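(* Assume $\mathbb{E}X_i=0$ and $X_i\in\mathcal L^\alpha$ for some $\alpha>2$, and $$\sum_{i=0}^{\infty}\|\mathcal P_0X_i\|_\alpha<\infty.$$ Let $(a_k)_{k\ge1}$ be a strictly increasing integer sequence with $a_1=1$ such that, as $m\to\infty$, $a_{m+1}-a_m\to\infty$ and $$\frac{(a_{m+1}-a_m)^2}{\sum_{k=2}^m (a_k-a_{k-1})^2}\to 0 .$$ Then $\|V_n/v_n-\sigma^2\|_{\alpha/2}\to 0$ as $n\to\infty$.
   Context: Let $(\varepsilon_i)_{i\in\mathbb Z}$ be i.i.d. random variables, let $\mathcal F_i$ denote the $\sigma$-field generated by $(\ldots,\varepsilon_{i-1},\varepsilon_i)$, and let $X_i=g(\ldots,\varepsilon_{i-1},\varepsilon_i)$ for a measurable function $g$ such that $X_i$ is well defined; $(X_i)_{i\in\mathbb Z}$ is then stationary. For a random variable $\xi$ and $p>0$, $\|\xi\|_p=(\mathbb E|\xi|^p)^{1/p}$, $\xi\in\mathcal L^p$ means $\|\xi\|_p<\infty$, and $\|\xi\|=\|\xi\|_2$. The projection operator is $\mathcal P_i\xi=\mathbb E(\xi\mid\mathcal F_i)-\mathbb E(\xi\mid\mathcal F_{i-1})$. When $\mathbb E X_i=0$ and $\sum_{i\ge0}\|\mathcal P_0X_i\|_2<\infty$, define $D_k=\sum_{i\ge k}\mathcal P_kX_i$ (convergent in $\mathcal L^2$) and $\sigma=\|D_0\|_2$ (the time-average variance constant). Given an integer sequence $(a_k)_{k\ge1}$ with $a_k\to\infty$, define for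 $i\ge1$: $t_i=\max(\{1\}\cup\{a_k:k\ge1,\ a_k\le i\})$, $W_i=X_{t_i}+X_{t_i+1}+\cdots+X_i$, $l_i=i-t_i+1$, and $V_n=\sum_{i=1}^nW_i^2$, $v_n=\sum_{i=1}^n l_i$. *)

theory Defs
  imports "HOL-Probability.Probability"
begin

definition Fsig :: "'a measure \<Rightarrow> 'b measure \<Rightarrow> (int \<Rightarrow> 'a \<Rightarrow> 'b) \<Rightarrow> int \<Rightarrow> 'a measure" where
  "Fsig M N eps i = sigma (space M) {eps j -` A \<inter> space M | j A. j \<le> i \<and> A \<in> sets N}"

definition proj :: "'a measure \<Rightarrow> 'b measure \<Rightarrow> (int \<Rightarrow> 'a \<Rightarrow> 'b) \<Rightarrow> int \<Rightarrow> ('a \<Rightarrow> real) \<Rightarrow> 'a \<Rightarrow> real" where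
  "proj M N eps i f = (\<lambda>x. real_cond_exp M (Fsig M N eps i) f x - real_cond_exp M (Fsig M N eps (i - 1)) f x)"

text \<open>X_i = g(..., eps_{i-1}, eps_i); the argument sequence is listed backwards: position j holds eps_{i-j}\<close>
definition bern_proc :: "(int \<Rightarrow> 'a \<Rightarrow> 'b) \<Rightarrow> ((nat \<Rightarrow> 'b) \<Rightarrow> real) \<Rightarrow> int \<Rightarrow> 'a \<Rightarrow> real" where
  "bern_proc eps g i x = g (\<lambda>j. eps (i - int j) x)"

definition Lpnorm :: "'a measure \<Rightarrow> real \<Rightarrow> ('a \<Rightarrow> real) \<Rightarrow> real" where
  "Lpnorm M p f = (\<integral>x. \<bar>f x\<bar> powr p \<partial>M) powr (1 / p)"

definition tpt :: "(nat \<Rightarrow> int) \<Rightarrow> int \<Rightarrow> int" where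
  "tpt a i = Max ({1} \<union> {a k | k. k \<ge> 1 \<and> a k \<le> i})"

definition Wblk :: "(int \<Rightarrow> 'a \<Rightarrow> real) \<Rightarrow> (nat \<Rightarrow> int) \<Rightarrow> int \<Rightarrow> 'a \<Rightarrow> real" where
  "Wblk X a i x = (\<Sum>j\<in>{tpt a i..i}. X j x)"

definition lblk :: "(nat \<Rightarrow> int) \<Rightarrow> int \<Rightarrow> int" where
  "lblk a i = i - tpt a i + 1"

definition Vn :: "(int \<Rightarrow> 'a \<Rightarrow> real) \<Rightarrow> (nat \<Rightarrow> int) \<Rightarrow> nat \<Rightarrow> 'a \<Rightarrow> real" where
  "Vn X a n x = (\<Sum>i\<in>{1..int n}. (Wblk X a i x)^2)"

definition vn :: "(nat \<Rightarrow> int) \<Rightarrow> nat \<Rightarrow> int" where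
  "vn a n = (\<Sum>i\<in>{1..int n}. lblk a i)"

end

theory Submission
  imports Defs
begin

text \<open>Let \<open>q > 1\<close> and \<open>r = min 2 q\<close>. Convexity gives
  \<open>\<parallel>S + d\<parallel>\<^sub>q\<^sup>r \<le> \<parallel>S\<parallel>\<^sub>q\<^sup>r + K \<parallel>d\<parallel>\<^sub>q\<^sup>r\<close> whenever \<open>d\<close> is orthogonal to \<open>sgn S \<bar>S\<bar>\<^bsup>q - 1\<^esup>\<close>, hence moment
  bounds for martingale sums. Decomposing \<open>X\<^sub>i\<close> into its innovations \<open>P\<^sub>i\<^sub>-\<^sub>j X\<^sub>i\<close> then yields
  \<open>\<parallel>\<Sum> X\<^sub>i\<parallel>\<^sub>\<alpha> = O(\<surd>l)\<close> for \<open>l\<close> consecutive terms, and an approximation by sums of the stationary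
  martingale differences \<open>D\<^sub>k = \<Sum>\<^sub>j\<^sub><\<^sub>m P\<^sub>k X\<^sub>k\<^sub>+\<^sub>j\<close> up to \<open>O(\<surd>l \<Sum>\<^sub>j\<^sub>\<ge>\<^sub>m \<parallel>P\<^sub>0 X\<^sub>j\<parallel>\<^sub>\<alpha>) + O(1)\<close>.
  Replacing \<open>X\<close> by \<open>D\<close> in \<open>V\<^sub>n\<close> therefore costs little relative to \<open>v\<^sub>n\<close>, as the block lengths \<open>L\<^sub>k\<close> diverge.
  The diagonal terms \<open>\<Sum> D\<^sub>j\<^sup>2\<close> obey a law of large numbers in \<open>\<L>\<^bsup>\<alpha>/2\<^esup>\<close>. The off-diagonal parts of the blocks
  are martingale differences of norm \<open>O(L\<^sub>k\<^sup>2)\<close>, and the moment bound in \<open>\<L>\<^bsup>\<alpha>/2\<^esup>\<close> makes their sum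
  negligible because \<open>L\<^sub>k\<^sup>2 = o(\<Sum>\<^sub>j\<^sub><\<^sub>k L\<^sub>j\<^sup>2)\<close>.\<close>

section \<open>Real inequalities\<close>

text \<open>The quadratic statistic has moments only of order \<alpha>/2 > 1, so second moments may
  be missing. This is why the moment bound has to cover every q > 1: a sum of l bounded martingale
  differences then grows like l^(1/min(2,q)), which is sublinear, while at order \<alpha> the rate
  is sqrt l. The truncation order m stays fixed while n tends to infinity and is released only at
  the end. Errors are kept in the form \<open>e * l + C\<close> with C independent of the position
  in time; summed over all positions in all blocks they give e v_n + C n, and n = o(v_n). Removing m
  innovations from X_k leaves E(X_k | F_(k-m)), which must approach the mean. This is Kolmogorov's
  zero-one law in L^q form. For cylinders it is exact from some m on; approximation extends it to
  L^q. A conditional expectation is determined only up to a null set, and separately at each time.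
  To make it stationary, it is computed once on the space of one-sided sequences under the law of
  the past, and the resulting function is evaluated at the past of every time.\<close>

lemma powr_tangent:
  fixes y \<theta> :: real
  assumes "0 \<le> y" "0 \<le> \<theta>" "\<theta> \<le> 1"
  shows "y powr \<theta> \<le> \<theta> * y + (1 - \<theta>)"
  using Youngs_inequality_0[of \<theta> "1 - \<theta>" y 1] assms by (cases "y = 0") auto

text \<open>Young's inequality with exponents q and q/(q-1), applied to u and v^(q-1); with
  denominators cleared it also holds at q = 1. It says that u^q lies above its tangent at v.\<close>

lemma powr_Young:
  fixes u v q :: real
  assumes "0 \<le> u" "0 \<le> v" "1 \<le> q"
  shows "q * (v powr (q - 1) * u) \<le> u powr q + (q - 1) * v powr q"
proof (cases "q = 1")
  case True
  then show ?thesis using assms by (cases "v = 0") auto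
next
  case False
  then have q: "q > 1" using assms by simp
  have "u * (v powr (q - 1)) \<le> u powr q / q + (v powr (q - 1)) powr (q/(q-1)) / (q/(q-1))"
    using Youngs_inequality[of q "q/(q-1)" u "v powr (q-1)"] q assms by (simp add: field_simps)
  also have "(v powr (q - 1)) powr (q/(q-1)) = v powr q"
    using q by (simp add: powr_powr)
  finally have "q * (u * (v powr (q - 1))) \<le> q * (u powr q / q + v powr q / (q/(q-1)))"
    using q by (intro mult_left_mono) auto
  also have "\<dots> = u powr q + (q - 1) * v powr q"
    using q by (simp add: field_simps)
  finally show ?thesis by (simp add: mult_ac)
qed

lemma convex_abs_powr:
  fixes q :: real
  assumes "1 \<le> q"
  shows "convex_on UNIV (\<lambda>x::real. \<bar>x\<bar> powr q)"
proof (rule convex_onI)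
  fix t x y :: real
  assume t: "0 < t" "t < 1"
  \<comment> \<open>Convexity on the closed half line; at an endpoint 0 it reduces to t^q \<le> t on
    (0,1).\<close>
  have nn: "((1 - t) * a + t * b) powr q \<le> (1 - t) * a powr q + t * b powr q"
    if ab: "0 \<le> a" "0 \<le> b" for a b
  proof -
    consider "a = 0" | "b = 0" | "a > 0" "b > 0" using ab by linarith
    then show ?thesis
    proof cases
      case 1
      have "t powr q \<le> t" using powr_mono'[of 1 q t] t assms by simp
      then show ?thesis using 1 ab by (simp add: powr_mult mult_right_mono)
    next
      case 2
      have "(1 - t) powr q \<le> 1 - t" using powr_mono'[of 1 q "1 - t"] t assms by simp
      then show ?thesis using 2 ab by (simp add: powr_mult mult_right_mono)
    next
      case 3
      then show ?thesis
        using convex_onD[OF powr_convex[OF assms], of t a b] t by simp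
    qed
  qed
  have "\<bar>(1 - t) *\<^sub>R x + t *\<^sub>R y\<bar> powr q \<le> ((1 - t) * \<bar>x\<bar> + t * \<bar>y\<bar>) powr q"
    using t assms by (intro powr_mono2) (auto simp: abs_mult intro!: order_trans[OF abs_triangle_ineq])
  also have "\<dots> \<le> (1 - t) * \<bar>x\<bar> powr q + t * \<bar>y\<bar> powr q"
    by (rule nn) auto
  finally show "\<bar>(1 - t) *\<^sub>R x + t *\<^sub>R y\<bar> powr q \<le> (1 - t) * \<bar>x\<bar> powr q + t * \<bar>y\<bar> powr q" .
qed auto

text \<open>In z^t = z^(t-1) z the first factor is enlarged to (a + x)^(t-1) for both z = a and z =
  x.\<close>

lemma powr_add_superadditive:
  fixes a x t :: real
  assumes "0 \<le> a" "0 \<le> x" "1 \<le> t"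
  shows "a powr t + x powr t \<le> (a + x) powr t"
proof -
  have e: "z powr t = z powr (t - 1) * z" if "z \<ge> 0" for z
    using that by (cases "z = 0") (auto simp: powr_diff)
  have "a powr (t - 1) * a + x powr (t - 1) * x \<le> (a + x) powr (t - 1) * a + (a + x) powr (t - 1) * x"
    using assms by (intro add_mono mult_right_mono powr_mono2) auto
  then show ?thesis using e[of a] e[of x] e[of "a + x"] assms by (simp add: algebra_simps)
qed

lemma powr_add_subadditive:
  fixes a x t :: real
  assumes "0 \<le> a" "0 \<le> x" "0 < t" "t \<le> 1"
  shows "(a + x) powr t \<le> a powr t + x powr t"
proof -
  have "(a powr t) powr (1/t) + (x powr t) powr (1/t) \<le> (a powr t + x powr t) powr (1/t)"
    using assms by (intro powr_add_superadditive) auto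
  then have "a + x \<le> (a powr t + x powr t) powr (1/t)"
    using assms by (simp add: powr_powr)
  then have "(a + x) powr t \<le> ((a powr t + x powr t) powr (1/t)) powr t"
    using assms by (intro powr_mono2) auto
  then show ?thesis using assms by (simp add: powr_powr)
qed

lemma abs_add_powr_le:
  fixes x y q :: real
  assumes "0 \<le> q"
  shows "\<bar>x + y\<bar> powr q \<le> 2 powr q * (\<bar>x\<bar> powr q + \<bar>y\<bar> powr q)"
proof -
  have "\<bar>x + y\<bar> powr q \<le> (2 * max \<bar>x\<bar> \<bar>y\<bar>) powr q"
    using assms by (intro powr_mono2) auto
  also have "\<dots> = 2 powr q * max \<bar>x\<bar> \<bar>y\<bar> powr q" by (simp add: powr_mult)
  also have "max \<bar>x\<bar> \<bar>y\<bar> powr q \<le> \<bar>x\<bar> powr q + \<bar>y\<bar> powr q" by (simp add: max_def)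
  finally show ?thesis by simp
qed

section \<open>Tangent lines and smoothness of the power |x|^q\<close>

definition signed_powr :: "real \<Rightarrow> real \<Rightarrow> real" where
  "signed_powr s x = sgn x * \<bar>x\<bar> powr s"

lemma abs_signed_powr: "\<bar>signed_powr s x\<bar> = \<bar>x\<bar> powr s"
  by (cases "x = 0") (auto simp: signed_powr_def abs_mult)

lemma measurable_signed_powr [measurable]: "signed_powr s \<in> borel_measurable borel"
  unfolding signed_powr_def[abs_def] by measurable

text \<open>\<open>q * signed_powr (q - 1) v\<close> is the derivative of |v|^q, so this is the
  tangent inequality of a convex function; Young's inequality gives it without
  differentiation.\<close>

lemma abs_powr_subgradient:
  fixes u v q :: real
  assumes "1 \<le> q"
  shows "\<bar>v\<bar> powr q + q * (signed_powr (q - 1) v * (u - v)) \<le> \<bar>u\<bar> powr q"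
proof -
  have v: "signed_powr (q - 1) v * v = \<bar>v\<bar> powr q"
    by (cases "v = 0") (auto simp: signed_powr_def powr_diff sgn_if)
  have "signed_powr (q - 1) v * u \<le> \<bar>v\<bar> powr (q - 1) * \<bar>u\<bar>"
    using abs_ge_self[of "signed_powr (q - 1) v * u"] by (simp add: abs_mult abs_signed_powr)
  then have "q * (signed_powr (q - 1) v * u) \<le> q * (\<bar>v\<bar> powr (q - 1) * \<bar>u\<bar>)"
    using assms by (intro mult_left_mono) auto
  also have "\<dots> \<le> \<bar>u\<bar> powr q + (q - 1) * \<bar>v\<bar> powr q"
    using assms by (intro powr_Young) auto
  also have "\<dots> = \<bar>u\<bar> powr q + q * (signed_powr (q - 1) v * v) - \<bar>v\<bar> powr q"
    unfolding v by (simp add: algebra_simps)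
  finally show ?thesis by (simp add: right_diff_distrib)
qed

text \<open>For equal signs subadditivity of the power gives the constant 1; for opposite signs |a|
  and |b| are each at most |a - b|, which costs the factor 2.\<close>

lemma signed_powr_diff_le_1:
  assumes s: "0 < s" "s \<le> 1"
  shows "\<bar>signed_powr s a - signed_powr s b\<bar> \<le> 2 * \<bar>a - b\<bar> powr s"
proof -
  have pos: "\<bar>x powr s - y powr s\<bar> \<le> \<bar>x - y\<bar> powr s" if "0 \<le> x" "0 \<le> y" for x y
  proof -
    have *: "u powr s - v powr s \<le> (u - v) powr s" if "0 \<le> v" "v \<le> u" for u v
      using powr_add_subadditive[of v "u - v" s] that s by auto
    have m: "u powr s \<le> v powr s" if "0 \<le> u" "u \<le> v" for u v
      using that s by (intro powr_mono2) auto
    show ?thesis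
      using *[of x y] *[of y x] m[of x y] m[of y x] that by (cases "x \<le> y") auto
  qed
  consider "0 \<le> a" "0 \<le> b" | "a \<le> 0" "b \<le> 0" | "a < 0" "0 < b" | "b < 0" "0 < a" by linarith
  then show ?thesis
  proof cases
    case 1
    then show ?thesis using pos[of a b] by (auto simp: signed_powr_def sgn_if)
  next
    case 2
    have "signed_powr s a - signed_powr s b = (-b) powr s - (-a) powr s"
      using 2 by (auto simp: signed_powr_def sgn_if)
    then show ?thesis using pos[of "-b" "-a"] 2 by auto
  next
    case 3
    have "\<bar>a\<bar> powr s \<le> \<bar>a - b\<bar> powr s" "\<bar>b\<bar> powr s \<le> \<bar>a - b\<bar> powr s"
      using 3 s by (auto intro!: powr_mono2)
    moreover have "\<bar>signed_powr s a - signed_powr s b\<bar> \<le> \<bar>a\<bar> powr s + \<bar>b\<bar> powr s"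
      unfolding abs_signed_powr[symmetric] by (rule abs_triangle_ineq4)
    ultimately show ?thesis by simp
  next
    case 4
    have "\<bar>a\<bar> powr s \<le> \<bar>a - b\<bar> powr s" "\<bar>b\<bar> powr s \<le> \<bar>a - b\<bar> powr s"
      using 4 s by (auto intro!: powr_mono2)
    moreover have "\<bar>signed_powr s a - signed_powr s b\<bar> \<le> \<bar>a\<bar> powr s + \<bar>b\<bar> powr s"
      unfolding abs_signed_powr[symmetric] by (rule abs_triangle_ineq4)
    ultimately show ?thesis by simp
  qed
qed

lemma signed_powr_diff_ge_1:
  assumes s: "1 \<le> s"
  shows "\<bar>signed_powr s a - signed_powr s b\<bar> \<le> s * (max \<bar>a\<bar> \<bar>b\<bar> powr (s - 1) * \<bar>a - b\<bar>)"
proof -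
  have e: "z powr s = z powr (s - 1) * z" if "z \<ge> 0" for z
    using that by (cases "z = 0") (auto simp: powr_diff)
  have pos: "\<bar>x powr s - y powr s\<bar> \<le> s * (max x y powr (s - 1) * \<bar>x - y\<bar>)" if "0 \<le> x" "0 \<le> y" for x y
  proof -
    have *: "u powr s - v powr s \<le> s * (u powr (s - 1) * (u - v))" if "0 \<le> v" "v \<le> u" for u v
      using powr_Young[of v u s] e[of u] that s by (simp add: algebra_simps)
    have m: "u powr s \<le> v powr s" if "0 \<le> u" "u \<le> v" for u v
      using that s by (intro powr_mono2) auto
    show ?thesis
      using *[of x y] *[of y x] m[of x y] m[of y x] that by (cases "x \<le> y") (auto simp: max_def)
  qed
  have opp: "x powr s + y powr s \<le> s * (max x y powr (s - 1) * (x + y))" if "0 \<le> x" "0 \<le> y" for x y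
  proof -
    have "x powr s + y powr s \<le> max x y powr (s - 1) * x + max x y powr (s - 1) * y"
      unfolding e[OF that(1)] e[OF that(2)] using that s
      by (intro add_mono mult_right_mono powr_mono2) auto
    also have "\<dots> = 1 * (max x y powr (s - 1) * (x + y))" by (simp add: algebra_simps)
    also have "\<dots> \<le> s * (max x y powr (s - 1) * (x + y))" using s that by (intro mult_right_mono) auto
    finally show ?thesis .
  qed
  consider "0 \<le> a" "0 \<le> b" | "a \<le> 0" "b \<le> 0" | "a < 0" "0 < b" | "b < 0" "0 < a" by linarith
  then show ?thesis
  proof cases
    case 1
    then show ?thesis using pos[of a b] by (auto simp: signed_powr_def sgn_if)
  next
    case 2
    have "signed_powr s a - signed_powr s b = (-b) powr s - (-a) powr s"
      using 2 by (auto simp: signed_powr_def sgn_if)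
    then show ?thesis using pos[of "-b" "-a"] 2 by (auto simp: max.commute)
  next
    case 3
    have "\<bar>signed_powr s a - signed_powr s b\<bar> \<le> (-a) powr s + b powr s"
      using abs_triangle_ineq4[of "signed_powr s a" "signed_powr s b"] 3 by (simp add: abs_signed_powr)
    then show ?thesis using opp[of "-a" b] 3 by auto
  next
    case 4
    have "\<bar>signed_powr s a - signed_powr s b\<bar> \<le> a powr s + (-b) powr s"
      using abs_triangle_ineq4[of "signed_powr s a" "signed_powr s b"] 4 by (simp add: abs_signed_powr)
    then show ?thesis using opp[of a "-b"] 4 by auto
  qed
qed

text \<open>Up to the factor q, the Hoelder constant 2 serves q \<le> 2 and (q - 1) 2^(q - 2) serves
  q \<ge> 2; their sum is one constant for every q > 1.\<close>

definition smooth_const :: "real \<Rightarrow> real" where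
  "smooth_const q = q * (2 + (q - 1) * 2 powr (q - 2))"

text \<open>The tangent is taken at x + y instead of x, which bounds |x + y|^q from above by |x|^q +
  q phi(x + y) y, with phi the signed power of order q - 1. Replacing phi(x + y) by phi(x) costs at
  most 2 |y|^(q-1) |y|.\<close>

lemma abs_powr_smooth_le_2:
  fixes x y q :: real
  assumes q: "1 < q" "q \<le> 2"
  shows "\<bar>x + y\<bar> powr q \<le> \<bar>x\<bar> powr q + q * (signed_powr (q - 1) x * y) + smooth_const q * \<bar>y\<bar> powr q"
proof -
  have "\<bar>x + y\<bar> powr q + q * (signed_powr (q - 1) (x + y) * (- y)) \<le> \<bar>x\<bar> powr q"
    using abs_powr_subgradient[of q "x + y" x] q by simp
  moreover have "(signed_powr (q - 1) (x + y) - signed_powr (q - 1) x) * y \<le> 2 * \<bar>y\<bar> powr q"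
  proof -
    have "(signed_powr (q - 1) (x + y) - signed_powr (q - 1) x) * y
        \<le> \<bar>signed_powr (q - 1) (x + y) - signed_powr (q - 1) x\<bar> * \<bar>y\<bar>"
      by (metis abs_ge_self abs_mult)
    also have "\<dots> \<le> (2 * \<bar>x + y - x\<bar> powr (q - 1)) * \<bar>y\<bar>"
      using q by (intro mult_right_mono signed_powr_diff_le_1) auto
    also have "\<dots> = 2 * \<bar>y\<bar> powr q"
      by (cases "y = 0") (auto simp: powr_diff)
    finally show ?thesis .
  qed
  then have "q * ((signed_powr (q - 1) (x + y) - signed_powr (q - 1) x) * y) \<le> q * (2 * \<bar>y\<bar> powr q)"
    using q by (intro mult_left_mono) auto
  moreover have "q * (2 * \<bar>y\<bar> powr q) \<le> smooth_const q * \<bar>y\<bar> powr q"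
    unfolding mult.assoc[symmetric] using q by (intro mult_right_mono) (auto simp: smooth_const_def)
  ultimately show ?thesis by (simp add: algebra_simps)
qed

text \<open>Again the tangent at x + y. The increment of phi is now at most (q - 1) |y| times a
  power q - 2 of |x| + |y|, and splitting that power yields the two remainder terms.\<close>

lemma abs_powr_smooth_ge_2:
  fixes x y q :: real
  assumes q: "2 \<le> q"
  shows "\<bar>x + y\<bar> powr q \<le> \<bar>x\<bar> powr q + q * (signed_powr (q - 1) x * y)
           + smooth_const q * (\<bar>x\<bar> powr (q - 2) * y\<^sup>2 + \<bar>y\<bar> powr q)"
proof -
  let ?R = "\<bar>x\<bar> powr (q - 2) * y\<^sup>2 + \<bar>y\<bar> powr q"
  have "\<bar>x + y\<bar> powr q + q * (signed_powr (q - 1) (x + y) * (- y)) \<le> \<bar>x\<bar> powr q"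
    using abs_powr_subgradient[of q "x + y" x] q by simp
  moreover have "(signed_powr (q - 1) (x + y) - signed_powr (q - 1) x) * y \<le> (q - 1) * 2 powr (q - 2) * ?R"
  proof -
    have "(signed_powr (q - 1) (x + y) - signed_powr (q - 1) x) * y
        \<le> \<bar>signed_powr (q - 1) (x + y) - signed_powr (q - 1) x\<bar> * \<bar>y\<bar>"
      by (metis abs_ge_self abs_mult)
    also have "\<dots> \<le> ((q - 1) * (max \<bar>x + y\<bar> \<bar>x\<bar> powr (q - 1 - 1) * \<bar>x + y - x\<bar>)) * \<bar>y\<bar>"
      using q by (intro mult_right_mono signed_powr_diff_ge_1) auto
    also have "\<dots> = (q - 1) * (max \<bar>x + y\<bar> \<bar>x\<bar> powr (q - 2) * y\<^sup>2)"
      by (simp add: power2_eq_square)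
    also have "\<dots> \<le> (q - 1) * ((2 powr (q - 2) * (\<bar>x\<bar> powr (q - 2) + \<bar>y\<bar> powr (q - 2))) * y\<^sup>2)"
    proof (intro mult_left_mono mult_right_mono)
      have "max \<bar>x + y\<bar> \<bar>x\<bar> powr (q - 2) \<le> \<bar>\<bar>x\<bar> + \<bar>y\<bar>\<bar> powr (q - 2)"
        using q by (intro powr_mono2) auto
      also have "\<dots> \<le> 2 powr (q - 2) * (\<bar>x\<bar> powr (q - 2) + \<bar>y\<bar> powr (q - 2))"
        using abs_add_powr_le[of "q - 2" "\<bar>x\<bar>" "\<bar>y\<bar>"] q by simp
      finally show "max \<bar>x + y\<bar> \<bar>x\<bar> powr (q - 2) \<le> 2 powr (q - 2) * (\<bar>x\<bar> powr (q - 2) + \<bar>y\<bar> powr (q - 2))" .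
    qed (use q in auto)
    also have "\<dots> = (q - 1) * 2 powr (q - 2) * ?R"
    proof -
      have y: "\<bar>y\<bar> powr q = \<bar>y\<bar> powr (q - 2) * y\<^sup>2"
        by (cases "y = 0") (auto simp: powr_diff)
      show ?thesis unfolding y by (simp add: algebra_simps)
    qed
    finally show ?thesis .
  qed
  then have "q * ((signed_powr (q - 1) (x + y) - signed_powr (q - 1) x) * y) \<le> q * ((q - 1) * 2 powr (q - 2) * ?R)"
    using q by (intro mult_left_mono) auto
  moreover have "q * ((q - 1) * 2 powr (q - 2) * ?R) \<le> smooth_const q * ?R"
  proof -
    have "q * ((q - 1) * 2 powr (q - 2)) \<le> smooth_const q"
      using q by (auto simp: smooth_const_def algebra_simps)
    then show ?thesis by (metis (no_types, lifting) mult.assoc mult_right_mono add_nonneg_nonneg mult_nonneg_nonneg powr_ge_zero zero_le_power2)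
  qed
  ultimately show ?thesis by (simp add: algebra_simps)
qed

lemma smooth_const_pos: "1 < q \<Longrightarrow> smooth_const q > 0"
  unfolding smooth_const_def by (intro mult_pos_pos add_pos_nonneg) auto

section \<open>The spaces of p-integrable functions\<close>

text \<open>The Bochner integral of a nonintegrable function is 0, so a bound on
  \<open>Lpnorm\<close> alone carries no integrability; this predicate records it.\<close>

definition in_Lp :: "'a measure \<Rightarrow> real \<Rightarrow> ('a \<Rightarrow> real) \<Rightarrow> bool" where
  "in_Lp M q f \<longleftrightarrow> f \<in> borel_measurable M \<and> integrable M (\<lambda>x. \<bar>f x\<bar> powr q)"

lemma in_LpD [dest]:
  assumes "in_Lp M q f"
  shows "f \<in> borel_measurable M" "integrable M (\<lambda>x. \<bar>f x\<bar> powr q)"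
  using assms by (auto simp: in_Lp_def)

lemma in_Lp_measurable [measurable_dest]: "in_Lp M q f \<Longrightarrow> f \<in> borel_measurable M" by auto

lemma Lpnorm_nonneg [simp]: "0 \<le> Lpnorm M q f" by (simp add: Lpnorm_def)

lemma Lpnorm_powr:
  assumes "q > 0"
  shows "Lpnorm M q f powr q = (\<integral>x. \<bar>f x\<bar> powr q \<partial>M)"
  using assms by (simp add: Lpnorm_def powr_powr)

lemma Lpnorm_le_iff:
  assumes "q > 0" "0 \<le> B"
  shows "Lpnorm M q f \<le> B \<longleftrightarrow> (\<integral>x. \<bar>f x\<bar> powr q \<partial>M) \<le> B powr q"
proof
  assume "Lpnorm M q f \<le> B"
  then have "Lpnorm M q f powr q \<le> B powr q" using assms by (intro powr_mono2) auto
  then show "(\<integral>x. \<bar>f x\<bar> powr q \<partial>M) \<le> B powr q" using Lpnorm_powr[OF assms(1)] by metis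
next
  assume "(\<integral>x. \<bar>f x\<bar> powr q \<partial>M) \<le> B powr q"
  then have "(\<integral>x. \<bar>f x\<bar> powr q \<partial>M) powr (1/q) \<le> (B powr q) powr (1/q)"
    using assms by (intro powr_mono2) auto
  then show "Lpnorm M q f \<le> B" using assms by (simp add: Lpnorm_def powr_powr)
qed

lemma in_Lp_cong_AE:
  assumes "AE x in M. f x = g x" "f \<in> borel_measurable M" "g \<in> borel_measurable M"
  shows "in_Lp M q f \<longleftrightarrow> in_Lp M q g"
proof -
  have "AE x in M. \<bar>f x\<bar> powr q = \<bar>g x\<bar> powr q"
    using assms(1) by eventually_elim simp
  then have "integrable M (\<lambda>x. \<bar>f x\<bar> powr q) \<longleftrightarrow> integrable M (\<lambda>x. \<bar>g x\<bar> powr q)"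
    using assms(2,3) by (intro integrable_cong_AE) auto
  then show ?thesis using assms(2,3) by (simp add: in_Lp_def)
qed

lemma Lpnorm_cong_AE:
  assumes "AE x in M. f x = g x" "f \<in> borel_measurable M" "g \<in> borel_measurable M"
  shows "Lpnorm M q f = Lpnorm M q g"
  unfolding Lpnorm_def using assms by (intro arg_cong2[where f="(powr)"] integral_cong_AE) auto

lemma in_Lp_bound_AE:
  assumes "in_Lp M q g" "f \<in> borel_measurable M" "AE x in M. \<bar>f x\<bar> \<le> \<bar>g x\<bar>" "0 \<le> q"
  shows "in_Lp M q f"
  unfolding in_Lp_def
proof
  show "integrable M (\<lambda>x. \<bar>f x\<bar> powr q)"
  proof (rule Bochner_Integration.integrable_bound)
    show "integrable M (\<lambda>x. \<bar>g x\<bar> powr q)" using assms by auto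
    show "AE x in M. norm (\<bar>f x\<bar> powr q) \<le> norm (\<bar>g x\<bar> powr q)"
      using assms(3) by eventually_elim (auto intro!: powr_mono2 assms)
  qed (use assms in auto)
qed fact

lemma in_Lp_cmult:
  assumes "in_Lp M q f"
  shows "in_Lp M q (\<lambda>x. c * f x)"
  using assms by (auto simp: in_Lp_def abs_mult powr_mult)

lemma Lpnorm_cmult:
  assumes "q > 0"
  shows "Lpnorm M q (\<lambda>x. c * f x) = \<bar>c\<bar> * Lpnorm M q f"
  using assms by (simp add: Lpnorm_def abs_mult powr_mult powr_powr)

lemma in_Lp_uminus: "in_Lp M q f \<Longrightarrow> in_Lp M q (\<lambda>x. - f x)"
  by (simp add: in_Lp_def)

lemma Lpnorm_uminus: "Lpnorm M q (\<lambda>x. - f x) = Lpnorm M q f"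
  by (simp add: Lpnorm_def)

lemma Lpnorm_minus_commute: "Lpnorm M q (\<lambda>x. f x - g x) = Lpnorm M q (\<lambda>x. g x - f x)"
  by (simp add: Lpnorm_def abs_minus_commute)

lemma in_Lp_add:
  assumes [measurable]: "in_Lp M q f" "in_Lp M q g" and "0 \<le> q"
  shows "in_Lp M q (\<lambda>x. f x + g x)"
  unfolding in_Lp_def
proof
  show "(\<lambda>x. f x + g x) \<in> borel_measurable M" by measurable
  show "integrable M (\<lambda>x. \<bar>f x + g x\<bar> powr q)"
  proof (rule Bochner_Integration.integrable_bound)
    show "integrable M (\<lambda>x. 2 powr q * (\<bar>f x\<bar> powr q + \<bar>g x\<bar> powr q))"
      using assms by auto
    show "AE x in M. norm (\<bar>f x + g x\<bar> powr q) \<le> norm (2 powr q * (\<bar>f x\<bar> powr q + \<bar>g x\<bar> powr q))"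
      using abs_add_powr_le[of q] assms by auto
  qed (use assms in auto)
qed

lemma in_Lp_diff:
  assumes "in_Lp M q f" "in_Lp M q g" "0 \<le> q"
  shows "in_Lp M q (\<lambda>x. f x - g x)"
  using in_Lp_add[OF assms(1) in_Lp_uminus[OF assms(2)] assms(3)] by simp

lemma in_Lp_zero [simp]: "in_Lp M q (\<lambda>x. 0)" by (simp add: in_Lp_def)

lemma Lpnorm_zero [simp]: "Lpnorm M q (\<lambda>x. 0) = 0" by (simp add: Lpnorm_def)

lemma in_Lp_sum:
  assumes "\<And>i. i \<in> I \<Longrightarrow> in_Lp M q (f i)" "0 \<le> q"
  shows "in_Lp M q (\<lambda>x. \<Sum>i\<in>I. f i x)"
  using assms by (induction I rule: infinite_finite_induct) (auto intro!: in_Lp_add)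

lemma Lpnorm_eq_0_AE:
  assumes "in_Lp M q f" "q > 0" "Lpnorm M q f = 0"
  shows "AE x in M. f x = 0"
proof -
  have "(\<integral>x. \<bar>f x\<bar> powr q \<partial>M) = 0" using Lpnorm_powr[OF assms(2), of M f] assms by simp
  then have "AE x in M. \<bar>f x\<bar> powr q = 0"
    using assms by (subst (asm) integral_nonneg_eq_0_iff_AE) auto
  then show ?thesis by eventually_elim auto
qed

text \<open>With A and B the two norms, (f + g)/(A + B) is the convex combination of f/A and g/B
  with weights A/(A + B) and B/(A + B); convexity of |x|^q is then integrated. A vanishing norm
  cannot be normalised and is treated through a.e. equality.\<close>

lemma Lpnorm_triangle:
  assumes f: "in_Lp M q f" and g: "in_Lp M q g" and q: "1 \<le> q"
  shows "Lpnorm M q (\<lambda>x. f x + g x) \<le> Lpnorm M q f + Lpnorm M q g"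
proof -
  define A B where "A = Lpnorm M q f" and "B = Lpnorm M q g"
  note [measurable] = in_Lp_measurable[OF f] in_Lp_measurable[OF g]
  have nn: "A \<ge> 0" "B \<ge> 0" by (auto simp: A_def B_def)
  consider "A = 0" | "B = 0" | "A > 0" "B > 0" using nn by linarith
  then show ?thesis
  proof cases
    case 1
    then have "AE x in M. f x = 0" using Lpnorm_eq_0_AE[OF f] q by (auto simp: A_def)
    then have "AE x in M. f x + g x = g x" by eventually_elim auto
    then have "Lpnorm M q (\<lambda>x. f x + g x) = Lpnorm M q g" by (rule Lpnorm_cong_AE) auto
    then show ?thesis by simp
  next
    case 2
    then have "AE x in M. g x = 0" using Lpnorm_eq_0_AE[OF g] q by (auto simp: B_def)
    then have "AE x in M. f x + g x = f x" by eventually_elim auto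
    then have "Lpnorm M q (\<lambda>x. f x + g x) = Lpnorm M q f" by (rule Lpnorm_cong_AE) auto
    then show ?thesis by simp
  next
    case 3
    define S where "S = A + B"
    have S: "S > 0" using 3 by (simp add: S_def)
    have t: "1 - B / S = A / S" using S by (auto simp: S_def field_simps)
    have "\<bar>f x + g x\<bar> powr q \<le> S powr q * (A / S * (\<bar>f x\<bar> powr q / A powr q) + B / S * (\<bar>g x\<bar> powr q / B powr q))" for x
    proof -
      have "\<bar>(1 - B / S) *\<^sub>R (f x / A) + (B / S) *\<^sub>R (g x / B)\<bar> powr q
          \<le> (1 - B / S) * \<bar>f x / A\<bar> powr q + B / S * \<bar>g x / B\<bar> powr q"
        using 3 S by (intro convex_onD[OF convex_abs_powr[OF q]]) (auto simp: S_def)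
      then have *: "\<bar>(f x + g x) / S\<bar> powr q \<le> A / S * (\<bar>f x\<bar> powr q / A powr q) + B / S * (\<bar>g x\<bar> powr q / B powr q)"
        unfolding t using 3 by (simp add: powr_divide add_divide_distrib)
      have "\<bar>f x + g x\<bar> powr q = S powr q * \<bar>(f x + g x) / S\<bar> powr q"
        using S by (simp add: powr_divide)
      then show ?thesis using mult_left_mono[OF *, of "S powr q"] by simp
    qed
    then have "(\<integral>x. \<bar>f x + g x\<bar> powr q \<partial>M)
       \<le> (\<integral>x. S powr q * (A / S * (\<bar>f x\<bar> powr q / A powr q) + B / S * (\<bar>g x\<bar> powr q / B powr q)) \<partial>M)"
      using f g in_Lp_add[OF f g] q
      by (intro integral_mono integrable_mult_right Bochner_Integration.integrable_add integrable_divide) auto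
    also have "\<dots> = S powr q * (A / S * ((\<integral>x. \<bar>f x\<bar> powr q \<partial>M) / A powr q) + B / S * ((\<integral>x. \<bar>g x\<bar> powr q \<partial>M) / B powr q))"
      using f g by (subst integral_mult_right_zero, subst Bochner_Integration.integral_add) auto
    also have "(\<integral>x. \<bar>f x\<bar> powr q \<partial>M) = A powr q"
      using Lpnorm_powr[of q M f] q by (simp add: A_def)
    also have "(\<integral>x. \<bar>g x\<bar> powr q \<partial>M) = B powr q"
      using Lpnorm_powr[of q M g] q by (simp add: B_def)
    also have "S powr q * (A / S * (A powr q / A powr q) + B / S * (B powr q / B powr q)) = S powr q"
      using 3 S by (simp add: S_def flip: add_divide_distrib)
    finally show ?thesis
      using Lpnorm_le_iff[of q S M "\<lambda>x. f x + g x"] S q by (simp add: S_def A_def B_def)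
  qed
qed

lemma Lpnorm_triangle_diff:
  assumes "in_Lp M q f" and "in_Lp M q g" and "1 \<le> q"
  shows "Lpnorm M q (\<lambda>x. f x - g x) \<le> Lpnorm M q f + Lpnorm M q g"
  using Lpnorm_triangle[OF assms(1) in_Lp_uminus[OF assms(2)] assms(3)] by (simp add: Lpnorm_uminus)

lemma Lpnorm_triangle_via:
  assumes "in_Lp M q f" "in_Lp M q g" "in_Lp M q h" "1 \<le> q"
  shows "Lpnorm M q (\<lambda>x. f x - h x) \<le> Lpnorm M q (\<lambda>x. f x - g x) + Lpnorm M q (\<lambda>x. g x - h x)"
  using Lpnorm_triangle[OF in_Lp_diff[OF assms(1,2)] in_Lp_diff[OF assms(2,3)] assms(4)] assms(4) by simp

lemma Lpnorm_reverse_triangle: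
  assumes "in_Lp M q f" and "in_Lp M q g" and "1 \<le> q"
  shows "\<bar>Lpnorm M q f - Lpnorm M q g\<bar> \<le> Lpnorm M q (\<lambda>x. f x - g x)"
  using Lpnorm_triangle[OF in_Lp_diff[OF assms(1,2)] assms(2,3)]
    Lpnorm_triangle[OF in_Lp_diff[OF assms(2,1)] assms(1,3)] assms(3) Lpnorm_minus_commute[of M q f g]
  by (simp add: abs_le_iff)

lemma Lpnorm_sum:
  assumes "\<And>i. i \<in> I \<Longrightarrow> in_Lp M q (f i)" "1 \<le> q"
  shows "Lpnorm M q (\<lambda>x. \<Sum>i\<in>I. f i x) \<le> (\<Sum>i\<in>I. Lpnorm M q (f i))"
  using assms
proof (induction I rule: infinite_finite_induct)
  case (insert i I)
  have "Lpnorm M q (\<lambda>x. f i x + (\<Sum>i\<in>I. f i x)) \<le> Lpnorm M q (f i) + Lpnorm M q (\<lambda>x. \<Sum>i\<in>I. f i x)"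
    using insert by (intro Lpnorm_triangle in_Lp_sum) auto
  also have "\<dots> \<le> Lpnorm M q (f i) + (\<Sum>i\<in>I. Lpnorm M q (f i))"
    using insert by auto
  finally show ?case using insert by simp
qed auto

section \<open>Hoelder's inequality and comparison of norms of different order\<close>

lemma Hoelder_weighted:
  fixes F G :: "'a \<Rightarrow> real"
  assumes F: "integrable M F" "\<And>x. 0 \<le> F x" and G: "integrable M G" "\<And>x. 0 \<le> G x"
    and uv: "0 < u" "0 < v" "u + v = 1"
  shows "integrable M (\<lambda>x. F x powr u * G x powr v)"
    and "(\<integral>x. F x powr u * G x powr v \<partial>M) \<le> (\<integral>x. F x \<partial>M) powr u * (\<integral>x. G x \<partial>M) powr v"
proof -
  note [measurable] = borel_measurable_integrable[OF F(1)] borel_measurable_integrable[OF G(1)]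
  have Y: "a powr u * b powr v \<le> u * a + v * b" if "0 \<le> a" "0 \<le> b" for a b
    using Youngs_inequality_0[of u v a b] uv that by (cases "a = 0 \<or> b = 0") auto
  show int: "integrable M (\<lambda>x. F x powr u * G x powr v)"
  proof (rule Bochner_Integration.integrable_bound)
    show "integrable M (\<lambda>x. u * F x + v * G x)" using F G by auto
    show "AE x in M. norm (F x powr u * G x powr v) \<le> norm (u * F x + v * G x)"
      using Y F G uv by (auto simp: abs_mult)
  qed auto
  define A B where "A = (\<integral>x. F x \<partial>M)" and "B = (\<integral>x. G x \<partial>M)"
  have nn: "A \<ge> 0" "B \<ge> 0" using F G by (auto simp: A_def B_def intro!: integral_nonneg)
  have z: "(\<integral>x. F x powr u * G x powr v \<partial>M) = 0" if "A = 0 \<or> B = 0"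
  proof -
    have "(AE x in M. F x = 0) \<or> (AE x in M. G x = 0)"
      using that F G by (auto simp: A_def B_def integral_nonneg_eq_0_iff_AE)
    then have "AE x in M. F x powr u * G x powr v = 0"
    proof
      assume "AE x in M. F x = 0"
      then show ?thesis by eventually_elim simp
    next
      assume "AE x in M. G x = 0"
      then show ?thesis by eventually_elim simp
    qed
    then show ?thesis by (simp add: integral_eq_zero_AE)
  qed
  show "(\<integral>x. F x powr u * G x powr v \<partial>M) \<le> A powr u * B powr v"
  proof (cases "A = 0 \<or> B = 0")
    case True
    then show ?thesis using z by auto
  next
    case False
    then have pos: "A > 0" "B > 0" using nn by auto
    \<comment> \<open>Pointwise Young inequality for the normalised functions F/A and G/B; after
      integration the weights add up to u + v = 1.\<close>
    have "(\<integral>x. F x powr u * G x powr v \<partial>M) \<le> (\<integral>x. A powr u * B powr v * (u * (F x / A) + v * (G x / B)) \<partial>M)"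
    proof (rule integral_mono[OF int])
      fix x
      have "(F x / A) powr u * (G x / B) powr v \<le> u * (F x / A) + v * (G x / B)"
        using F G pos by (intro Y) auto
      then have "A powr u * B powr v * ((F x / A) powr u * (G x / B) powr v) \<le> A powr u * B powr v * (u * (F x / A) + v * (G x / B))"
        by (intro mult_left_mono) auto
      then show "F x powr u * G x powr v \<le> A powr u * B powr v * (u * (F x / A) + v * (G x / B))"
        using pos by (simp add: powr_divide)
    qed (use F G in auto)
    also have "\<dots> = A powr u * B powr v * (u * (A / A) + v * (B / B))"
      using F G by (subst integral_mult_right_zero, subst Bochner_Integration.integral_add)
        (auto simp: A_def B_def)
    also have "\<dots> = A powr u * B powr v" using pos uv by simp
    finally show ?thesis .
  qed
qed

text \<open>Cauchy-Schwarz for |f|^p and |g|^p. This is the passage from linear sums in the norm of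
  order \<alpha> to their squares in the norm of order \<alpha>/2.\<close>

lemma in_Lp_mult:
  assumes f: "in_Lp M (2 * p) f" and g: "in_Lp M (2 * p) g" and p: "p > 0"
  shows "in_Lp M p (\<lambda>x. f x * g x)"
    and "Lpnorm M p (\<lambda>x. f x * g x) \<le> Lpnorm M (2 * p) f * Lpnorm M (2 * p) g"
proof -
  let ?F = "\<lambda>x. \<bar>f x\<bar> powr (2 * p)" and ?G = "\<lambda>x. \<bar>g x\<bar> powr (2 * p)"
  have e: "\<bar>f x * g x\<bar> powr p = ?F x powr (1/2) * ?G x powr (1/2)" for x
    by (simp add: powr_powr abs_mult powr_mult)
  note H = Hoelder_weighted[of M ?F ?G "1/2" "1/2"]
  show "in_Lp M p (\<lambda>x. f x * g x)"
    unfolding in_Lp_def e using f g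
    by (intro conjI borel_measurable_times H) auto
  have "(\<integral>x. \<bar>f x * g x\<bar> powr p \<partial>M) \<le> (\<integral>x. ?F x \<partial>M) powr (1/2) * (\<integral>x. ?G x \<partial>M) powr (1/2)"
    unfolding e using f g by (intro H) auto
  also have "\<dots> = (Lpnorm M (2 * p) f * Lpnorm M (2 * p) g) powr p"
    using p by (simp add: Lpnorm_def powr_mult powr_powr)
  finally show "Lpnorm M p (\<lambda>x. f x * g x) \<le> Lpnorm M (2 * p) f * Lpnorm M (2 * p) g"
    using p by (subst Lpnorm_le_iff) auto
qed

lemma (in prob_space) Lpnorm_mono_exponent:
  assumes f: "in_Lp M q f" and p: "0 < p" "p \<le> q"
  shows "in_Lp M p f" "Lpnorm M p f \<le> Lpnorm M q f"
proof -
  have "in_Lp M p f \<and> Lpnorm M p f \<le> Lpnorm M q f"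
  proof (cases "p = q")
    case False
    then have pq: "p < q" using p by simp
    let ?F = "\<lambda>x. \<bar>f x\<bar> powr q"
    have e: "\<bar>f x\<bar> powr p = ?F x powr (p/q) * 1 powr (1 - p/q)" for x
      using pq p by (simp add: powr_powr)
    note H = Hoelder_weighted[of M ?F "\<lambda>_. 1" "p/q" "1 - p/q"]
    have 1: "in_Lp M p f"
      unfolding in_Lp_def e using f pq p by (intro conjI H) auto
    have "(\<integral>x. \<bar>f x\<bar> powr p \<partial>M) \<le> (\<integral>x. ?F x \<partial>M) powr (p/q) * (\<integral>x. 1 \<partial>M) powr (1 - p/q)"
      unfolding e using f pq p by (intro H) auto
    also have "\<dots> = (Lpnorm M q f) powr p"
      using p pq by (simp add: Lpnorm_def powr_powr prob_space)
    finally show ?thesis using 1 p by (subst Lpnorm_le_iff) auto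
  qed (use f in auto)
  then show "in_Lp M p f" "Lpnorm M p f \<le> Lpnorm M q f" by auto
qed

lemma (in prob_space) in_Lp_const [simp]: "in_Lp M q (\<lambda>x. c)"
  by (simp add: in_Lp_def)

lemma (in prob_space) Lpnorm_const: "q > 0 \<Longrightarrow> Lpnorm M q (\<lambda>x. c) = \<bar>c\<bar>"
  by (simp add: Lpnorm_def prob_space powr_powr)

lemma in_Lp_1: "in_Lp M 1 f \<longleftrightarrow> integrable M f"
  by (auto simp: in_Lp_def integrable_abs_iff)

lemma Lpnorm_1: "Lpnorm M 1 f = (\<integral>x. \<bar>f x\<bar> \<partial>M)"
  by (simp add: Lpnorm_def)

lemma (in prob_space) in_Lp_integrable: "in_Lp M q f \<Longrightarrow> 1 \<le> q \<Longrightarrow> integrable M f"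
  using Lpnorm_mono_exponent(1)[of q f 1] by (auto simp: in_Lp_1)

section \<open>A smoothness inequality for p-norms\<close>

lemma integrable_signed_powr_mult:
  assumes S: "in_Lp M q S" and d: "in_Lp M q d" and q: "1 < q"
  shows "integrable M (\<lambda>x. signed_powr (q - 1) (S x) * d x)"
proof -
  have e: "norm (signed_powr (q - 1) (S x) * d x) = (\<bar>S x\<bar> powr q) powr ((q-1)/q) * (\<bar>d x\<bar> powr q) powr (1/q)" for x
    using q by (simp add: abs_mult abs_signed_powr powr_powr)
  note [measurable] = in_Lp_measurable[OF S] in_Lp_measurable[OF d]
  have "integrable M (\<lambda>x. norm (signed_powr (q - 1) (S x) * d x))"
    unfolding e using S d q by (intro Hoelder_weighted) (auto simp: field_simps)
  then show ?thesis by (subst (asm) integrable_norm_iff) auto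
qed

text \<open>For q > 2 two error terms occur and each is paid by one of two averaged inequalities,
  hence the factor 2; the lower bound 1 ensures K^t \<ge> K for t \<ge> 1.\<close>

definition moment_const :: "real \<Rightarrow> real" where
  "moment_const q = max 1 (2 * smooth_const q)"

lemma moment_const_ge_1: "1 \<le> moment_const q" by (simp add: moment_const_def)

text \<open>Integration of the pointwise smoothness bound removes the linear term by
  \<open>orth\<close>. For q \<le> 2 the claim follows at once. For q > 2 Hoelder bounds the mixed
  term by s^(q-2) e^2, and the result still has to be compared with (s^2 + K e^2)^(q/2).\<close>

lemma Lpnorm_smooth:
  assumes S: "in_Lp M q S" and d: "in_Lp M q d" and q: "1 < q"
    and orth: "(\<integral>x. signed_powr (q - 1) (S x) * d x \<partial>M) = 0"
  defines "r \<equiv> min 2 q"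
  shows "Lpnorm M q (\<lambda>x. S x + d x) powr r \<le> Lpnorm M q S powr r + moment_const q * Lpnorm M q d powr r"
proof -
  define C where "C = smooth_const q"
  have C: "C > 0" using smooth_const_pos[OF q] by (simp add: C_def)
  define s e where "s = Lpnorm M q S" and "e = Lpnorm M q d"
  have nn: "s \<ge> 0" "e \<ge> 0" by (auto simp: s_def e_def)
  note [measurable] = in_Lp_measurable[OF S] in_Lp_measurable[OF d]
  have iphi: "integrable M (\<lambda>x. signed_powr (q - 1) (S x) * d x)"
    by (rule integrable_signed_powr_mult[OF S d q])
  have iS: "integrable M (\<lambda>x. \<bar>S x\<bar> powr q)" "integrable M (\<lambda>x. \<bar>d x\<bar> powr q)"
    "integrable M (\<lambda>x. \<bar>S x + d x\<bar> powr q)" using S d in_Lp_add[OF S d] q by auto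
  have sp: "(\<integral>x. \<bar>S x\<bar> powr q \<partial>M) = s powr q" "(\<integral>x. \<bar>d x\<bar> powr q \<partial>M) = e powr q"
    "(\<integral>x. \<bar>S x + d x\<bar> powr q \<partial>M) = Lpnorm M q (\<lambda>x. S x + d x) powr q"
    using q by (auto simp: s_def e_def Lpnorm_powr)
  show ?thesis
  proof (cases "q \<le> 2")
    case True
    then have r: "r = q" using q by (simp add: r_def)
    have "(\<integral>x. \<bar>S x + d x\<bar> powr q \<partial>M) \<le> (\<integral>x. \<bar>S x\<bar> powr q + q * (signed_powr (q - 1) (S x) * d x) + C * \<bar>d x\<bar> powr q \<partial>M)"
      using iS iphi abs_powr_smooth_le_2[OF q True] by (intro integral_mono) (auto simp: C_def)
    also have "\<dots> = s powr q + C * e powr q"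
      using iS iphi orth by (simp add: sp)
    also have "\<dots> \<le> s powr q + moment_const q * e powr q"
      using C by (intro add_left_mono mult_right_mono) (auto simp: moment_const_def C_def)
    finally show ?thesis unfolding sp r by (simp add: s_def e_def)
  next
    case False
    then have q2: "q > 2" by simp
    then have r: "r = 2" by (simp add: r_def)
    define K where "K = moment_const q"
    have K: "K \<ge> 1" "K \<ge> 2 * C" by (auto simp: K_def moment_const_def C_def)
    let ?F = "\<lambda>x. \<bar>S x\<bar> powr q" and ?G = "\<lambda>x. \<bar>d x\<bar> powr q"
    have eq: "\<bar>S x\<bar> powr (q - 2) * (d x)\<^sup>2 = ?F x powr ((q-2)/q) * ?G x powr (2/q)" for x
      using q by (simp add: powr_powr)
    note H = Hoelder_weighted[of M ?F ?G "(q-2)/q" "2/q"]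
    have im: "integrable M (\<lambda>x. \<bar>S x\<bar> powr (q - 2) * (d x)\<^sup>2)"
      unfolding eq using iS q2 by (intro H) (auto simp: field_simps)
    have "(\<integral>x. \<bar>S x\<bar> powr (q - 2) * (d x)\<^sup>2 \<partial>M) \<le> (s powr q) powr ((q-2)/q) * (e powr q) powr (2/q)"
      unfolding eq sp(1,2)[symmetric] using iS q2 by (intro H) (auto simp: field_simps)
    also have "\<dots> = s powr (q - 2) * e\<^sup>2"
      using nn q by (simp add: powr_powr)
    finally have m: "(\<integral>x. \<bar>S x\<bar> powr (q - 2) * (d x)\<^sup>2 \<partial>M) \<le> s powr (q - 2) * e\<^sup>2" .
    have "(\<integral>x. \<bar>S x + d x\<bar> powr q \<partial>M) \<le> (\<integral>x. \<bar>S x\<bar> powr q + q * (signed_powr (q - 1) (S x) * d x)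
          + C * (\<bar>S x\<bar> powr (q - 2) * (d x)\<^sup>2 + \<bar>d x\<bar> powr q) \<partial>M)"
      using iS iphi im abs_powr_smooth_ge_2[of q] q2 by (intro integral_mono) (auto simp: C_def)
    also have "\<dots> = s powr q + C * ((\<integral>x. \<bar>S x\<bar> powr (q - 2) * (d x)\<^sup>2 \<partial>M) + e powr q)"
      using iS iphi im orth by (simp add: sp)
    also have "\<dots> \<le> s powr q + C * (s powr (q - 2) * e\<^sup>2 + e powr q)"
      using m C by auto
    also have "\<dots> \<le> (s\<^sup>2 + K * e\<^sup>2) powr (q/2)"
    proof -
      define t a b where "t = q/2" and "a = s\<^sup>2" and "b = e\<^sup>2"
      have t: "t > 1" using q2 by (simp add: t_def)
      have ab: "a \<ge> 0" "b \<ge> 0" by (auto simp: a_def b_def)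
      have sa: "s powr q = a powr t" "e powr q = b powr t"
        using nn by (auto simp: a_def b_def t_def powr_powr simp flip: powr_numeral)
      have sa2: "s powr (q - 2) = a powr (t - 1)"
      proof -
        have "a powr (t - 1) = (s powr 2) powr (t - 1)" using nn by (simp add: a_def)
        also have "\<dots> = s powr (q - 2)" unfolding powr_powr by (simp add: t_def algebra_simps)
        finally show ?thesis by simp
      qed
      \<comment> \<open>The tangent at a and superadditivity are two lower bounds for (a + K b)^t.
        Each pays for twice one of the error terms, and their average is the desired
        inequality.\<close>
      have "a powr t + t * (a powr (t - 1) * (K * b)) \<le> (a + K * b) powr t"
        using abs_powr_subgradient[of t a "a + K * b"] t ab K
        by (cases "a = 0") (auto simp: signed_powr_def)
      moreover have "a powr t + (K * b) powr t \<le> (a + K * b) powr t"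
        using t ab K by (intro powr_add_superadditive) auto
      moreover have "2 * C * (a powr (t - 1) * b) \<le> t * (a powr (t - 1) * (K * b))"
      proof -
        have "2 * C * (a powr (t - 1) * b) \<le> (t * K) * (a powr (t - 1) * b)"
          using t K ab by (intro mult_right_mono) (auto intro: order_trans[OF K(2)])
        then show ?thesis by (simp add: mult_ac)
      qed
      moreover have "2 * C * b powr t \<le> (K * b) powr t"
      proof -
        have "2 * C \<le> K powr t"
          using K t powr_mono[of 1 t K] by auto
        then show ?thesis by (simp add: powr_mult mult_right_mono)
      qed
      ultimately have "a powr t + C * (a powr (t - 1) * b + b powr t) \<le> (a + K * b) powr t"
        by (simp add: algebra_simps)
      then show ?thesis unfolding sa sa2 by (simp add: a_def b_def t_def)
    qed
    finally have "Lpnorm M q (\<lambda>x. S x + d x) powr q \<le> (s\<^sup>2 + K * e\<^sup>2) powr (q/2)" unfolding sp .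
    then have "(Lpnorm M q (\<lambda>x. S x + d x) powr q) powr (2/q) \<le> ((s\<^sup>2 + K * e\<^sup>2) powr (q/2)) powr (2/q)"
      using q by (intro powr_mono2) auto
    then have "Lpnorm M q (\<lambda>x. S x + d x) powr 2 \<le> s\<^sup>2 + K * e\<^sup>2"
      unfolding powr_powr using q K by (simp add: add_nonneg_nonneg)
    then show ?thesis using nn unfolding r by (simp add: s_def e_def K_def)
  qed
qed

text \<open>The Burkholder and von Bahr--Esseen inequalities in one: the hypothesis is all that is used
  of the martingale property.\<close>

lemma Lpnorm_sum_orthogonal:
  fixes d :: "nat \<Rightarrow> 'a \<Rightarrow> real"
  assumes d: "\<And>i. i < n \<Longrightarrow> in_Lp M q (d i)" and q: "1 < q"
    and orth: "\<And>i. i < n \<Longrightarrow> (\<integral>x. signed_powr (q - 1) (\<Sum>j<i. d j x) * d i x \<partial>M) = 0"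
  shows "Lpnorm M q (\<lambda>x. \<Sum>i<n. d i x) powr (min 2 q)
      \<le> moment_const q * (\<Sum>i<n. Lpnorm M q (d i) powr (min 2 q))"
  using d orth
proof (induction n)
  case (Suc n)
  have "Lpnorm M q (\<lambda>x. (\<Sum>i<n. d i x) + d n x) powr (min 2 q)
     \<le> Lpnorm M q (\<lambda>x. \<Sum>i<n. d i x) powr (min 2 q) + moment_const q * Lpnorm M q (d n) powr (min 2 q)"
    using Suc.prems q by (intro Lpnorm_smooth in_Lp_sum) auto
  with Suc show ?case by (simp add: algebra_simps)
qed simp

section \<open>Conditional expectations and martingale differences\<close>

lemma (in prob_space) sigma_finite_subalgebra_of_subalgebra:
  assumes "subalgebra M G"
  shows "sigma_finite_subalgebra M G"
  using assms by (intro finite_measure_subalgebra_is_sigma_finite) (unfold_locales, auto)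

lemma (in prob_space) cond_exp_Lp:
  assumes G: "subalgebra M G" and f: "in_Lp M q f" and q: "1 \<le> q"
  shows "in_Lp M q (real_cond_exp M G f)" "Lpnorm M q (real_cond_exp M G f) \<le> Lpnorm M q f"
proof -
  interpret G: sigma_finite_subalgebra M G
    by (rule sigma_finite_subalgebra_of_subalgebra[OF G])
  let ?q = "\<lambda>x::real. \<bar>x\<bar> powr q"
  have fi: "integrable M f" using in_Lp_integrable[OF f q] .
  have fq: "integrable M (\<lambda>x. ?q (f x))" using f by auto
  note J = G.real_cond_exp_jensens_inequality(2)[where I=UNIV and q="?q", OF fi _ _ fq convex_abs_powr[OF q]]
  have *: "AE x in M. ?q (real_cond_exp M G f x) \<le> real_cond_exp M G (\<lambda>x. ?q (f x)) x"
    by (rule J) auto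
  have "integrable M (\<lambda>x. ?q (real_cond_exp M G f x))"
    by (rule G.integrable_convex_cond_exp[where I=UNIV and q="?q", OF fi _ _ fq convex_abs_powr[OF q]]) auto
  then show 1: "in_Lp M q (real_cond_exp M G f)" by (simp add: in_Lp_def)
  have "(\<integral>x. ?q (real_cond_exp M G f x) \<partial>M) \<le> (\<integral>x. real_cond_exp M G (\<lambda>x. ?q (f x)) x \<partial>M)"
    using 1 * G.real_cond_exp_int(1)[OF fq] by (intro integral_mono_AE) auto
  also have "\<dots> = (\<integral>x. ?q (f x) \<partial>M)" by (rule G.real_cond_exp_int(2)[OF fq])
  finally show "Lpnorm M q (real_cond_exp M G f) \<le> Lpnorm M q f"
    unfolding Lpnorm_def using q by (intro powr_mono2) auto
qed

lemma (in prob_space) integral_mult_cond_exp_zero: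
  assumes G: "subalgebra M G" and f: "f \<in> borel_measurable G" and d: "d \<in> borel_measurable M"
    and i: "integrable M (\<lambda>x. f x * d x)" and z: "AE x in M. real_cond_exp M G d x = 0"
  shows "(\<integral>x. f x * d x \<partial>M) = 0"
proof -
  interpret G: sigma_finite_subalgebra M G
    by (rule sigma_finite_subalgebra_of_subalgebra[OF G])
  have "(\<integral>x. f x * d x \<partial>M) = (\<integral>x. f x * real_cond_exp M G d x \<partial>M)"
    using G.real_cond_exp_intg(2)[OF i f d] by simp
  also have "\<dots> = 0"
    using z by (intro integral_eq_zero_AE) auto
  finally show ?thesis .
qed

text \<open>The signed power of the partial sum before i is \<open>G i\<close>-measurable and
  \<open>d i\<close> has conditional mean 0 given \<open>G i\<close>, so their product integrates to
  0. Thus \<open>G i\<close> is the information just before step i.\<close>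

lemma (in prob_space) Lpnorm_martingale_sum:
  fixes d :: "nat \<Rightarrow> 'a \<Rightarrow> real" and G :: "nat \<Rightarrow> 'a measure"
  assumes G: "\<And>i. subalgebra M (G i)" and d: "\<And>i. in_Lp M q (d i)" and q: "1 < q"
    and meas: "\<And>i j. j < i \<Longrightarrow> d j \<in> borel_measurable (G i)"
    and z: "\<And>i. AE x in M. real_cond_exp M (G i) (d i) x = 0"
  shows "Lpnorm M q (\<lambda>x. \<Sum>i<n. d i x) powr (min 2 q)
      \<le> moment_const q * (\<Sum>i<n. Lpnorm M q (d i) powr (min 2 q))"
proof (rule Lpnorm_sum_orthogonal[OF d q])
  fix i
  have "(\<lambda>x. \<Sum>j<i. d j x) \<in> borel_measurable (G i)" using meas by (intro borel_measurable_sum) auto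
  then show "(\<integral>x. signed_powr (q - 1) (\<Sum>j<i. d j x) * d i x \<partial>M) = 0"
    using d q by (intro integral_mult_cond_exp_zero[OF G[of i]] z integrable_signed_powr_mult in_Lp_sum) auto
qed

lemma (in prob_space) Lpnorm_martingale_sum_bound:
  fixes d :: "nat \<Rightarrow> 'a \<Rightarrow> real" and G :: "nat \<Rightarrow> 'a measure"
  assumes G: "\<And>i. subalgebra M (G i)" and d: "\<And>i. in_Lp M q (d i)" and q: "1 < q"
    and meas: "\<And>i j. j < i \<Longrightarrow> d j \<in> borel_measurable (G i)"
    and z: "\<And>i. AE x in M. real_cond_exp M (G i) (d i) x = 0"
    and B: "\<And>i. Lpnorm M q (d i) \<le> B"
  shows "Lpnorm M q (\<lambda>x. \<Sum>i<n. d i x) \<le> (moment_const q * real n) powr (1 / min 2 q) * B"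
proof -
  let ?r = "min 2 q"
  have r: "?r > 0" using q by auto
  have B0: "B \<ge> 0" using B[of 0] Lpnorm_nonneg order_trans by blast
  have "Lpnorm M q (\<lambda>x. \<Sum>i<n. d i x) powr ?r \<le> moment_const q * (\<Sum>i<n. Lpnorm M q (d i) powr ?r)"
    by (rule Lpnorm_martingale_sum[OF G d q meas z])
  also have "\<dots> \<le> moment_const q * (\<Sum>i<n. B powr ?r)"
    using moment_const_ge_1[of q] B r by (intro mult_left_mono sum_mono powr_mono2) auto
  also have "\<dots> = moment_const q * real n * B powr ?r" by simp
  finally have "(Lpnorm M q (\<lambda>x. \<Sum>i<n. d i x) powr ?r) powr (1/?r) \<le> (moment_const q * real n * B powr ?r) powr (1/?r)"
    using r by (intro powr_mono2) auto
  then show ?thesis using r B0 by (simp only: powr_powr powr_mult) simp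
qed

section \<open>Stationarity of causal processes\<close>

locale iid_sequence = prob_space M for M :: "'a measure" +
  fixes N :: "'b measure" and eps :: "int \<Rightarrow> 'a \<Rightarrow> 'b"
  assumes eps_measurable [measurable]: "\<And>i. eps i \<in> measurable M N"
    and indep: "indep_vars (\<lambda>_. N) eps UNIV"
    and ident: "\<And>i. distr M N (eps i) = distr M N (eps 0)"
begin

abbreviation F :: "int \<Rightarrow> 'a measure" where "F \<equiv> Fsig M N eps"

abbreviation Y :: "((nat \<Rightarrow> 'b) \<Rightarrow> real) \<Rightarrow> int \<Rightarrow> 'a \<Rightarrow> real" where "Y \<equiv> bern_proc eps"

abbreviation CE :: "int \<Rightarrow> ('a \<Rightarrow> real) \<Rightarrow> 'a \<Rightarrow> real" where "CE k \<equiv> real_cond_exp M (F k)"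

abbreviation Seq :: "(nat \<Rightarrow> 'b) measure" where "Seq \<equiv> PiM UNIV (\<lambda>_. N)"

definition past :: "int \<Rightarrow> 'a \<Rightarrow> nat \<Rightarrow> 'b" where "past k x = (\<lambda>j. eps (k - int j) x)"

text \<open>Moments of functions of the past are computed under this law, where the time index no
  longer appears.\<close>

definition past_law :: "(nat \<Rightarrow> 'b) measure" where "past_law = distr M Seq (past 0)"

lemma Y_past: "Y f k = (\<lambda>x. f (past k x))"
  by (simp add: past_def bern_proc_def fun_eq_iff)

lemma eps_space: "x \<in> space M \<Longrightarrow> eps i x \<in> space N"
  by (rule measurable_space[OF eps_measurable])

lemma past_measurable [measurable]: "past k \<in> measurable M Seq"
  unfolding past_def[abs_def] by (rule measurable_PiM_single') (auto simp: eps_space)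

lemma past_space: "x \<in> space M \<Longrightarrow> past k x \<in> space Seq"
  by (rule measurable_space[OF past_measurable])

lemma prob_cylinder:
  assumes J: "finite J" and A: "\<And>j. j \<in> J \<Longrightarrow> A j \<in> sets N"
  shows "prob {x \<in> space M. \<forall>j\<in>J. eps (k - int j) x \<in> A j} = (\<Prod>j\<in>J. measure (distr M N (eps 0)) (A j))"
proof (cases "J = {}")
  case False
  define I where "I = (\<lambda>j. k - int j) ` J"
  define A' where "A' = (\<lambda>i. A (nat (k - i)))"
  have "{x \<in> space M. \<forall>j\<in>J. eps (k - int j) x \<in> A j} = (\<Inter>i\<in>I. eps i -` A' i \<inter> space M)"
    using False by (auto simp: I_def A'_def)
  also have "prob \<dots> = (\<Prod>i\<in>I. prob (eps i -` A' i \<inter> space M))"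
    using False J A by (intro indep_varsD[OF indep]) (auto simp: I_def A'_def)
  also have "\<dots> = (\<Prod>j\<in>J. prob (eps (k - int j) -` A j \<inter> space M))"
    unfolding I_def A'_def by (subst prod.reindex) (auto simp: inj_on_def)
  also have "\<dots> = (\<Prod>j\<in>J. measure (distr M N (eps 0)) (A j))"
    by (intro prod.cong refl) (metis A ident eps_measurable measure_distr)
  finally show ?thesis .
qed (simp add: prob_space)

text \<open>Cylinder probabilities are products of marginals that do not involve k, and they
  determine the law. This is the stationarity of every process \<open>Y f\<close>.\<close>

lemma distr_past: "distr M Seq (past k) = past_law"
  unfolding past_law_def
proof (rule measure_eqI_PiM_infinite[of _ _ "\<lambda>_. N"])
  fix A :: "nat \<Rightarrow> 'b set" and J :: "nat set"
  assume J: "finite J" "J \<subseteq> UNIV" and A: "\<And>i. i \<in> J \<Longrightarrow> A i \<in> sets N"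
  have S: "prod_emb UNIV (\<lambda>_. N) J (Pi\<^sub>E J A) \<in> sets Seq"
    using J A by (intro sets_PiM_I) auto
  have pre: "past k' -` prod_emb UNIV (\<lambda>_. N) J (Pi\<^sub>E J A) \<inter> space M
      = {x \<in> space M. \<forall>j\<in>J. eps (k' - int j) x \<in> A j}" for k'
    by (auto simp: prod_emb_def past_def eps_space)
  show "distr M Seq (past k) (prod_emb UNIV (\<lambda>_. N) J (Pi\<^sub>E J A))
      = distr M Seq (past 0) (prod_emb UNIV (\<lambda>_. N) J (Pi\<^sub>E J A))"
    using S prob_cylinder[OF J(1), of A k] prob_cylinder[OF J(1), of A 0] A
    by (simp add: emeasure_distr pre emeasure_eq_measure)
qed (auto intro!: finite_measure_distr)

lemma prob_space_past_law: "prob_space past_law"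
  unfolding past_law_def by (rule prob_space_distr) simp

lemma sets_past_law [measurable_cong, simp]: "sets past_law = sets Seq"
  by (simp add: past_law_def)

lemma space_past_law [simp]: "space past_law = space Seq"
  by (simp add: past_law_def)

lemma Y_measurable: "f \<in> borel_measurable Seq \<Longrightarrow> Y f k \<in> borel_measurable M"
  unfolding Y_past by (rule measurable_compose[OF past_measurable])

lemma integral_Y: "f \<in> borel_measurable Seq \<Longrightarrow> (\<integral>x. h (Y f k x) \<partial>M) = (\<integral>u. (h (f u) :: real) \<partial>past_law)"
  if [measurable]: "h \<in> borel_measurable borel"
  unfolding distr_past[of k, symmetric] Y_past by (subst integral_distr) auto

lemma integrable_Y: "f \<in> borel_measurable Seq \<Longrightarrow> integrable M (\<lambda>x. h (Y f k x) :: real) \<longleftrightarrow> integrable past_law (\<lambda>u. h (f u))"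
  if [measurable]: "h \<in> borel_measurable borel"
  unfolding distr_past[of k, symmetric] Y_past by (subst integrable_distr_eq) auto

lemma Lpnorm_Y: "f \<in> borel_measurable Seq \<Longrightarrow> Lpnorm M q (Y f k) = Lpnorm past_law q f"
  unfolding Lpnorm_def using integral_Y[of "\<lambda>x. \<bar>x\<bar> powr q" f k] by simp

lemma in_Lp_Y: "f \<in> borel_measurable Seq \<Longrightarrow> in_Lp M q (Y f k) \<longleftrightarrow> in_Lp past_law q f"
  unfolding in_Lp_def using integrable_Y[of "\<lambda>x. \<bar>x\<bar> powr q" f k] Y_measurable[of f k]
  by (simp add: measurable_cong_sets[OF sets_past_law refl])

lemma in_Lp_past_law_measurable: "in_Lp past_law q f \<Longrightarrow> f \<in> borel_measurable Seq"
  by (auto simp: in_Lp_def measurable_cong_sets[OF sets_past_law refl])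

lemma space_F [simp]: "space (F k) = space M"
  unfolding Fsig_def by (rule space_measure_of) auto

lemma sets_F: "sets (F k) = sigma_sets (space M) {eps j -` A \<inter> space M | j A. j \<le> k \<and> A \<in> sets N}"
  unfolding Fsig_def by (rule sets_measure_of) auto

lemma eps_measurable_F: "j \<le> k \<Longrightarrow> eps j \<in> measurable (F k) N"
  by (rule measurableI) (auto simp: eps_space sets_F intro!: sigma_sets.Basic)

lemma subalgebra_F: "subalgebra M (F k)"
proof (unfold subalgebra_def, intro conjI)
  show "sets (F k) \<subseteq> sets M"
    unfolding sets_F by (rule sets.sigma_sets_subset) (auto intro!: measurable_sets[OF eps_measurable])
qed simp

lemma subalgebra_F_mono: "j \<le> k \<Longrightarrow> subalgebra (F k) (F j)"
  unfolding subalgebra_def sets_F by (intro conjI sigma_sets_subseteq) (auto intro: order_trans)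

lemma past_measurable_F: "j \<le> k \<Longrightarrow> past j \<in> measurable (F k) Seq"
  unfolding past_def[abs_def]
  by (rule measurable_PiM_single') (auto simp: eps_space intro!: eps_measurable_F)

lemma Y_measurable_F: "f \<in> borel_measurable Seq \<Longrightarrow> j \<le> k \<Longrightarrow> Y f j \<in> borel_measurable (F k)"
  unfolding Y_past by (rule measurable_compose[OF past_measurable_F])

lemma measurable_F_mono: "f \<in> borel_measurable (F j) \<Longrightarrow> j \<le> k \<Longrightarrow> f \<in> borel_measurable (F k)"
  using measurable_from_subalg[OF subalgebra_F_mono] .

lemma CE_measurable_F: "j \<le> k \<Longrightarrow> CE j f \<in> borel_measurable (F k)"
  by (rule measurable_F_mono[OF borel_measurable_cond_exp])

text \<open>A generating event on \<open>eps j\<close> with j \<le> k is an event on coordinate k -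
  j of \<open>past k\<close>. So events of F_k can be transferred to the sequence space.\<close>

lemma sets_F_past:
  assumes "A \<in> sets (F k)"
  obtains B where "B \<in> sets Seq" "A = past k -` B \<inter> space M"
proof -
  have "{eps j -` A \<inter> space M | j A. j \<le> k \<and> A \<in> sets N} \<subseteq> sets (vimage_algebra (space M) (past k) Seq)"
  proof clarify
    fix j A assume j: "j \<le> k" and A[measurable]: "A \<in> sets N"
    have "{u \<in> space Seq. u (nat (k - j)) \<in> A} \<in> sets Seq" by measurable
    then have "past k -` {u \<in> space Seq. u (nat (k - j)) \<in> A} \<inter> space M \<in> sets (vimage_algebra (space M) (past k) Seq)"
      by (rule in_vimage_algebra)
    also have "past k -` {u \<in> space Seq. u (nat (k - j)) \<in> A} \<inter> space M = eps j -` A \<inter> space M"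
      using j by (auto simp: past_space) (auto simp: past_def)
    finally show "eps j -` A \<inter> space M \<in> sets (vimage_algebra (space M) (past k) Seq)" .
  qed
  then have "sets (F k) \<subseteq> sets (vimage_algebra (space M) (past k) Seq)"
    unfolding sets_F using sets.sigma_sets_subset[of _ "vimage_algebra (space M) (past k) Seq"] by simp
  then have "A \<in> sets (vimage_algebra (space M) (past k) Seq)" using assms by auto
  also have "sets (vimage_algebra (space M) (past k) Seq) = {past k -` A \<inter> space M | A. A \<in> sets Seq}"
    by (rule sets_vimage_algebra2) (auto simp: past_space)
  finally show ?thesis using that by auto
qed

section \<open>Shifts of the sequence space and conditioning on an earlier past\<close>

definition shift :: "nat \<Rightarrow> (nat \<Rightarrow> 'b) \<Rightarrow> nat \<Rightarrow> 'b" where "shift j u = (\<lambda>i. u (i + j))"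

lemma shift_measurable [measurable]: "shift j \<in> measurable Seq Seq"
  unfolding shift_def[abs_def]
  by (rule measurable_PiM_single') (auto simp: space_PiM)

lemma shift_past: "shift j (past k x) = past (k - int j) x"
  by (auto simp: shift_def past_def algebra_simps)

text \<open>The sigma-field pulled back along \<open>shift j\<close> sees only the coordinates from
  j on. When the sequence is the past at time k, these are the variables up to time k - j.\<close>

definition lagged_cond_exp :: "nat \<Rightarrow> ((nat \<Rightarrow> 'b) \<Rightarrow> real) \<Rightarrow> (nat \<Rightarrow> 'b) \<Rightarrow> real" where
  "lagged_cond_exp j = real_cond_exp past_law (vimage_algebra (space Seq) (shift j) Seq)"

lemma subalgebra_shift: "subalgebra past_law (vimage_algebra (space Seq) (shift j) Seq)"
  unfolding subalgebra_def sets_past_law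
  using sets_image_in_sets[OF _ shift_measurable[of j], of "space Seq"] by auto

lemma lagged_cond_exp_measurable [measurable]: "lagged_cond_exp j f \<in> borel_measurable Seq"
  unfolding lagged_cond_exp_def
  using borel_measurable_cond_exp2[of past_law] by (simp add: measurable_cong_sets[OF sets_past_law refl])

text \<open>The same function represents the conditional expectation at every time, hence stationarity.\<close>

lemma CE_eq_lagged:
  assumes f: "integrable past_law f"
  shows "AE x in M. CE (k - int j) (Y f k) x = Y (lagged_cond_exp j f) k x"
proof -
  interpret L: prob_space past_law by (rule prob_space_past_law)
  interpret G: sigma_finite_subalgebra past_law "vimage_algebra (space Seq) (shift j) Seq"
    by (rule L.sigma_finite_subalgebra_of_subalgebra[OF subalgebra_shift])
  interpret C: sigma_finite_subalgebra M "F (k - int j)"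
    by (rule sigma_finite_subalgebra_of_subalgebra[OF subalgebra_F])
  have fm [measurable]: "f \<in> borel_measurable Seq"
    using borel_measurable_integrable[OF f] by (simp add: measurable_cong_sets[OF sets_past_law refl])
  have hi: "integrable past_law (lagged_cond_exp j f)"
    unfolding lagged_cond_exp_def by (rule G.real_cond_exp_int(1)[OF f])
  show ?thesis
  proof (rule C.real_cond_exp_charact)
    show "integrable M (Y f k)" using integrable_Y[of "\<lambda>x. x" f k] f by simp
    show "integrable M (Y (lagged_cond_exp j f) k)"
      using integrable_Y[of "\<lambda>x. x" "lagged_cond_exp j f" k] hi by simp
    have p: "past k \<in> measurable (F (k - int j)) (vimage_algebra (space Seq) (shift j) Seq)"
      by (rule measurable_vimage_algebra2) (auto simp: past_space shift_past intro!: past_measurable_F)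
    have "lagged_cond_exp j f \<in> borel_measurable (vimage_algebra (space Seq) (shift j) Seq)"
      unfolding lagged_cond_exp_def by simp
    then show "Y (lagged_cond_exp j f) k \<in> borel_measurable (F (k - int j))"
      unfolding Y_past by (rule measurable_compose[OF p])
  next
    fix A assume A: "A \<in> sets (F (k - int j))"
    then obtain B where B[measurable]: "B \<in> sets Seq" and AB: "A = past (k - int j) -` B \<inter> space M"
      by (rule sets_F_past)
    \<comment> \<open>Seen from time k, the event A of \<open>F (k - int j)\<close> is an event on
      the shifted sequence. B' is this event in the sigma-field used by
      \<open>lagged_cond_exp\<close>, whose integrals over B' agree with those of f.\<close>
    define B' where "B' = shift j -` B \<inter> space Seq"
    have B'[measurable]: "B' \<in> sets Seq" by (simp add: B'_def measurable_sets[OF shift_measurable])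
    have ind: "indicator A x = (indicator B' (past k x) :: real)" if "x \<in> space M" for x
      using that by (auto simp: AB B'_def indicator_def shift_past past_space)
    have set: "(\<integral>x\<in>A. Y h k x \<partial>M) = (\<integral>u\<in>B'. h u \<partial>past_law)" if [measurable]: "h \<in> borel_measurable Seq" for h
    proof -
      have "(\<integral>x\<in>A. Y h k x \<partial>M) = (\<integral>x. indicator B' (past k x) * h (past k x) \<partial>M)"
        unfolding set_lebesgue_integral_def Y_past by (intro Bochner_Integration.integral_cong) (auto simp: ind)
      also have "\<dots> = (\<integral>u\<in>B'. h u \<partial>distr M Seq (past k))"
        unfolding set_lebesgue_integral_def by (subst integral_distr) auto
      finally show ?thesis by (simp add: distr_past)
    qed
    have B'G: "B' \<in> sets (vimage_algebra (space Seq) (shift j) Seq)"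
      unfolding B'_def by (rule in_vimage_algebra) simp
    show "(\<integral>x\<in>A. Y f k x \<partial>M) = (\<integral>x\<in>A. Y (lagged_cond_exp j f) k x \<partial>M)"
      using G.real_cond_exp_intA[OF f B'G] by (simp add: set lagged_cond_exp_def[symmetric])
  qed
qed


lemma sigma_finite_F: "sigma_finite_subalgebra M (F k)"
  by (rule sigma_finite_subalgebra_of_subalgebra[OF subalgebra_F])

lemma CE_in_Lp: "in_Lp M q f \<Longrightarrow> 1 \<le> q \<Longrightarrow> in_Lp M q (CE k f)"
  by (rule cond_exp_Lp[OF subalgebra_F])

section \<open>Innovations\<close>

abbreviation Proj :: "int \<Rightarrow> ('a \<Rightarrow> real) \<Rightarrow> 'a \<Rightarrow> real" where "Proj \<equiv> proj M N eps"

lemma proj_measurable_F: "j \<le> k \<Longrightarrow> Proj j f \<in> borel_measurable (F k)"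
  unfolding proj_def by (intro borel_measurable_diff CE_measurable_F) auto

lemma proj_in_Lp: "in_Lp M q f \<Longrightarrow> 1 \<le> q \<Longrightarrow> in_Lp M q (Proj k f)"
  unfolding proj_def by (intro in_Lp_diff CE_in_Lp) auto

lemma CE_proj_zero:
  assumes f: "integrable M f"
  shows "AE x in M. CE (k - 1) (Proj k f) x = 0"
proof -
  interpret C: sigma_finite_subalgebra M "F (k - 1)" by (rule sigma_finite_F)
  interpret C': sigma_finite_subalgebra M "F k" by (rule sigma_finite_F)
  have i: "integrable M (CE k f)" "integrable M (CE (k - 1) f)"
    using f C.real_cond_exp_int(1) C'.real_cond_exp_int(1) by auto
  have "AE x in M. CE (k - 1) (\<lambda>x. CE k f x - CE (k - 1) f x) x = CE (k - 1) (CE k f) x - CE (k - 1) (CE (k - 1) f) x"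
    by (rule C.real_cond_exp_diff[OF i])
  moreover have "AE x in M. CE (k - 1) (CE k f) x = CE (k - 1) f x"
    by (rule C.real_cond_exp_nested_subalg[OF subalgebra_F subalgebra_F_mono f]) simp
  moreover have "AE x in M. CE (k - 1) (CE (k - 1) f) x = CE (k - 1) f x"
    by (rule C.real_cond_exp_F_meas[OF i(2)]) simp
  ultimately show ?thesis unfolding proj_def by eventually_elim simp
qed

text \<open>Evaluated at the past of time k + j this represents the projection P_k X_(k+j); j is a
  lag, not a time.\<close>

definition innovation :: "nat \<Rightarrow> ((nat \<Rightarrow> 'b) \<Rightarrow> real) \<Rightarrow> (nat \<Rightarrow> 'b) \<Rightarrow> real" where
  "innovation j f u = lagged_cond_exp j f u - lagged_cond_exp (Suc j) f u"

lemma innovation_measurable [measurable]: "innovation j f \<in> borel_measurable Seq"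
  unfolding innovation_def[abs_def] by measurable

lemma proj_eq_innovation:
  assumes f: "integrable past_law f"
  shows "AE x in M. Proj k (Y f (k + int j)) x = Y (innovation j f) (k + int j) x"
  using CE_eq_lagged[OF f, of "k + int j" j] CE_eq_lagged[OF f, of "k + int j" "Suc j"]
  by (simp, eventually_elim) (auto simp: proj_def innovation_def bern_proc_def)

lemma in_Lp_past_law_integrable: "in_Lp past_law q f \<Longrightarrow> 1 \<le> q \<Longrightarrow> integrable past_law f"
  by (rule prob_space.in_Lp_integrable[OF prob_space_past_law])

lemma in_Lp_Y': "in_Lp past_law q f \<Longrightarrow> in_Lp M q (Y f k)"
  using in_Lp_Y[OF in_Lp_past_law_measurable] by auto

lemma proj_Lpnorm_stationary:
  assumes f: "in_Lp past_law q f" and q: "1 \<le> q"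
  shows "Lpnorm M q (Proj k (Y f (k + int j))) = Lpnorm M q (Proj 0 (Y f (int j)))"
proof -
  note fi = in_Lp_past_law_integrable[OF f q]
  have *: "Lpnorm M q (Proj k (Y f (k + int j))) = Lpnorm past_law q (innovation j f)" for k
  proof -
    have "Lpnorm M q (Proj k (Y f (k + int j))) = Lpnorm M q (Y (innovation j f) (k + int j))"
      using proj_in_Lp[OF in_Lp_Y'[OF f] q]
      by (intro Lpnorm_cong_AE proj_eq_innovation fi) (auto intro!: Y_measurable)
    then show ?thesis by (simp add: Lpnorm_Y)
  qed
  show ?thesis using *[of k] *[of 0] by simp
qed

text \<open>For a fixed lag j the projections P_(s+n-j) X_(s+n) are martingale differences in n.
  Each lag therefore contributes at the martingale rate, weighted by the size of the innovation at
  that lag.\<close>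

lemma Lpnorm_proj_sum:
  assumes f: "in_Lp past_law q f" and q: "1 < q"
  shows "Lpnorm M q (\<lambda>x. \<Sum>n<l. Proj (s + int n - int j) (Y f (s + int n)) x)
      \<le> (moment_const q * real l) powr (1 / min 2 q) * Lpnorm M q (Proj 0 (Y f (int j)))"
proof (rule Lpnorm_martingale_sum_bound[where G = "\<lambda>n. F (s + int n - int j - 1)"])
  fix i
  show "in_Lp M q (Proj (s + int i - int j) (Y f (s + int i)))"
    using q by (intro proj_in_Lp in_Lp_Y' f) auto
  have "integrable M (Y f (s + int i))"
    using in_Lp_integrable[OF in_Lp_Y'[OF f]] q by auto
  then show "AE x in M. CE (s + int i - int j - 1) (Proj (s + int i - int j) (Y f (s + int i))) x = 0"
    by (rule CE_proj_zero)
  show "Lpnorm M q (Proj (s + int i - int j) (Y f (s + int i))) \<le> Lpnorm M q (Proj 0 (Y f (int j)))"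
    using proj_Lpnorm_stationary[OF f, of "s + int i - int j" j] q by simp
qed (use q in \<open>auto intro!: subalgebra_F proj_measurable_F\<close>)

section \<open>Triviality of the remote past\<close>

text \<open>An L^q form of triviality of the remote past. Stability under linear combinations and
  under L^q approximation reduces it to cylinder indicators.\<close>

definition past_forgetting :: "real \<Rightarrow> ((nat \<Rightarrow> 'b) \<Rightarrow> real) \<Rightarrow> bool" where
  "past_forgetting q f \<longleftrightarrow>
     (\<lambda>m. Lpnorm past_law q (\<lambda>u. lagged_cond_exp m f u - (\<integral>v. f v \<partial>past_law))) \<longlonglongrightarrow> 0"

lemma sigma_finite_shift: "sigma_finite_subalgebra past_law (vimage_algebra (space Seq) (shift m) Seq)"
  by (rule prob_space.sigma_finite_subalgebra_of_subalgebra[OF prob_space_past_law subalgebra_shift])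

lemma lagged_cond_exp_Lp:
  assumes "in_Lp past_law q f" "1 \<le> q"
  shows "in_Lp past_law q (lagged_cond_exp m f)" "Lpnorm past_law q (lagged_cond_exp m f) \<le> Lpnorm past_law q f"
  unfolding lagged_cond_exp_def
  using prob_space.cond_exp_Lp[OF prob_space_past_law subalgebra_shift assms] by auto

lemma measure_past_law_space [simp]: "measure past_law (space Seq) = 1"
  using prob_space.prob_space[OF prob_space_past_law] by simp

lemma in_Lp_past_law_const [simp]: "in_Lp past_law q (\<lambda>x. c)"
  by (rule prob_space.in_Lp_const[OF prob_space_past_law])

lemma past_forgetting_remainder_in_Lp:
  assumes "in_Lp past_law q f" "1 \<le> q"
  shows "in_Lp past_law q (\<lambda>u. lagged_cond_exp m f u - c)"
  using assms by (intro in_Lp_diff lagged_cond_exp_Lp) auto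

lemma Lpnorm_CE_lagged:
  assumes f: "in_Lp past_law q f" and q: "1 \<le> q"
  shows "Lpnorm M q (\<lambda>x. CE (k - int m) (Y f k) x - c) = Lpnorm past_law q (\<lambda>u. lagged_cond_exp m f u - c)"
proof -
  have "AE x in M. CE (k - int m) (Y f k) x - c = Y (\<lambda>u. lagged_cond_exp m f u - c) k x"
    using CE_eq_lagged[OF in_Lp_past_law_integrable[OF f q], of k m]
    by eventually_elim (simp add: bern_proc_def)
  then have "Lpnorm M q (\<lambda>x. CE (k - int m) (Y f k) x - c) = Lpnorm M q (Y (\<lambda>u. lagged_cond_exp m f u - c) k)"
    by (intro Lpnorm_cong_AE) (auto intro!: Y_measurable)
  also have "\<dots> = Lpnorm past_law q (\<lambda>u. lagged_cond_exp m f u - c)"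
    by (rule Lpnorm_Y) measurable
  finally show ?thesis .
qed

text \<open>Conditional expectation and mean are both contractions, so passing from f to g costs the
  distance twice; these two errors and the convergence for g get e/3 each.\<close>

lemma past_forgetting_approx:
  assumes f: "in_Lp past_law q f" and q: "1 \<le> q"
    and approx: "\<And>e. e > 0 \<Longrightarrow> \<exists>g. in_Lp past_law q g \<and> past_forgetting q g \<and> Lpnorm past_law q (\<lambda>u. f u - g u) \<le> e"
  shows "past_forgetting q f"
  unfolding past_forgetting_def
proof (rule LIMSEQ_I)
  interpret L: prob_space past_law by (rule prob_space_past_law)
  fix e :: real assume e: "e > 0"
  obtain g where g: "in_Lp past_law q g" "past_forgetting q g" "Lpnorm past_law q (\<lambda>u. f u - g u) \<le> e / 3"
    using approx[of "e / 3"] e by auto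
  define c d where "c = (\<integral>v. f v \<partial>past_law)" and "d = (\<integral>v. g v \<partial>past_law)"
  note fg = in_Lp_past_law_integrable[OF f q] in_Lp_past_law_integrable[OF g(1) q]
  have fgLp: "in_Lp past_law q (\<lambda>u. f u - g u)" using f g q by (intro in_Lp_diff) auto
  have "c - d = (\<integral>u. f u - g u \<partial>past_law)" using fg by (simp add: c_def d_def)
  then have "\<bar>c - d\<bar> \<le> (\<integral>u. \<bar>f u - g u\<bar> \<partial>past_law)" by simp
  also have "\<dots> \<le> Lpnorm past_law q (\<lambda>u. f u - g u)"
    using L.Lpnorm_mono_exponent(2)[OF fgLp, of 1] q by (simp add: Lpnorm_1)
  finally have cd: "\<bar>c - d\<bar> \<le> e / 3" using g(3) by simp
  have "eventually (\<lambda>m. Lpnorm past_law q (\<lambda>u. lagged_cond_exp m g u - d) < e / 3) sequentially"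
    using order_tendstoD(2)[OF g(2)[unfolded past_forgetting_def], of "e/3"] e by (simp add: d_def)
  then obtain m0 where m0: "\<And>m. m \<ge> m0 \<Longrightarrow> Lpnorm past_law q (\<lambda>u. lagged_cond_exp m g u - d) < e / 3"
    by (auto simp: eventually_sequentially)
  show "\<exists>no. \<forall>m\<ge>no. norm (Lpnorm past_law q (\<lambda>u. lagged_cond_exp m f u - (\<integral>v. f v \<partial>past_law)) - 0) < e"
    unfolding c_def[symmetric]
  proof (intro exI allI impI)
    fix m assume m: "m \<ge> m0"
    interpret G: sigma_finite_subalgebra past_law "vimage_algebra (space Seq) (shift m) Seq"
      by (rule sigma_finite_shift)
    note Lf = lagged_cond_exp_Lp(1)[OF f q, of m] and Lg = lagged_cond_exp_Lp(1)[OF g(1) q, of m]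
    have "Lpnorm past_law q (\<lambda>u. lagged_cond_exp m f u - lagged_cond_exp m g u) = Lpnorm past_law q (lagged_cond_exp m (\<lambda>u. f u - g u))"
    proof (rule Lpnorm_cong_AE)
      show "AE u in past_law. lagged_cond_exp m f u - lagged_cond_exp m g u = lagged_cond_exp m (\<lambda>u. f u - g u) u"
        unfolding lagged_cond_exp_def using G.real_cond_exp_diff[OF fg] by eventually_elim simp
    qed auto
    also have "\<dots> \<le> e / 3" using lagged_cond_exp_Lp(2)[OF fgLp q, of m] g(3) by simp
    finally have 1: "Lpnorm past_law q (\<lambda>u. lagged_cond_exp m f u - lagged_cond_exp m g u) \<le> e / 3" .
    have "Lpnorm past_law q (\<lambda>u. lagged_cond_exp m f u - c)
      \<le> Lpnorm past_law q (\<lambda>u. lagged_cond_exp m f u - lagged_cond_exp m g u) + Lpnorm past_law q (\<lambda>u. lagged_cond_exp m g u - c)"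
      using Lf Lg q by (intro Lpnorm_triangle_via) auto
    also have "Lpnorm past_law q (\<lambda>u. lagged_cond_exp m g u - c)
      \<le> Lpnorm past_law q (\<lambda>u. lagged_cond_exp m g u - d) + Lpnorm past_law q (\<lambda>u. d - c)"
      using Lg q by (intro Lpnorm_triangle_via) auto
    also have "Lpnorm past_law q (\<lambda>u. d - c) = \<bar>d - c\<bar>"
      using q by (intro L.Lpnorm_const) auto
    finally show "norm (Lpnorm past_law q (\<lambda>u. lagged_cond_exp m f u - c) - 0) < e"
      using 1 m0[OF m] cd by (simp add: abs_minus_commute)
  qed
qed

lemma past_forgetting_add:
  assumes f: "in_Lp past_law q f" "past_forgetting q f" and g: "in_Lp past_law q g" "past_forgetting q g"
    and q: "1 \<le> q"
  shows "past_forgetting q (\<lambda>u. f u + g u)"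
proof -
  define c d where "c = (\<integral>v. f v \<partial>past_law)" and "d = (\<integral>v. g v \<partial>past_law)"
  note fg = in_Lp_past_law_integrable[OF f(1) q] in_Lp_past_law_integrable[OF g(1) q]
  have s: "(\<integral>v. f v + g v \<partial>past_law) = c + d" using fg by (simp add: c_def d_def)
  have lim: "(\<lambda>m. Lpnorm past_law q (\<lambda>u. lagged_cond_exp m f u - c) + Lpnorm past_law q (\<lambda>u. lagged_cond_exp m g u - d)) \<longlonglongrightarrow> 0"
    using tendsto_add[OF f(2)[unfolded past_forgetting_def] g(2)[unfolded past_forgetting_def]] by (simp add: c_def d_def)
  have b: "Lpnorm past_law q (\<lambda>u. lagged_cond_exp m (\<lambda>u. f u + g u) u - (c + d))
     \<le> Lpnorm past_law q (\<lambda>u. lagged_cond_exp m f u - c) + Lpnorm past_law q (\<lambda>u. lagged_cond_exp m g u - d)" for m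
  proof -
    interpret G: sigma_finite_subalgebra past_law "vimage_algebra (space Seq) (shift m) Seq"
      by (rule sigma_finite_shift)
    have "Lpnorm past_law q (\<lambda>u. lagged_cond_exp m (\<lambda>u. f u + g u) u - (c + d))
       = Lpnorm past_law q (\<lambda>u. (lagged_cond_exp m f u - c) + (lagged_cond_exp m g u - d))"
    proof (rule Lpnorm_cong_AE)
      show "AE u in past_law. lagged_cond_exp m (\<lambda>u. f u + g u) u - (c + d) = (lagged_cond_exp m f u - c) + (lagged_cond_exp m g u - d)"
        unfolding lagged_cond_exp_def using G.real_cond_exp_add[OF fg] by eventually_elim simp
    qed auto
    also have "\<dots> \<le> Lpnorm past_law q (\<lambda>u. lagged_cond_exp m f u - c) + Lpnorm past_law q (\<lambda>u. lagged_cond_exp m g u - d)"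
      using f g q by (intro Lpnorm_triangle past_forgetting_remainder_in_Lp) auto
    finally show ?thesis .
  qed
  show ?thesis unfolding past_forgetting_def s
    by (rule real_tendsto_sandwich[OF _ _ tendsto_const lim]) (use b in auto)
qed

lemma past_forgetting_cmult:
  assumes f: "in_Lp past_law q f" "past_forgetting q f" and q: "1 \<le> q"
  shows "past_forgetting q (\<lambda>u. a * f u)"
proof -
  define c where "c = (\<integral>v. f v \<partial>past_law)"
  note fi = in_Lp_past_law_integrable[OF f(1) q]
  have s: "(\<integral>v. a * f v \<partial>past_law) = a * c" by (simp add: c_def)
  have b: "Lpnorm past_law q (\<lambda>u. lagged_cond_exp m (\<lambda>u. a * f u) u - a * c) = \<bar>a\<bar> * Lpnorm past_law q (\<lambda>u. lagged_cond_exp m f u - c)" for m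
  proof -
    interpret G: sigma_finite_subalgebra past_law "vimage_algebra (space Seq) (shift m) Seq"
      by (rule sigma_finite_shift)
    have "Lpnorm past_law q (\<lambda>u. lagged_cond_exp m (\<lambda>u. a * f u) u - a * c)
       = Lpnorm past_law q (\<lambda>u. a * (lagged_cond_exp m f u - c))"
    proof (rule Lpnorm_cong_AE)
      show "AE u in past_law. lagged_cond_exp m (\<lambda>u. a * f u) u - a * c = a * (lagged_cond_exp m f u - c)"
        unfolding lagged_cond_exp_def using G.real_cond_exp_cmult[OF fi, of a]
        by eventually_elim (simp add: algebra_simps)
    qed auto
    also have "\<dots> = \<bar>a\<bar> * Lpnorm past_law q (\<lambda>u. lagged_cond_exp m f u - c)"
      using q by (intro Lpnorm_cmult) auto
    finally show ?thesis .
  qed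
  have "(\<lambda>m. \<bar>a\<bar> * Lpnorm past_law q (\<lambda>u. lagged_cond_exp m f u - c)) \<longlonglongrightarrow> 0"
    using tendsto_mult_right_zero[OF f(2)[unfolded past_forgetting_def], of "\<bar>a\<bar>"]
    by (simp add: c_def)
  then show ?thesis unfolding past_forgetting_def s b .
qed

section \<open>The zero-one law: from cylinders to all of L^q\<close>

lemma indep_past_cylinder:
  assumes A: "A \<in> sets (F (- int m))" and J: "finite J" "J \<subseteq> {..<m}" and E: "\<And>j. j \<in> J \<Longrightarrow> E j \<in> sets N"
  defines "C \<equiv> {x \<in> space M. \<forall>j\<in>J. eps (- int j) x \<in> E j}"
  shows "prob (A \<inter> C) = prob A * prob C"
proof -
  let ?E = "\<lambda>i. {eps i -` A \<inter> space M | A. A \<in> sets N}"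
  \<comment> \<open>Times are split at -m. The event A depends on times up to -m, the cylinder C on
    times -j with j < m, which are all later; sigma-fields generated by disjoint groups of
    independent variables are independent.\<close>
  let ?I = "\<lambda>b. if b then {.. - int m} else {- int m<..}"
  let ?S = "\<lambda>b. sigma_sets (space M) (\<Union>i\<in>?I b. ?E i)"
  have "indep_sets ?S UNIV"
  proof (rule indep_sets_collect_sigma)
    have "(\<Union>b\<in>UNIV. ?I b) = UNIV" by (auto simp: UNIV_bool)
    then show "indep_sets ?E (\<Union>b\<in>UNIV. ?I b)"
      using indep unfolding indep_vars_def2 by simp
    show "Int_stable (?E i)" for i
      by (rule Int_stableI) (auto, metis (no_types, lifting) Int_assoc Int_left_commute sets.Int vimage_Int Int_absorb)
  qed (auto simp: disjoint_family_on_def)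
  moreover have "A \<in> ?S True"
  proof -
    have "(\<Union>i\<in>?I True. ?E i) = {eps j -` A \<inter> space M | j A. j \<le> - int m \<and> A \<in> sets N}" by auto
    then show ?thesis using A unfolding sets_F by simp
  qed
  moreover have "C \<in> ?S False"
  proof -
    have sub: "(\<Union>i\<in>?I False. ?E i) \<subseteq> Pow (space M)" by auto
    let ?\<Sigma> = "sigma (space M) (\<Union>i\<in>?I False. ?E i)"
    have sp: "space ?\<Sigma> = space M" "sets ?\<Sigma> = ?S False"
      using sub by (auto simp: space_measure_of sets_measure_of)
    have "{x \<in> space ?\<Sigma>. \<forall>j\<in>J. eps (- int j) x \<in> E j} \<in> sets ?\<Sigma>"
    proof (rule sets.sets_Collect_finite_All[OF _ J(1)])
      fix j assume j: "j \<in> J"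
      have "eps (- int j) -` E j \<inter> space M \<in> ?S False"
        using j J E by (intro sigma_sets.Basic) force
      also have "eps (- int j) -` E j \<inter> space M = {x \<in> space ?\<Sigma>. eps (- int j) x \<in> E j}"
        unfolding sp by auto
      finally show "{x \<in> space ?\<Sigma>. eps (- int j) x \<in> E j} \<in> sets ?\<Sigma>" unfolding sp .
    qed
    then show ?thesis unfolding C_def sp .
  qed
  ultimately show ?thesis
    using indep_setsD[of ?S UNIV UNIV "\<lambda>b. if b then A else C"] by (simp add: UNIV_bool Int_commute mult.commute)
qed

text \<open>Once m exceeds every coordinate in J, the cylinder is independent of the shifted
  sequence. Its conditional expectation is then its probability, and the norm is exactly 0.\<close>

lemma past_forgetting_cylinder:
  assumes J: "finite J" and E: "\<And>j. j \<in> J \<Longrightarrow> E j \<in> sets N"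
  shows "past_forgetting 1 (indicator (prod_emb UNIV (\<lambda>_. N) J (Pi\<^sub>E J E)))"
proof -
  interpret L: prob_space past_law by (rule prob_space_past_law)
  define S where "S = prod_emb UNIV (\<lambda>_. N) J (Pi\<^sub>E J E)"
  have S[measurable]: "S \<in> sets Seq" unfolding S_def using J E by (intro sets_PiM_I) auto
  have pre: "past 0 -` S \<inter> space M = {x \<in> space M. \<forall>j\<in>J. eps (- int j) x \<in> E j}"
    by (auto simp: prod_emb_def past_def eps_space S_def)
  have law: "measure past_law A = prob (past 0 -` A \<inter> space M)" if "A \<in> sets Seq" for A
    unfolding past_law_def using that by (intro measure_distr) auto
  obtain m0 where m0: "J \<subseteq> {..<m0}" using J finite_nat_iff_bounded by auto
  have "Lpnorm past_law 1 (\<lambda>u. lagged_cond_exp m (indicator S) u - (\<integral>v. indicator S v \<partial>past_law)) = 0" if m: "m \<ge> m0" for m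
  proof -
    interpret G: sigma_finite_subalgebra past_law "vimage_algebra (space Seq) (shift m) Seq"
      by (rule sigma_finite_shift)
    have "AE u in past_law. real_cond_exp past_law (vimage_algebra (space Seq) (shift m) Seq) (indicator S) u = measure past_law S"
    proof (rule G.real_cond_exp_charact)
      fix A assume A: "A \<in> sets (vimage_algebra (space Seq) (shift m) Seq)"
      then have A'[measurable]: "A \<in> sets Seq" using subalgebra_shift by (auto simp: subalgebra_def)
      have "A \<in> {shift m -` B \<inter> space Seq | B. B \<in> sets Seq}"
        using A sets_vimage_algebra2[of "shift m" "space Seq" Seq] measurable_space[OF shift_measurable] by auto
      then obtain B where B: "B \<in> sets Seq" "A = shift m -` B \<inter> space Seq" by auto
      have "past 0 -` A \<inter> space M = past (- int m) -` B \<inter> space M"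
        using B by (auto simp: past_space shift_past)
      also have "\<dots> \<in> sets (F (- int m))"
        using measurable_sets[OF past_measurable_F[OF order_refl] B(1)] by simp
      finally have AF: "past 0 -` A \<inter> space M \<in> sets (F (- int m))" .
      have "measure past_law (A \<inter> S) = prob ((past 0 -` A \<inter> space M) \<inter> (past 0 -` S \<inter> space M))"
        by (subst law) (auto intro!: arg_cong[where f=prob])
      also have "\<dots> = prob (past 0 -` A \<inter> space M) * prob (past 0 -` S \<inter> space M)"
        unfolding pre using J m0 m E by (intro indep_past_cylinder[OF AF]) auto
      finally have "measure past_law (A \<inter> S) = measure past_law A * measure past_law S"
        by (simp add: law)
      then show "(\<integral>u\<in>A. indicator S u \<partial>past_law) = (\<integral>u\<in>A. measure past_law S \<partial>past_law)"
        by (simp add: set_lebesgue_integral_def flip: indicator_inter_arith)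
    qed (auto simp: L.emeasure_eq_measure)
    then have "AE u in past_law. lagged_cond_exp m (indicator S) u - (\<integral>v. indicator S v \<partial>past_law) = 0"
      unfolding lagged_cond_exp_def[symmetric] by eventually_elim (simp add: Int_absorb1 sets.sets_into_space[OF S])
    then have "Lpnorm past_law 1 (\<lambda>u. lagged_cond_exp m (indicator S) u - (\<integral>v. indicator S v \<partial>past_law)) = Lpnorm past_law 1 (\<lambda>_. 0)"
      by (intro Lpnorm_cong_AE) auto
    then show ?thesis by simp
  qed
  then show ?thesis
    unfolding past_forgetting_def S_def[symmetric]
    by (intro tendsto_eventually) (auto simp: eventually_sequentially)
qed

text \<open>Dynkin's argument starting from cylinders. Order 1 is convenient because a countable
  disjoint union is approximated by finite ones with error equal to the measure of the rest.\<close>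

lemma past_forgetting_indicator:
  assumes "A \<in> sets Seq"
  shows "past_forgetting 1 (indicator A)"
proof -
  interpret L: prob_space past_law by (rule prob_space_past_law)
  let ?\<Omega> = "\<Pi>\<^sub>E i\<in>(UNIV::nat set). space N"
  have sub: "prod_algebra (UNIV::nat set) (\<lambda>_. N) \<subseteq> Pow ?\<Omega>" by (rule prod_algebra_sets_into_space)
  have int: "in_Lp past_law 1 (indicator A)" if "A \<in> sets Seq" for A
    using that unfolding in_Lp_1 by (intro integrable_real_indicator) (auto simp: L.emeasure_eq_measure)
  have const: "past_forgetting 1 (\<lambda>u. c)" for c
    unfolding past_forgetting_def
  proof (rule tendsto_eventually, rule always_eventually, rule allI)
    fix m
    interpret G: sigma_finite_subalgebra past_law "vimage_algebra (space Seq) (shift m) Seq"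
      by (rule sigma_finite_shift)
    have "AE u in past_law. lagged_cond_exp m (\<lambda>u. c) u = c"
      unfolding lagged_cond_exp_def by (rule G.real_cond_exp_F_meas) auto
    then have "AE u in past_law. lagged_cond_exp m (\<lambda>u. c) u - (\<integral>v. c \<partial>past_law) = 0"
      by eventually_elim simp
    then have "Lpnorm past_law 1 (\<lambda>u. lagged_cond_exp m (\<lambda>u. c) u - (\<integral>v. c \<partial>past_law)) = Lpnorm past_law 1 (\<lambda>_. 0)"
      by (intro Lpnorm_cong_AE) auto
    then show "Lpnorm past_law 1 (\<lambda>u. lagged_cond_exp m (\<lambda>u. c) u - (\<integral>v. c \<partial>past_law)) = 0" by simp
  qed
  have "A \<in> sigma_sets ?\<Omega> (prod_algebra UNIV (\<lambda>_. N))" using assms by (simp add: sets_PiM)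
  then show ?thesis
  proof (induction rule: sigma_sets_induct_disjoint[OF Int_stable_prod_algebra sub, consumes 1])
    case (1 A)
    then obtain J E where "A = prod_emb UNIV (\<lambda>_. N) J (Pi\<^sub>E J E)" "finite J" "\<And>i. i \<in> J \<Longrightarrow> E i \<in> sets N"
      by (elim prod_algebraE) auto
    then show ?case using past_forgetting_cylinder by simp
  next
    case 2
    show ?case using const[of 0] by (simp add: indicator_def[abs_def])
  next
    case (3 A)
    then have A: "A \<in> sets Seq" by (simp add: sets_PiM)
    have "past_forgetting 1 (\<lambda>u. 1 + (-1) * indicator A u)"
      by (intro past_forgetting_add past_forgetting_cmult const 3 in_Lp_cmult int A) auto
    \<comment> \<open>The indicator of the complement and 1 minus the indicator need agree only on
      the space, so they are linked by an approximation with error 0.\<close>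
    moreover have "past_forgetting 1 (indicator (?\<Omega> - A))"
      if *: "past_forgetting 1 (\<lambda>u. 1 + (-1) * indicator A u)"
    proof (rule past_forgetting_approx)
      have sp: "?\<Omega> = space Seq" by (simp add: space_PiM)
      show "in_Lp past_law 1 (indicator (?\<Omega> - A))" unfolding sp using A by (intro int) auto
      fix e :: real assume "e > 0"
      have "Lpnorm past_law 1 (\<lambda>u. indicator (?\<Omega> - A) u - (1 + (-1) * indicator A u)) = Lpnorm past_law 1 (\<lambda>u. 0)"
        unfolding sp using A
        by (intro Lpnorm_cong_AE AE_I2) (auto simp: indicator_def)
      then have "Lpnorm past_law 1 (\<lambda>u. indicator (?\<Omega> - A) u - (1 + (-1) * indicator A u)) \<le> e"
        using \<open>e > 0\<close> by simp
      moreover have "in_Lp past_law 1 (\<lambda>u. 1 + (-1) * indicator A u)"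
        by (intro in_Lp_add in_Lp_cmult int A) auto
      ultimately show "\<exists>g. in_Lp past_law 1 g \<and> past_forgetting 1 g \<and> Lpnorm past_law 1 (\<lambda>u. indicator (?\<Omega> - A) u - g u) \<le> e"
        using * by blast
    qed simp
    ultimately show ?case by blast
  next
    case (4 A)
    then have A: "\<And>i. A i \<in> sets Seq" by (auto simp: sets_PiM)
    then have UA: "(\<Union>i. A i) \<in> sets Seq" by auto
    define B where "B n = (\<Union>i<n. A i)" for n
    have B: "B n \<in> sets Seq" for n using A by (auto simp: B_def)
    have Bp: "past_forgetting 1 (indicator (B n))" for n
    proof (induction n)
      case 0
      then show ?case using const[of 0] by (simp add: indicator_def[abs_def] B_def)
    next
      case (Suc n)
      have "A n \<inter> A i = {}" if "i < n" for i
        using disjoint_family_onD[OF 4(1), of n i] that by simp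
      then have "A n \<inter> B n = {}" unfolding B_def by blast
      then have "indicator (B (Suc n)) = (\<lambda>u. indicator (B n) u + indicator (A n) u :: real)"
        by (auto simp: B_def lessThan_Suc indicator_def fun_eq_iff)
      moreover have "past_forgetting 1 (\<lambda>u. indicator (B n) u + indicator (A n) u)"
        by (intro past_forgetting_add int A B Suc 4(3)) simp
      ultimately show ?case by simp
    qed
    show ?case
    proof (rule past_forgetting_approx)
      show "in_Lp past_law 1 (indicator (\<Union>i. A i))" using UA by (rule int)
      fix e :: real assume e: "e > 0"
      have "(\<lambda>n. measure past_law (B n)) \<longlonglongrightarrow> measure past_law (\<Union>n. B n)"
      proof (rule L.finite_Lim_measure_incseq)
        show "incseq B" unfolding incseq_def B_def by (intro allI impI UN_mono) auto
      qed (use B in auto)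
      also have "(\<Union>n. B n) = (\<Union>i. A i)" by (auto simp: B_def)
      finally obtain n where n: "norm (measure past_law (B n) - measure past_law (\<Union>i. A i)) < e"
        using LIMSEQ_D[OF _ e] by blast
      have BU: "B n \<subseteq> (\<Union>i. A i)" by (auto simp: B_def)
      have "Lpnorm past_law 1 (\<lambda>u. indicator (\<Union>i. A i) u - indicator (B n) u) = (\<integral>u. indicator ((\<Union>i. A i) - B n) u \<partial>past_law)"
        unfolding Lpnorm_1 using BU by (intro Bochner_Integration.integral_cong) (auto simp: indicator_def)
      also have "\<dots> = measure past_law ((\<Union>i. A i) - B n)"
        using sets.sets_into_space[OF UA] by (simp add: Int_absorb2 Diff_subset_conv le_supI2)
      also have "\<dots> = measure past_law (\<Union>i. A i) - measure past_law (B n)"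
        using UA B BU by (intro L.finite_measure_Diff) auto
      also have "\<dots> \<le> e" using n by simp
      finally show "\<exists>g. in_Lp past_law 1 g \<and> past_forgetting 1 g \<and> Lpnorm past_law 1 (\<lambda>u. indicator (\<Union>i. A i) u - g u) \<le> e"
        using Bp int B by blast
    qed simp
  qed
qed

lemma past_forgetting_L1:
  assumes "integrable past_law f"
  shows "past_forgetting 1 f"
  using assms
proof (induction rule: integrable_induct)
  case (base A c)
  interpret L: prob_space past_law by (rule prob_space_past_law)
  have "in_Lp past_law 1 (indicator A)"
    using base unfolding in_Lp_1 by (intro integrable_real_indicator) (auto simp: L.emeasure_eq_measure)
  then have "past_forgetting 1 (\<lambda>u. c * indicator A u)"
    using base by (intro past_forgetting_cmult past_forgetting_indicator) auto
  then show ?case by (simp add: mult.commute)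
next
  case (add f g)
  then show ?case by (intro past_forgetting_add) (auto simp: in_Lp_1)
next
  case (lim f s)
  have conv: "(\<lambda>i. s i x) \<longlonglongrightarrow> f x" if "x \<in> space past_law" for x
    using that by (rule lim)
  have bound: "norm (s i x) \<le> 2 * norm (f x)" if "x \<in> space past_law" for i x
    using that by (rule lim)
  show ?case
  proof (rule past_forgetting_approx)
    fix e :: real assume e: "e > 0"
    have "(\<lambda>i. \<integral>u. \<bar>f u - s i u\<bar> \<partial>past_law) \<longlonglongrightarrow> (\<integral>u. 0 \<partial>past_law)"
    proof (rule integral_dominated_convergence[where w = "\<lambda>u. 3 * \<bar>f u\<bar>"])
      show "AE u in past_law. (\<lambda>i. \<bar>f u - s i u\<bar>) \<longlonglongrightarrow> 0"
      proof (rule AE_I2)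
        fix u assume "u \<in> space past_law"
        then have "(\<lambda>i. \<bar>f u - s i u\<bar>) \<longlonglongrightarrow> \<bar>f u - f u\<bar>" by (intro tendsto_intros conv)
        then show "(\<lambda>i. \<bar>f u - s i u\<bar>) \<longlonglongrightarrow> 0" by simp
      qed
      show "AE u in past_law. norm \<bar>f u - s i u\<bar> \<le> 3 * \<bar>f u\<bar>" for i
        using bound[of _ i] by (intro AE_I2) (smt (verit) real_norm_def)
    qed (use lim in auto)
    then obtain i where "norm ((\<integral>u. \<bar>f u - s i u\<bar> \<partial>past_law) - (\<integral>u. 0 \<partial>past_law)) < e"
      using LIMSEQ_D[OF _ e] by blast
    then have "Lpnorm past_law 1 (\<lambda>u. f u - s i u) \<le> e"
      by (simp add: Lpnorm_1)
    then show "\<exists>g. in_Lp past_law 1 g \<and> past_forgetting 1 g \<and> Lpnorm past_law 1 (\<lambda>u. f u - g u) \<le> e"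
      using lim by (intro exI[of _ "s i"]) (auto simp: in_Lp_1)
  qed (use lim in \<open>auto simp: in_Lp_1\<close>)
qed

text \<open>The deviation h is a.e. bounded by 2 K, hence |h|^q \<le> (2 K)^(q-1) |h|, and
  convergence in L^1 improves to L^q.\<close>

lemma past_forgetting_bounded:
  assumes f: "f \<in> borel_measurable Seq" and K: "\<And>u. \<bar>f u\<bar> \<le> K" and q: "1 \<le> q"
  shows "past_forgetting q f"
proof -
  interpret L: prob_space past_law by (rule prob_space_past_law)
  have fm: "f \<in> borel_measurable past_law" using f by (simp add: measurable_cong_sets[OF sets_past_law refl])
  have K0: "K \<ge> 0" using K[of undefined] by linarith
  have fi: "integrable past_law f"
    by (rule L.integrable_const_bound[of _ K]) (use K fm in auto)
  define c where "c = (\<integral>v. f v \<partial>past_law)"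
  define h where "h m u = lagged_cond_exp m f u - c" for m u
  have hm [measurable]: "h m \<in> borel_measurable past_law" for m
    unfolding h_def by (simp add: measurable_cong_sets[OF sets_past_law refl])
  have "\<bar>c\<bar> \<le> (\<integral>v. \<bar>f v\<bar> \<partial>past_law)" unfolding c_def by simp
  also have "\<dots> \<le> (\<integral>v. K \<partial>past_law)" using fi K by (intro integral_mono) auto
  finally have cK: "\<bar>c\<bar> \<le> K" by simp
  have hK: "AE u in past_law. \<bar>h m u\<bar> \<le> 2 * K" for m
  proof -
    interpret G: sigma_finite_subalgebra past_law "vimage_algebra (space Seq) (shift m) Seq"
      by (rule sigma_finite_shift)
    have "AE u in past_law. lagged_cond_exp m f u \<le> K" "AE u in past_law. lagged_cond_exp m f u \<ge> - K"
      unfolding lagged_cond_exp_def using K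
      by (intro G.real_cond_exp_le_c G.real_cond_exp_ge_c fi AE_I2, auto simp: abs_le_iff minus_le_iff)+
    then show ?thesis by eventually_elim (use cK in \<open>auto simp: h_def\<close>)
  qed
  have hint: "integrable past_law (h m)" for m
    by (rule L.integrable_const_bound[OF _ hm]) (use hK in simp)
  have le: "Lpnorm past_law q (h m) \<le> ((2 * K) powr (q - 1) * Lpnorm past_law 1 (h m)) powr (1 / q)" for m
  proof -
    have "AE u in past_law. \<bar>h m u\<bar> powr q \<le> (2 * K) powr (q - 1) * \<bar>h m u\<bar>"
      using hK[of m]
    proof eventually_elim
      fix u assume u: "\<bar>h m u\<bar> \<le> 2 * K"
      have "\<bar>h m u\<bar> powr q = \<bar>h m u\<bar> powr (q - 1) * \<bar>h m u\<bar>"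
        by (cases "h m u = 0") (auto simp: powr_diff)
      also have "\<dots> \<le> (2 * K) powr (q - 1) * \<bar>h m u\<bar>"
        using u q by (intro mult_right_mono powr_mono2) auto
      finally show "\<bar>h m u\<bar> powr q \<le> (2 * K) powr (q - 1) * \<bar>h m u\<bar>" .
    qed
    then have "(\<integral>u. \<bar>h m u\<bar> powr q \<partial>past_law) \<le> (\<integral>u. (2 * K) powr (q - 1) * \<bar>h m u\<bar> \<partial>past_law)"
      using hint[of m] by (intro integral_mono_AE' integrable_mult_right) auto
    then have "(\<integral>u. \<bar>h m u\<bar> powr q \<partial>past_law) \<le> (2 * K) powr (q - 1) * Lpnorm past_law 1 (h m)"
      by (simp add: Lpnorm_1)
    then show ?thesis unfolding Lpnorm_def[of _ q] using q by (intro powr_mono2) auto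
  qed
  have "(\<lambda>m. Lpnorm past_law 1 (h m)) \<longlonglongrightarrow> 0"
    using past_forgetting_L1[OF fi] unfolding past_forgetting_def c_def[symmetric] h_def .
  then have "(\<lambda>m. (2 * K) powr (q - 1) * Lpnorm past_law 1 (h m)) \<longlonglongrightarrow> 0"
    by (rule tendsto_mult_right_zero)
  then have "(\<lambda>m. ((2 * K) powr (q - 1) * Lpnorm past_law 1 (h m)) powr (1 / q)) \<longlonglongrightarrow> 0"
    using q by (intro tendsto_zero_powrI[OF _ tendsto_const]) auto
  then have "(\<lambda>m. Lpnorm past_law q (h m)) \<longlonglongrightarrow> 0"
    by (rule real_tendsto_sandwich[OF _ _ tendsto_const, rotated 2]) (use le in auto)
  then show ?thesis unfolding past_forgetting_def c_def[symmetric] h_def .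
qed

text \<open>Truncations at levels -n and n are bounded and converge to f in L^q by dominated
  convergence.\<close>

lemma past_forgetting_Lp:
  assumes f: "in_Lp past_law q f" and q: "1 \<le> q"
  shows "past_forgetting q f"
proof (rule past_forgetting_approx[OF f q])
  fix e :: real assume e: "e > 0"
  define t where "t n u = max (- real n) (min (real n) (f u))" for n u
  have fS [measurable]: "f \<in> borel_measurable Seq" by (rule in_Lp_past_law_measurable[OF f])
  have tS [measurable]: "t n \<in> borel_measurable Seq" for n unfolding t_def by measurable
  have tb: "\<bar>t n u\<bar> \<le> \<bar>f u\<bar>" "\<bar>t n u\<bar> \<le> real n" "\<bar>f u - t n u\<bar> \<le> \<bar>f u\<bar>" for n u
    by (auto simp: t_def max_def min_def)
  have "(\<lambda>n. \<integral>u. \<bar>f u - t n u\<bar> powr q \<partial>past_law) \<longlonglongrightarrow> (\<integral>u. 0 \<partial>past_law)"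
  proof (rule integral_dominated_convergence[where w = "\<lambda>u. \<bar>f u\<bar> powr q"])
    show "AE u in past_law. (\<lambda>n. \<bar>f u - t n u\<bar> powr q) \<longlonglongrightarrow> 0"
    proof (rule AE_I2)
      fix u
      obtain n0 where n0: "\<bar>f u\<bar> \<le> real n0" using real_arch_simple by blast
      have "\<bar>f u - t n u\<bar> powr q = 0" if "n \<ge> n0" for n
      proof -
        have "real n0 \<le> real n" using that by simp
        then have "t n u = f u" using n0 by (auto simp: t_def max_def min_def)
        then show ?thesis by simp
      qed
      then show "(\<lambda>n. \<bar>f u - t n u\<bar> powr q) \<longlonglongrightarrow> 0"
        by (intro tendsto_eventually) (auto simp: eventually_sequentially)
    qed
    show "AE u in past_law. norm (\<bar>f u - t n u\<bar> powr q) \<le> \<bar>f u\<bar> powr q" for n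
      using tb q by (auto intro!: powr_mono2)
  qed (use f in auto)
  then have lim: "(\<lambda>n. \<integral>u. \<bar>f u - t n u\<bar> powr q \<partial>past_law) \<longlonglongrightarrow> 0" by simp
  obtain n where "norm ((\<integral>u. \<bar>f u - t n u\<bar> powr q \<partial>past_law) - 0) < e powr q"
    using LIMSEQ_D[OF lim, of "e powr q"] e by auto
  then have "Lpnorm past_law q (\<lambda>u. f u - t n u) \<le> e"
    using e q by (subst Lpnorm_le_iff) auto
  moreover have "in_Lp past_law q (t n)"
    using tb q tS[of n] by (intro in_Lp_bound_AE[OF f] AE_I2) (auto simp: measurable_cong_sets[OF sets_past_law refl])
  moreover have "past_forgetting q (t n)"
    using tb q by (intro past_forgetting_bounded[of _ "real n"]) auto
  ultimately show "\<exists>g. in_Lp past_law q g \<and> past_forgetting q g \<and> Lpnorm past_law q (\<lambda>u. f u - g u) \<le> e" by blast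
qed

end

section \<open>The law of large numbers and the martingale approximation\<close>

lemma powr_sublinear:
  fixes \<theta> e :: real
  assumes "0 \<le> \<theta>" "\<theta> < 1" "0 < e"
  shows "\<exists>C\<ge>0. \<forall>x\<ge>0. x powr \<theta> \<le> e * x + C"
proof -
  \<comment> \<open>Rescaling x to \<delta> x gives the tangent bound the slope
    \<delta>^(1-\<theta>), which this choice makes equal to e.\<close>
  define \<delta> where "\<delta> = e powr (1 / (1 - \<theta>))"
  have d: "\<delta> > 0" using assms by (simp add: \<delta>_def)
  have de: "\<delta> powr (1 - \<theta>) = e" using assms by (simp add: \<delta>_def powr_powr)
  show ?thesis
  proof (intro exI conjI allI impI)
    show "0 \<le> \<delta> powr (- \<theta>)" by simp
    fix x :: real assume x: "0 \<le> x"
    have "(\<delta> * x) powr \<theta> \<le> \<theta> * (\<delta> * x) + (1 - \<theta>)"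
      using d x assms by (intro powr_tangent) auto
    also have "\<dots> \<le> \<delta> * x + 1"
    proof -
      have "\<theta> * (\<delta> * x) \<le> 1 * (\<delta> * x)" using d x assms by (intro mult_right_mono) auto
      then show ?thesis using assms by simp
    qed
    finally have "\<delta> powr (- \<theta>) * (\<delta> * x) powr \<theta> \<le> \<delta> powr (- \<theta>) * (\<delta> * x + 1)"
      by (intro mult_left_mono) auto
    also have "\<dots> = \<delta> powr (1 - \<theta>) * x + \<delta> powr (- \<theta>)"
      using d by (simp add: algebra_simps powr_diff powr_minus divide_inverse)
    finally show "x powr \<theta> \<le> e * x + \<delta> powr (- \<theta>)"
      using d de by (simp add: powr_mult powr_minus flip: mult.assoc)
  qed
qed

lemma powr_sublinear_scaled:
  fixes \<theta> e K B :: real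
  assumes "0 \<le> \<theta>" "\<theta> < 1" "0 < e" "0 \<le> K" "0 \<le> B"
  shows "\<exists>C\<ge>0. \<forall>l::nat. (K * real l) powr \<theta> * B \<le> e * real l + C"
proof -
  define e' where "e' = e / ((K + 1) * (B + 1))"
  have e': "e' > 0" using assms by (simp add: e'_def)
  obtain C where C: "C \<ge> 0" "\<And>x. x \<ge> 0 \<Longrightarrow> x powr \<theta> \<le> e' * x + C"
    using powr_sublinear[OF assms(1,2) e'] by blast
  have KB: "K * B \<le> (K + 1) * (B + 1)" using assms by (simp add: algebra_simps)
  have "e' * (K * B) \<le> e' * ((K + 1) * (B + 1))" using KB e' by (intro mult_left_mono) auto
  also have "\<dots> = e" using assms by (simp add: e'_def)
  finally have ee: "e' * (K * B) \<le> e" .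
  have "(K * real l) powr \<theta> * B \<le> e * real l + C * B" for l
  proof -
    have "(K * real l) powr \<theta> * B \<le> (e' * (K * real l) + C) * B"
      using assms by (intro mult_right_mono C) auto
    also have "\<dots> = (e' * (K * B)) * real l + C * B" by (simp add: algebra_simps)
    also have "\<dots> \<le> e * real l + C * B" using ee by (intro add_right_mono mult_right_mono) auto
    finally show ?thesis .
  qed
  then show ?thesis using C assms by (intro exI[of _ "C * B"]) auto
qed

text \<open>Both windows are completed to the same sum of l + j terms. A shift by j changes only j
  terms at each end, however long the window is.\<close>

lemma sum_shift_window:
  fixes b :: "nat \<Rightarrow> 'a::ab_group_add"
  shows "(\<Sum>n<l. b n) - (\<Sum>n<l. b (j + n)) = (\<Sum>i<j. b i) - (\<Sum>i<j. b (l + i))"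
proof -
  have s: "(\<Sum>n<u + v. b n) = (\<Sum>n<u. b n) + (\<Sum>n<v. b (u + n))" for u v
    by (induction v) (auto simp: algebra_simps)
  have "(\<Sum>n<l. b n) + (\<Sum>i<j. b (l + i)) = (\<Sum>i<j. b i) + (\<Sum>n<l. b (j + n))"
    using s[of l j] s[of j l] by (simp add: add.commute)
  then show ?thesis by (simp add: algebra_simps)
qed

context iid_sequence begin

lemma CE_telescope:
  "CE (k - int m) Z x = (\<Sum>j<d. Proj (k - int (m + j)) Z x) + CE (k - int (m + d)) Z x"
proof (induction d)
  case (Suc d)
  have "CE (k - int (m + d)) Z x = Proj (k - int (m + d)) Z x + CE (k - int (m + Suc d)) Z x"
    unfolding proj_def by (simp add: algebra_simps)
  then show ?case using Suc by simp
qed simp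

lemma CE_Y_self:
  assumes f: "in_Lp past_law q f" and q: "1 \<le> q"
  shows "AE x in M. CE k (Y f k) x = Y f k x"
proof -
  interpret C: sigma_finite_subalgebra M "F k" by (rule sigma_finite_F)
  show ?thesis
    using in_Lp_integrable[OF in_Lp_Y'[OF f] q] Y_measurable_F[OF in_Lp_past_law_measurable[OF f] order_refl]
    by (rule C.real_cond_exp_F_meas)
qed

lemma CE_sum_Y:
  assumes f: "in_Lp past_law q f" and q: "1 \<le> q"
  shows "AE x in M. \<forall>n<l. CE (s + int n) (Y f (s + int n)) x = Y f (s + int n) x"
  using CE_Y_self[OF f q] by (subst AE_all_countable | auto)+

text \<open>Fix m with E(Y_k | F_(k-m)) within e/2 of the mean; this part costs at most (e/2) l.
  What remains are m lagged martingale sums of sublinear order, absorbed in (e/2) l + C. By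
  stationarity C does not depend on s.\<close>

lemma law_of_large_numbers_Lp:
  assumes f: "in_Lp past_law p f" and p: "1 < p" and e: "0 < e"
  shows "\<exists>C\<ge>0. \<forall>s l. Lpnorm M p (\<lambda>x. \<Sum>n<l. (Y f (s + int n) x - (\<integral>u. f u \<partial>past_law))) \<le> e * real l + C"
proof -
  define c where "c = (\<integral>u. f u \<partial>past_law)"
  let ?\<theta> = "1 / min 2 p" and ?K = "moment_const p"
  define B where "B j = Lpnorm M p (Proj 0 (Y f (int j)))" for j
  have p1: "1 \<le> p" using p by simp
  have "eventually (\<lambda>m. Lpnorm past_law p (\<lambda>u. lagged_cond_exp m f u - c) < e / 2) sequentially"
    using order_tendstoD(2)[OF past_forgetting_Lp[OF f p1, unfolded past_forgetting_def], of "e / 2"] e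
    by (simp add: c_def)
  then obtain m where m: "Lpnorm past_law p (\<lambda>u. lagged_cond_exp m f u - c) < e / 2"
    by (auto simp: eventually_sequentially)
  obtain C where C: "C \<ge> 0" "\<And>l. (?K * real l) powr ?\<theta> * (\<Sum>j<m. B j) \<le> e / 2 * real l + C"
    using powr_sublinear_scaled[of ?\<theta> "e/2" ?K "\<Sum>j<m. B j"] p e moment_const_ge_1[of p]
    by (auto simp: B_def sum_nonneg field_simps)
  have YL: "in_Lp M p (Y f k)" for k by (rule in_Lp_Y'[OF f])
  have "Lpnorm M p (\<lambda>x. \<Sum>n<l. (Y f (s + int n) x - c)) \<le> e * real l + C" for s l
  proof -
    let ?k = "\<lambda>n. s + int n"
    have PL: "in_Lp M p (\<lambda>x. \<Sum>n<l. Proj (?k n - int j) (Y f (?k n)) x)" for j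
      using p1 by (intro in_Lp_sum proj_in_Lp YL) auto
    have RL: "in_Lp M p (\<lambda>x. CE (?k n - int m) (Y f (?k n)) x - c)" for n
      using p1 by (intro in_Lp_diff CE_in_Lp YL) auto
    have "AE x in M. (\<Sum>n<l. (Y f (?k n) x - c))
        = (\<Sum>j<m. \<Sum>n<l. Proj (?k n - int j) (Y f (?k n)) x) + (\<Sum>n<l. CE (?k n - int m) (Y f (?k n)) x - c)"
      using CE_sum_Y[OF f p1, of l s]
    proof eventually_elim
      fix x assume x: "\<forall>n<l. CE (?k n) (Y f (?k n)) x = Y f (?k n) x"
      have "(\<Sum>n<l. (Y f (?k n) x - c)) = (\<Sum>n<l. (\<Sum>j<m. Proj (?k n - int j) (Y f (?k n)) x) + (CE (?k n - int m) (Y f (?k n)) x - c))"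
        using x CE_telescope[of "?k n" 0 "Y f (?k n)" x m for n] by (intro sum.cong) auto
      also have "\<dots> = (\<Sum>j<m. \<Sum>n<l. Proj (?k n - int j) (Y f (?k n)) x) + (\<Sum>n<l. CE (?k n - int m) (Y f (?k n)) x - c)"
        unfolding sum.distrib by (subst sum.swap) simp
      finally show "(\<Sum>n<l. (Y f (?k n) x - c))
        = (\<Sum>j<m. \<Sum>n<l. Proj (?k n - int j) (Y f (?k n)) x) + (\<Sum>n<l. CE (?k n - int m) (Y f (?k n)) x - c)" .
    qed
    then have "Lpnorm M p (\<lambda>x. \<Sum>n<l. (Y f (?k n) x - c))
       = Lpnorm M p (\<lambda>x. (\<Sum>j<m. \<Sum>n<l. Proj (?k n - int j) (Y f (?k n)) x) + (\<Sum>n<l. CE (?k n - int m) (Y f (?k n)) x - c))"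
      using YL PL RL by (intro Lpnorm_cong_AE) (measurable, auto)
    also have "\<dots> \<le> Lpnorm M p (\<lambda>x. \<Sum>j<m. \<Sum>n<l. Proj (?k n - int j) (Y f (?k n)) x)
         + Lpnorm M p (\<lambda>x. \<Sum>n<l. CE (?k n - int m) (Y f (?k n)) x - c)"
      using p1 PL RL by (intro Lpnorm_triangle in_Lp_sum[where f = "\<lambda>j x. \<Sum>n<l. Proj (?k n - int j) (Y f (?k n)) x"] in_Lp_sum[where f = "\<lambda>n x. CE (?k n - int m) (Y f (?k n)) x - c"]) auto
    also have "Lpnorm M p (\<lambda>x. \<Sum>j<m. \<Sum>n<l. Proj (?k n - int j) (Y f (?k n)) x)
         \<le> (\<Sum>j<m. Lpnorm M p (\<lambda>x. \<Sum>n<l. Proj (?k n - int j) (Y f (?k n)) x))"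
      using p1 PL by (intro Lpnorm_sum[where f = "\<lambda>j x. \<Sum>n<l. Proj (?k n - int j) (Y f (?k n)) x"]) auto
    also have "\<dots> \<le> (\<Sum>j<m. (?K * real l) powr ?\<theta> * B j)"
      unfolding B_def by (intro sum_mono Lpnorm_proj_sum f p)
    also have "\<dots> = (?K * real l) powr ?\<theta> * (\<Sum>j<m. B j)" by (simp add: sum_distrib_left)
    also have "\<dots> \<le> e / 2 * real l + C" by (rule C)
    also have "Lpnorm M p (\<lambda>x. \<Sum>n<l. CE (?k n - int m) (Y f (?k n)) x - c)
        \<le> (\<Sum>n<l. Lpnorm M p (\<lambda>x. CE (?k n - int m) (Y f (?k n)) x - c))"
      using p1 RL by (intro Lpnorm_sum) auto
    also have "\<dots> \<le> (\<Sum>n<l. e / 2)"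
      using m by (intro sum_mono) (simp add: Lpnorm_CE_lagged[OF f p1])
    finally show ?thesis by simp
  qed
  then show ?thesis using C(1) unfolding c_def by blast
qed

section \<open>Truncated martingale differences and the approximation of sums of the process\<close>

definition mart_diff :: "nat \<Rightarrow> ((nat \<Rightarrow> 'b) \<Rightarrow> real) \<Rightarrow> int \<Rightarrow> 'a \<Rightarrow> real" where
  "mart_diff m f k x = (\<Sum>j<m. Proj k (Y f (k + int j)) x)"

definition dependence :: "real \<Rightarrow> ((nat \<Rightarrow> 'b) \<Rightarrow> real) \<Rightarrow> nat \<Rightarrow> real" where
  "dependence q f j = Lpnorm M q (Proj 0 (Y f (int j)))"

lemma dependence_nonneg [simp]: "0 \<le> dependence q f j" by (simp add: dependence_def)

context
  fixes q :: real and f :: "(nat \<Rightarrow> 'b) \<Rightarrow> real"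
  assumes f: "in_Lp past_law q f" and q: "1 < q"
begin

lemma q_ge_1: "1 \<le> q" using q by simp

lemma mart_diff_in_Lp: "in_Lp M q (mart_diff m f k)"
  unfolding mart_diff_def[abs_def] using q_ge_1 by (intro in_Lp_sum proj_in_Lp in_Lp_Y' f) auto

lemma mart_diff_Lpnorm: "Lpnorm M q (mart_diff m f k) \<le> (\<Sum>j<m. dependence q f j)"
proof -
  have "Lpnorm M q (mart_diff m f k) \<le> (\<Sum>j<m. Lpnorm M q (Proj k (Y f (k + int j))))"
    unfolding mart_diff_def[abs_def] using q_ge_1 by (intro Lpnorm_sum proj_in_Lp in_Lp_Y' f) auto
  also have "\<dots> = (\<Sum>j<m. dependence q f j)"
    unfolding dependence_def by (intro sum.cong refl proj_Lpnorm_stationary[OF f q_ge_1])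
  finally show ?thesis .
qed

lemma mart_diff_measurable_F: "j \<le> k \<Longrightarrow> mart_diff m f j \<in> borel_measurable (F k)"
  unfolding mart_diff_def[abs_def] by (intro borel_measurable_sum proj_measurable_F)

lemma CE_mart_diff: "AE x in M. CE (k - 1) (mart_diff m f k) x = 0"
proof -
  interpret C: sigma_finite_subalgebra M "F (k - 1)" by (rule sigma_finite_F)
  have Yi: "integrable M (Y f i)" for i by (rule in_Lp_integrable[OF in_Lp_Y'[OF f] q_ge_1])
  have i: "integrable M (Proj k (Y f (k + int j)))" for j
    by (rule in_Lp_integrable[OF proj_in_Lp[OF in_Lp_Y'[OF f] q_ge_1] q_ge_1])
  have "AE x in M. \<forall>j. CE (k - 1) (Proj k (Y f (k + int j))) x = 0"
    unfolding AE_all_countable by (intro allI CE_proj_zero Yi)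
  then show ?thesis
    using C.real_cond_exp_sum[where f = "\<lambda>j. Proj k (Y f (k + int j))" and I = "{..<m}", OF i]
    unfolding mart_diff_def[abs_def] by eventually_elim simp
qed

text \<open>The projections are represented at the times k + j with j < m, and shifts only move
  backwards. The representing function is therefore attached to time k + m, from which k + j is
  reached by \<open>shift (m - j)\<close>.\<close>

lemma mart_diff_stationary:
  "\<exists>h. in_Lp past_law q h \<and> (\<forall>k. AE x in M. mart_diff m f k x = Y h (k + int m) x)"
proof -
  define h where "h u = (\<Sum>j<m. innovation j f (shift (m - j) u))" for u
  have hm: "h \<in> borel_measurable Seq" unfolding h_def by measurable
  have AE: "AE x in M. mart_diff m f k x = Y h (k + int m) x" for k
  proof -
    have "AE x in M. \<forall>j. Proj k (Y f (k + int j)) x = Y (innovation j f) (k + int j) x"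
      unfolding AE_all_countable by (intro allI proj_eq_innovation in_Lp_past_law_integrable[OF f q_ge_1])
    then show ?thesis
    proof eventually_elim
      fix x assume x: "\<forall>j. Proj k (Y f (k + int j)) x = Y (innovation j f) (k + int j) x"
      have "mart_diff m f k x = (\<Sum>j<m. innovation j f (past (k + int j) x))"
        unfolding mart_diff_def using x by (simp add: Y_past)
      also have "\<dots> = (\<Sum>j<m. innovation j f (shift (m - j) (past (k + int m) x)))"
        by (intro sum.cong refl) (auto simp: shift_past of_nat_diff)
      finally show "mart_diff m f k x = Y h (k + int m) x" by (simp add: h_def Y_past)
    qed
  qed
  have "in_Lp M q (Y h (0 + int m))"
    using in_Lp_cong_AE[OF AE[of 0], of q] mart_diff_in_Lp[of m 0] Y_measurable[OF hm] by auto
  then have "in_Lp past_law q h" using in_Lp_Y[OF hm] by simp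
  then show ?thesis using AE by blast
qed

lemma Lpnorm_mart_diff_sum:
  "Lpnorm M q (\<lambda>x. \<Sum>n<l. mart_diff m f (s + int n) x)
     \<le> (moment_const q * real l) powr (1 / min 2 q) * (\<Sum>j<m. dependence q f j)"
proof (rule Lpnorm_martingale_sum_bound[where G = "\<lambda>n. F (s + int n - 1)"])
  show "AE x in M. CE (s + int i - 1) (mart_diff m f (s + int i)) x = 0" for i by (rule CE_mart_diff)
qed (auto intro!: subalgebra_F mart_diff_in_Lp mart_diff_measurable_F mart_diff_Lpnorm q)

context
  assumes mean_zero: "(\<integral>u. f u \<partial>past_law) = 0" and summable_dep: "summable (dependence q f)"
begin

text \<open>Telescoping from lag m to lag m + d leaves lagged martingale sums, controlled by the
  tail of the dependence series, and a remainder l \<open>\<rho> (m + d)\<close>. For fixed l the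
  remainder vanishes as d grows, because the mean is 0 and the remote past is forgotten.\<close>

lemma Lpnorm_CE_sum:
  "Lpnorm M q (\<lambda>x. \<Sum>n<l. CE (s + int n - int m) (Y f (s + int n)) x)
     \<le> (moment_const q * real l) powr (1 / min 2 q) * (\<Sum>j. dependence q f (j + m))"
  (is "?L \<le> ?A * _")
proof -
  let ?k = "\<lambda>n. s + int n"
  define \<rho> where "\<rho> m = Lpnorm past_law q (\<lambda>u. lagged_cond_exp m f u - 0)" for m
  have PL: "in_Lp M q (\<lambda>x. \<Sum>n<l. Proj (?k n - int j) (Y f (?k n)) x)" for j
    using q_ge_1 by (intro in_Lp_sum proj_in_Lp in_Lp_Y' f) auto
  have RL: "in_Lp M q (\<lambda>x. CE k (Y f (?k n)) x)" for n k
    using q_ge_1 by (intro CE_in_Lp in_Lp_Y' f) auto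
  have sd: "summable (\<lambda>j. dependence q f (j + m))" using summable_dep by (subst summable_iff_shift)
  have *: "?L \<le> ?A * (\<Sum>j. dependence q f (j + m)) + real l * \<rho> (m + d)" for d
  proof -
    have "(\<lambda>x. \<Sum>n<l. CE (?k n - int m) (Y f (?k n)) x)
      = (\<lambda>x. (\<Sum>j<d. \<Sum>n<l. Proj (?k n - int (m + j)) (Y f (?k n)) x) + (\<Sum>n<l. CE (?k n - int (m + d)) (Y f (?k n)) x))"
      unfolding CE_telescope[of "?k n" m _ _ d for n] sum.distrib by (subst sum.swap) simp
    then have "?L = Lpnorm M q (\<lambda>x. (\<Sum>j<d. \<Sum>n<l. Proj (?k n - int (m + j)) (Y f (?k n)) x) + (\<Sum>n<l. CE (?k n - int (m + d)) (Y f (?k n)) x))"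
      by simp
    also have "\<dots> \<le> Lpnorm M q (\<lambda>x. \<Sum>j<d. \<Sum>n<l. Proj (?k n - int (m + j)) (Y f (?k n)) x)
        + Lpnorm M q (\<lambda>x. \<Sum>n<l. CE (?k n - int (m + d)) (Y f (?k n)) x)"
      using q_ge_1 by (intro Lpnorm_triangle in_Lp_sum[OF PL] in_Lp_sum[OF RL]) auto
    also have "Lpnorm M q (\<lambda>x. \<Sum>j<d. \<Sum>n<l. Proj (?k n - int (m + j)) (Y f (?k n)) x)
        \<le> (\<Sum>j<d. Lpnorm M q (\<lambda>x. \<Sum>n<l. Proj (?k n - int (m + j)) (Y f (?k n)) x))"
      using q_ge_1 by (intro Lpnorm_sum PL) auto
    also have "\<dots> \<le> (\<Sum>j<d. ?A * dependence q f (m + j))"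
      unfolding dependence_def by (intro sum_mono Lpnorm_proj_sum f q)
    also have "\<dots> = ?A * (\<Sum>j<d. dependence q f (j + m))" by (simp add: sum_distrib_left add.commute)
    also have "\<dots> \<le> ?A * (\<Sum>j. dependence q f (j + m))"
      by (intro mult_left_mono sum_le_suminf sd) auto
    also have "Lpnorm M q (\<lambda>x. \<Sum>n<l. CE (?k n - int (m + d)) (Y f (?k n)) x)
        \<le> (\<Sum>n<l. Lpnorm M q (\<lambda>x. CE (?k n - int (m + d)) (Y f (?k n)) x))"
      using q_ge_1 by (intro Lpnorm_sum RL) auto
    also have "\<dots> = (\<Sum>n<l. \<rho> (m + d))"
      unfolding \<rho>_def using Lpnorm_CE_lagged[OF f q_ge_1, of _ "m + d" 0] by simp
    finally show ?thesis by simp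
  qed
  have "\<rho> \<longlonglongrightarrow> 0"
    using past_forgetting_Lp[OF f q_ge_1] unfolding past_forgetting_def mean_zero \<rho>_def .
  then have "(\<lambda>d. \<rho> (m + d)) \<longlonglongrightarrow> 0" using LIMSEQ_ignore_initial_segment[of \<rho> 0 m] by (simp add: add.commute)
  then have "(\<lambda>d. ?A * (\<Sum>j. dependence q f (j + m)) + real l * \<rho> (m + d)) \<longlonglongrightarrow> ?A * (\<Sum>j. dependence q f (j + m)) + real l * 0"
    by (intro tendsto_intros)
  then show ?thesis using * by (intro LIMSEQ_le_const[of _ "?A * (\<Sum>j. dependence q f (j + m))"]) auto
qed

lemma Lpnorm_Y_sum:
  "Lpnorm M q (\<lambda>x. \<Sum>n<l. Y f (s + int n) x)
     \<le> (moment_const q * real l) powr (1 / min 2 q) * (\<Sum>j. dependence q f j)"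
proof -
  have "Lpnorm M q (\<lambda>x. \<Sum>n<l. Y f (s + int n) x) = Lpnorm M q (\<lambda>x. \<Sum>n<l. CE (s + int n - int 0) (Y f (s + int n)) x)"
  proof (rule Lpnorm_cong_AE)
    show "AE x in M. (\<Sum>n<l. Y f (s + int n) x) = (\<Sum>n<l. CE (s + int n - int 0) (Y f (s + int n)) x)"
      using CE_sum_Y[OF f q_ge_1, of l s] by eventually_elim simp
    show "(\<lambda>x. \<Sum>n<l. Y f (s + int n) x) \<in> borel_measurable M"
      by (intro borel_measurable_sum Y_measurable in_Lp_past_law_measurable[OF f])
  qed auto
  then show ?thesis using Lpnorm_CE_sum[where m = 0] by simp
qed

lemma mart_diff_Lpnorm_total: "Lpnorm M q (mart_diff m f k) \<le> (\<Sum>j. dependence q f j)"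
  using mart_diff_Lpnorm[of m k] sum_le_suminf[OF summable_dep, of "{..<m}"] by auto

lemma Lpnorm_mart_diff_sum_total:
  "Lpnorm M q (\<lambda>x. \<Sum>n<l. mart_diff m f (s + int n) x)
     \<le> (moment_const q * real l) powr (1 / min 2 q) * (\<Sum>j. dependence q f j)"
proof -
  have "(\<Sum>j<m. dependence q f j) \<le> (\<Sum>j. dependence q f j)"
    by (intro sum_le_suminf summable_dep) auto
  then show ?thesis
    by (intro order_trans[OF Lpnorm_mart_diff_sum] mult_left_mono) auto
qed

lemma Lpnorm_mart_approx:
  "Lpnorm M q (\<lambda>x. (\<Sum>n<l. Y f (s + int n) x) - (\<Sum>n<l. mart_diff m f (s + int n) x))
     \<le> (moment_const q * real l) powr (1 / min 2 q) * (\<Sum>j. dependence q f (j + m))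
       + (\<Sum>j<m. 2 * real j * dependence q f j)"
proof -
  let ?k = "\<lambda>n. s + int n"
  \<comment> \<open>This indexing puts both sums into one family: the lag j innovation of X_(s+n) is
    \<open>b j n\<close>, and the lag j part of the martingale difference at s + n is
    \<open>b j (j + n)\<close>. For each j the two windows differ by a shift, so only 2 j boundary
    terms survive.\<close>
  define b where "b j i = Proj (s - int j + int i) (Y f (s + int i))" for j i
  have bL: "in_Lp M q (b j i)" for j i
    unfolding b_def using q_ge_1 by (intro proj_in_Lp in_Lp_Y' f) auto
  have bn: "Lpnorm M q (b j i) = dependence q f j" for j i
    using proj_Lpnorm_stationary[OF f q_ge_1, of "s - int j + int i" j]
    by (simp add: b_def dependence_def algebra_simps)
  define E where "E x = (\<Sum>j<m. ((\<Sum>i<j. b j i x) - (\<Sum>i<j. b j (l + i) x)))" for x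
  define R where "R x = (\<Sum>n<l. CE (?k n - int m) (Y f (?k n)) x)" for x
  have eL: "in_Lp M q (\<lambda>x. (\<Sum>i<j. b j i x) - (\<Sum>i<j. b j (l + i) x))" for j
    using q_ge_1 by (intro in_Lp_diff in_Lp_sum bL) auto
  have EL: "in_Lp M q E" unfolding E_def using q_ge_1 by (intro in_Lp_sum eL) auto
  have RL: "in_Lp M q R" unfolding R_def using q_ge_1 by (intro in_Lp_sum CE_in_Lp in_Lp_Y' f) auto
  have "AE x in M. (\<Sum>n<l. Y f (?k n) x) - (\<Sum>n<l. mart_diff m f (?k n) x) = R x + E x"
    using CE_sum_Y[OF f q_ge_1, of l s]
  proof eventually_elim
    fix x assume x: "\<forall>n<l. CE (?k n) (Y f (?k n)) x = Y f (?k n) x"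
    have "(\<Sum>n<l. Y f (?k n) x) = (\<Sum>n<l. (\<Sum>j<m. b j n x) + CE (?k n - int m) (Y f (?k n)) x)"
      using x CE_telescope[of "?k n" 0 "Y f (?k n)" x m for n]
      by (intro sum.cong) (auto simp: b_def algebra_simps)
    also have "\<dots> = (\<Sum>j<m. \<Sum>n<l. b j n x) + R x"
      unfolding sum.distrib R_def by (subst sum.swap) simp
    finally have 1: "(\<Sum>n<l. Y f (?k n) x) = (\<Sum>j<m. \<Sum>n<l. b j n x) + R x" .
    have "(\<Sum>n<l. mart_diff m f (?k n) x) = (\<Sum>n<l. \<Sum>j<m. b j (j + n) x)"
      unfolding mart_diff_def b_def by (intro sum.cong refl) (simp add: algebra_simps)
    also have "\<dots> = (\<Sum>j<m. \<Sum>n<l. b j (j + n) x)" by (rule sum.swap)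
    finally have 2: "(\<Sum>n<l. mart_diff m f (?k n) x) = (\<Sum>j<m. \<Sum>n<l. b j (j + n) x)" .
    have w: "(\<Sum>n<l. b j n x) - (\<Sum>n<l. b j (j + n) x) = (\<Sum>i<j. b j i x) - (\<Sum>i<j. b j (l + i) x)" for j
      by (rule sum_shift_window)
    have "E x = (\<Sum>j<m. \<Sum>n<l. b j n x) - (\<Sum>j<m. \<Sum>n<l. b j (j + n) x)"
      unfolding E_def w[symmetric] by (rule sum_subtractf)
    then show "(\<Sum>n<l. Y f (?k n) x) - (\<Sum>n<l. mart_diff m f (?k n) x) = R x + E x"
      unfolding 1 2 by simp
  qed
  moreover have "(\<lambda>x. (\<Sum>n<l. Y f (?k n) x) - (\<Sum>n<l. mart_diff m f (?k n) x)) \<in> borel_measurable M"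
    using in_Lp_measurable[OF mart_diff_in_Lp]
    by (intro borel_measurable_diff borel_measurable_sum Y_measurable in_Lp_past_law_measurable[OF f])
  ultimately have "Lpnorm M q (\<lambda>x. (\<Sum>n<l. Y f (?k n) x) - (\<Sum>n<l. mart_diff m f (?k n) x)) = Lpnorm M q (\<lambda>x. R x + E x)"
    using RL EL by (intro Lpnorm_cong_AE) auto
  also have "\<dots> \<le> Lpnorm M q R + Lpnorm M q E"
    by (intro Lpnorm_triangle RL EL q_ge_1)
  also have "Lpnorm M q R \<le> (moment_const q * real l) powr (1 / min 2 q) * (\<Sum>j. dependence q f (j + m))"
    unfolding R_def by (rule Lpnorm_CE_sum)
  also have "Lpnorm M q E \<le> (\<Sum>j<m. Lpnorm M q (\<lambda>x. (\<Sum>i<j. b j i x) - (\<Sum>i<j. b j (l + i) x)))"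
    unfolding E_def by (intro Lpnorm_sum eL q_ge_1)
  also have "\<dots> \<le> (\<Sum>j<m. 2 * real j * dependence q f j)"
  proof (rule sum_mono)
    fix j
    have "Lpnorm M q (\<lambda>x. (\<Sum>i<j. b j i x) - (\<Sum>i<j. b j (l + i) x))
      \<le> Lpnorm M q (\<lambda>x. \<Sum>i<j. b j i x) + Lpnorm M q (\<lambda>x. \<Sum>i<j. b j (l + i) x)"
      using q_ge_1 by (intro Lpnorm_triangle_diff in_Lp_sum bL) auto
    also have "\<dots> \<le> (\<Sum>i<j. Lpnorm M q (b j i)) + (\<Sum>i<j. Lpnorm M q (b j (l + i)))"
      by (intro add_mono Lpnorm_sum bL q_ge_1)
    finally show "Lpnorm M q (\<lambda>x. (\<Sum>i<j. b j i x) - (\<Sum>i<j. b j (l + i) x)) \<le> 2 * real j * dependence q f j"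
      by (simp add: bn)
  qed
  finally show ?thesis by simp
qed

end

end

end

section \<open>Block sums\<close>

lemma sum_int_interval:
  fixes G :: "int \<Rightarrow> 'c::comm_monoid_add"
  shows "(\<Sum>i\<in>{t..<t + int l}. G i) = (\<Sum>n<l. G (t + int n))"
proof (rule sum.reindex_bij_witness[where i = "\<lambda>n. t + int n" and j = "\<lambda>i. nat (i - t)"])
qed auto

lemma sum_int_interval': "(\<Sum>i\<in>{t..t + int l}. G i) = (\<Sum>n<Suc l. G (t + int n))"
  for G :: "int \<Rightarrow> 'c::comm_monoid_add"
proof -
  have "{t..t + int l} = {t..<t + int (Suc l)}" by auto
  then show ?thesis by (simp only: sum_int_interval)
qed

locale block_partition =
  fixes a :: "nat \<Rightarrow> int"
  assumes a_1: "a 1 = 1" and a_less: "\<And>k. k \<ge> 1 \<Longrightarrow> a k < a (Suc k)"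
begin

text \<open>Blocks are numbered from \<open>0\<close>, so block \<open>k\<close> starts at \<open>a\<^sub>k\<^sub>+\<^sub>1\<close>.\<close>

abbreviation start :: "nat \<Rightarrow> int" where "start k \<equiv> a (Suc k)"

definition len :: "nat \<Rightarrow> nat" where "len k = nat (start (Suc k) - start k)"

lemma int_len: "int (len k) = start (Suc k) - start k"
  using a_less[of "Suc k"] by (simp add: len_def)

lemma len_pos: "len k > 0"
  using a_less[of "Suc k"] by (simp add: len_def)

lemma strict_mono_start: "strict_mono start"
  using a_less by (intro strict_mono_Suc_iff[THEN iffD2]) auto

lemma start_ge: "start k \<ge> int k + 1"
proof (induction k)
  case 0
  then show ?case using a_1 by simp
next
  case (Suc k)
  then show ?case using a_less[of "Suc k"] by simp
qed

lemma tpt_eq: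
  assumes "start k \<le> i" "i < start (Suc k)"
  shows "tpt a i = start k"
  unfolding tpt_def
proof (rule Max_eqI)
  have "{a k | k. k \<ge> 1 \<and> a k \<le> i} \<subseteq> {1..i}"
  proof clarify
    fix j :: nat assume j: "j \<ge> 1" "a j \<le> i"
    then obtain j' where "j = Suc j'" by (cases j) auto
    then show "a j \<in> {1..i}" using start_ge[of j'] j by simp
  qed
  then show "finite ({1} \<union> {a k | k. k \<ge> 1 \<and> a k \<le> i})" by (auto intro: finite_subset)
  show "start k \<in> {1} \<union> {a k | k. k \<ge> 1 \<and> a k \<le> i}" using assms by auto
  fix y assume "y \<in> {1} \<union> {a k | k. k \<ge> 1 \<and> a k \<le> i}"
  then show "y \<le> start k"
  proof
    assume "y \<in> {1}"
    then show ?thesis using start_ge[of k] by simp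
  next
    assume "y \<in> {a k | k. k \<ge> 1 \<and> a k \<le> i}"
    then obtain j where j: "j \<ge> 1" "a j \<le> i" "y = a j" by auto
    then obtain j' where j': "j = Suc j'" by (cases j) auto
    have "start j' < start (Suc k)" using j j' assms by simp
    then have "j' < Suc k" using strict_mono_less[OF strict_mono_start] by blast
    then have "start j' \<le> start k" using strict_mono_less_eq[OF strict_mono_start, of j' k] by simp
    then show ?thesis using j j' by simp
  qed
qed

lemma block_sum_full:
  fixes H :: "int \<Rightarrow> int \<Rightarrow> 'c::comm_monoid_add"
  shows "(\<Sum>i\<in>{1..<start \<kappa>}. H (tpt a i) i) = (\<Sum>k<\<kappa>. \<Sum>i<len k. H (start k) (start k + int i))"
proof (induction \<kappa>)
  case 0
  then show ?case using a_1 by simp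
next
  case (Suc \<kappa>)
  have "{1..<start (Suc \<kappa>)} = {1..<start \<kappa>} \<union> {start \<kappa>..<start (Suc \<kappa>)}"
    using start_ge[of \<kappa>] a_less[of "Suc \<kappa>"] by auto
  then have "(\<Sum>i\<in>{1..<start (Suc \<kappa>)}. H (tpt a i) i)
     = (\<Sum>i\<in>{1..<start \<kappa>}. H (tpt a i) i) + (\<Sum>i\<in>{start \<kappa>..<start (Suc \<kappa>)}. H (tpt a i) i)"
    by (simp add: sum.union_disjoint ivl_disj_int)
  also have "(\<Sum>i\<in>{start \<kappa>..<start (Suc \<kappa>)}. H (tpt a i) i) = (\<Sum>i\<in>{start \<kappa>..<start \<kappa> + int (len \<kappa>)}. H (start \<kappa>) i)"
    by (intro sum.cong) (auto simp: int_len tpt_eq)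
  also have "\<dots> = (\<Sum>i<len \<kappa>. H (start \<kappa>) (start \<kappa> + int i))" by (rule sum_int_interval)
  finally show ?case using Suc by simp
qed

section \<open>Blocks cut off at time n and the growth of v_n\<close>

definition block_index :: "nat \<Rightarrow> nat" where
  "block_index n = (SOME k. start k \<le> int n \<and> int n < start (Suc k))"

text \<open>The last block is cut off at \<open>n\<close>; later ones are empty, so that martingale bounds for
  infinite sequences of blocks apply.\<close>

definition block_len :: "nat \<Rightarrow> nat \<Rightarrow> nat" where
  "block_len n k = (if k < block_index n then len k else if k = block_index n then nat (int n - start k + 1) else 0)"

lemma block_index:
  assumes "n \<ge> 1"
  shows "start (block_index n) \<le> int n" "int n < start (Suc (block_index n))"
proof -
  define k where "k = (LEAST k. int n < start (Suc k))"
  have ex: "int n < start (Suc n)" using start_ge[of "Suc n"] by simp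
  have 1: "int n < start (Suc k)" unfolding k_def by (rule LeastI[where P = "\<lambda>k. int n < start (Suc k)", OF ex])
  have "start k \<le> int n"
  proof (cases k)
    case 0
    then show ?thesis using a_1 assms by simp
  next
    case (Suc k')
    then have "\<not> int n < start (Suc k')" using not_less_Least[of k' "\<lambda>k. int n < start (Suc k)"] by (simp add: k_def)
    then show ?thesis using Suc by simp
  qed
  with 1 have "\<exists>k. start k \<le> int n \<and> int n < start (Suc k)" by blast
  then have "start (block_index n) \<le> int n \<and> int n < start (Suc (block_index n))"
    unfolding block_index_def by (rule someI_ex)
  then show "start (block_index n) \<le> int n" "int n < start (Suc (block_index n))" by auto
qed

lemma block_len_le: "n \<ge> 1 \<Longrightarrow> block_len n k \<le> len k"
  using block_index[of n] by (auto simp: block_len_def len_def)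

lemma start_block_len: "n \<ge> 1 \<Longrightarrow> start k + int (block_len n k) \<le> start (Suc k)"
  using block_len_le[of n k] int_len[of k] by simp

text \<open>With H an arbitrary function of block start and position, the same rearrangement serves
  V_n, v_n and n.\<close>

lemma block_sum:
  fixes H :: "int \<Rightarrow> int \<Rightarrow> 'c::comm_monoid_add"
  assumes n: "n \<ge> 1"
  shows "(\<Sum>i\<in>{1..int n}. H (tpt a i) i)
    = (\<Sum>k<Suc (block_index n). \<Sum>i<block_len n k. H (start k) (start k + int i))"
proof -
  let ?\<kappa> = "block_index n"
  note \<kappa> = block_index[OF n]
  have "{1..int n} = {1..<start ?\<kappa>} \<union> {start ?\<kappa>..<start ?\<kappa> + int (block_len n ?\<kappa>)}"
    using \<kappa> start_ge[of ?\<kappa>] by (auto simp: block_len_def)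
  then have "(\<Sum>i\<in>{1..int n}. H (tpt a i) i)
     = (\<Sum>i\<in>{1..<start ?\<kappa>}. H (tpt a i) i) + (\<Sum>i\<in>{start ?\<kappa>..<start ?\<kappa> + int (block_len n ?\<kappa>)}. H (tpt a i) i)"
    by (simp add: sum.union_disjoint ivl_disj_int)
  also have "(\<Sum>i\<in>{1..<start ?\<kappa>}. H (tpt a i) i) = (\<Sum>k<?\<kappa>. \<Sum>i<block_len n k. H (start k) (start k + int i))"
    unfolding block_sum_full by (intro sum.cong) (auto simp: block_len_def)
  also have "(\<Sum>i\<in>{start ?\<kappa>..<start ?\<kappa> + int (block_len n ?\<kappa>)}. H (tpt a i) i)
     = (\<Sum>i\<in>{start ?\<kappa>..<start ?\<kappa> + int (block_len n ?\<kappa>)}. H (start ?\<kappa>) i)"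
    using \<kappa> by (intro sum.cong) (auto simp: block_len_def tpt_eq)
  also have "\<dots> = (\<Sum>i<block_len n ?\<kappa>. H (start ?\<kappa>) (start ?\<kappa> + int i))" by (rule sum_int_interval)
  finally show ?thesis by simp
qed

lemma n_eq: "n \<ge> 1 \<Longrightarrow> real n = (\<Sum>k<Suc (block_index n). real (block_len n k))"
  using block_sum[of n "\<lambda>_ _. 1 :: real"] by simp

lemma vn_eq: "n \<ge> 1 \<Longrightarrow> real_of_int (vn a n) = (\<Sum>k<Suc (block_index n). \<Sum>i<block_len n k. real (Suc i))"
  using block_sum[of n "\<lambda>t i. real_of_int (i - t + 1)"] by (simp add: vn_def lblk_def add.commute)

lemma sum_Suc_real: "(\<Sum>i<l. real (Suc i)) = real l * (real l + 1) / 2"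
  by (induction l) (auto simp: field_simps)

lemma vn_ge: "n \<ge> 1 \<Longrightarrow> real n \<le> real_of_int (vn a n)"
proof -
  assume n: "n \<ge> 1"
  have "real (block_len n k) \<le> (\<Sum>i<block_len n k. real (Suc i))" for k
    using sum_mono[of "{..<block_len n k}" "\<lambda>_. 1" "\<lambda>i. real (Suc i)"] by simp
  then show ?thesis unfolding vn_eq[OF n] n_eq[OF n] by (intro sum_mono)
qed

text \<open>A block of length l adds l to n but l (l + 1)/2 to v_n, so a block with l \<ge> 2 H pays
  for itself. The exceptions are the first K blocks and the cut-off last one; each is charged H^2,
  by 2 H l \<le> l^2 + H^2.\<close>

lemma n_little_o_vn:
  assumes len: "filterlim (\<lambda>k. real (len k)) at_top sequentially" and H: "H \<ge> 0"
  shows "\<exists>C\<ge>0. \<forall>n\<ge>1. H * real n \<le> real_of_int (vn a n) + C"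
proof -
  obtain K where K: "\<And>k. k \<ge> K \<Longrightarrow> real (len k) \<ge> 2 * H"
    using len by (auto simp: filterlim_at_top eventually_sequentially)
  have g1: "H * real l \<le> (\<Sum>i<l. real (Suc i)) + H\<^sup>2" for l
  proof -
    have "0 \<le> (real l - H)\<^sup>2" by simp
    also have "\<dots> = real l * real l - 2 * (H * real l) + H\<^sup>2"
      by (simp add: power2_eq_square algebra_simps)
    finally have "2 * (H * real l) \<le> real l * real l + H\<^sup>2" by simp
    moreover have "real l * (real l + 1) = real l * real l + real l" by (simp add: algebra_simps)
    moreover have "0 \<le> H\<^sup>2" "0 \<le> real l" by simp_all
    ultimately show ?thesis unfolding sum_Suc_real by linarith
  qed
  have g2: "H * real l \<le> (\<Sum>i<l. real (Suc i))" if "real l \<ge> 2 * H" for l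
  proof -
    have "(2 * H) * real l \<le> (real l + 1) * real l" using that by (intro mult_right_mono) auto
    then show ?thesis unfolding sum_Suc_real by (simp add: algebra_simps)
  qed
  show ?thesis
  proof (intro exI[of _ "(real K + 1) * H\<^sup>2"] conjI allI impI)
    fix n :: nat assume n: "n \<ge> 1"
    let ?\<kappa> = "block_index n"
    have "H * real n = (\<Sum>k<Suc ?\<kappa>. H * real (block_len n k))"
      unfolding n_eq[OF n] sum_distrib_left ..
    also have "\<dots> \<le> (\<Sum>k<Suc ?\<kappa>. (\<Sum>i<block_len n k. real (Suc i)) + (if k < K \<or> k = ?\<kappa> then H\<^sup>2 else 0))"
    proof (intro sum_mono)
      fix k assume k: "k \<in> {..<Suc ?\<kappa>}"
      show "H * real (block_len n k) \<le> (\<Sum>i<block_len n k. real (Suc i)) + (if k < K \<or> k = ?\<kappa> then H\<^sup>2 else 0)"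
      proof (cases "k < K \<or> k = ?\<kappa>")
        case False
        then have "real (block_len n k) \<ge> 2 * H" using k K[of k] by (auto simp: block_len_def)
        then show ?thesis using g2 False by simp
      qed (use g1 in simp)
    qed
    also have "\<dots> = real_of_int (vn a n) + (\<Sum>k<Suc ?\<kappa>. if k < K \<or> k = ?\<kappa> then H\<^sup>2 else 0)"
      unfolding vn_eq[OF n] sum.distrib ..
    also have "(\<Sum>k<Suc ?\<kappa>. if k < K \<or> k = ?\<kappa> then H\<^sup>2 else 0) = (\<Sum>k\<in>{k\<in>{..<Suc ?\<kappa>}. k < K \<or> k = ?\<kappa>}. H\<^sup>2)"
      by (rule sum.inter_filter[symmetric]) simp
    also have "\<dots> \<le> (\<Sum>k\<in>{..<K} \<union> {?\<kappa>}. H\<^sup>2)" by (intro sum_mono2) auto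
    also have "\<dots> = real (card ({..<K} \<union> {?\<kappa>})) * H\<^sup>2" by simp
    also have "\<dots> \<le> (real K + 1) * H\<^sup>2"
    proof (intro mult_right_mono)
      have "card ({..<K} \<union> {?\<kappa>}) \<le> K + 1" using card_Un_le[of "{..<K}" "{?\<kappa>}"] by simp
      then show "real (card ({..<K} \<union> {?\<kappa>})) \<le> real K + 1" by linarith
    qed simp
    finally show "H * real n \<le> real_of_int (vn a n) + (real K + 1) * H\<^sup>2" by simp
  qed simp
qed

text \<open>Write (L^2)^r = L^2 (L^2)^(r-1) and bound the second factor through L^2 \<le> \<epsilon>
  s, where s is the sum of squared lengths of the complete blocks. The remaining factors sum to at
  most 2 s, and s \<le> 2 v_n. Early blocks, where the ratio is not yet small, go into C.\<close>

lemma block_len_powr_sum: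
  assumes ratio: "(\<lambda>k. (real (len k))\<^sup>2 / (\<Sum>j<k. (real (len j))\<^sup>2)) \<longlonglongrightarrow> 0"
    and r: "r > 1" and e: "e > 0"
  shows "\<exists>C\<ge>0. \<forall>n\<ge>1. (\<Sum>k<Suc (block_index n). ((real (block_len n k))\<^sup>2) powr r) \<le> e * real_of_int (vn a n) powr r + C"
proof -
  define s where "s k = (\<Sum>j<k. (real (len j))\<^sup>2)" for k
  have s0: "s k \<ge> 0" for k unfolding s_def by (intro sum_nonneg) auto
  have s_mono: "s j \<le> s k" if "j \<le> k" for j k
    unfolding s_def using that by (intro sum_mono2) auto
  have s_pos: "s k > 0" if "k \<ge> 1" for k
  proof -
    have "s k \<ge> s 1" using that by (rule s_mono)
    also have "s 1 = (real (len 0))\<^sup>2" by (simp add: s_def)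
    finally show ?thesis using len_pos[of 0] by (smt (verit) of_nat_0_less_iff zero_less_power2)
  qed
  \<comment> \<open>The solution of 2 \<delta>^(r-1) 2^r = e: the factor 2 accounts for the last
    block, 2^r for s \<le> 2 v_n.\<close>
  define \<delta> where "\<delta> = (e / (2 * 2 powr r)) powr (1 / (r - 1))"
  have d: "\<delta> > 0" using e by (simp add: \<delta>_def)
  have dr: "\<delta> powr (r - 1) = e / (2 * 2 powr r)" using r e by (simp add: \<delta>_def powr_powr)
  define \<epsilon> where "\<epsilon> = min 1 \<delta>"
  have eps: "\<epsilon> > 0" "\<epsilon> \<le> 1" "\<epsilon> \<le> \<delta>" using d by (auto simp: \<epsilon>_def)
  have er: "\<epsilon> powr (r - 1) \<le> e / (2 * 2 powr r)"
    using powr_mono2[of "r - 1" \<epsilon> \<delta>] eps r dr by simp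
  obtain K where K: "\<And>k. k \<ge> K \<Longrightarrow> (real (len k))\<^sup>2 / s k < \<epsilon>"
    using order_tendstoD(2)[OF ratio eps(1)] by (auto simp: eventually_sequentially s_def)
  have K': "(real (len k))\<^sup>2 \<le> \<epsilon> * s k" if "k \<ge> max K 1" for k
    using K[of k] s_pos[of k] that by (simp add: field_simps)
  define K1 where "K1 = max K 1"
  define C where "C = (\<Sum>k<K1. ((real (len k))\<^sup>2) powr r)"
  have C0: "C \<ge> 0" unfolding C_def by (intro sum_nonneg) auto
  show ?thesis
  proof (intro exI[of _ C] conjI allI impI C0)
    fix n :: nat assume n: "n \<ge> 1"
    let ?\<kappa> = "block_index n"
    define \<kappa> where "\<kappa> = ?\<kappa>"
    have sv: "s \<kappa> \<le> 2 * real_of_int (vn a n)"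
    proof -
      have "s \<kappa> = (\<Sum>k<\<kappa>. (real (block_len n k))\<^sup>2)"
        unfolding s_def \<kappa>_def by (intro sum.cong) (auto simp: block_len_def)
      also have "\<dots> \<le> (\<Sum>k<Suc \<kappa>. (real (block_len n k))\<^sup>2)" by simp
      also have "\<dots> \<le> (\<Sum>k<Suc \<kappa>. 2 * (\<Sum>i<block_len n k. real (Suc i)))"
        unfolding sum_Suc_real by (intro sum_mono) (simp add: power2_eq_square algebra_simps)
      also have "\<dots> = 2 * real_of_int (vn a n)" unfolding vn_eq[OF n] sum_distrib_left \<kappa>_def ..
      finally show ?thesis .
    qed
    have block_term: "((real (len k))\<^sup>2) powr r \<le> (real (len k))\<^sup>2 * (\<epsilon> * s \<kappa>) powr (r - 1)" if "k \<ge> K1" "k \<le> \<kappa>" for k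
    proof -
      have "(real (len k))\<^sup>2 \<le> \<epsilon> * s k" using that K'[of k] by (simp add: K1_def)
      also have "\<dots> \<le> \<epsilon> * s \<kappa>" using that eps s_mono by (intro mult_left_mono) auto
      finally have le: "(real (len k))\<^sup>2 \<le> \<epsilon> * s \<kappa>" .
      have "((real (len k))\<^sup>2) powr r = (real (len k))\<^sup>2 * ((real (len k))\<^sup>2) powr (r - 1)"
        using len_pos[of k] by (simp add: powr_diff)
      also have "\<dots> \<le> (real (len k))\<^sup>2 * (\<epsilon> * s \<kappa>) powr (r - 1)"
        using le r by (intro mult_left_mono powr_mono2) auto
      finally show ?thesis .
    qed
    \<comment> \<open>The last block enters with its full length, although v_n counts only the part
      up to n. The ratio condition compares it with the complete blocks instead; the cap \<epsilon>
      \<le> 1 serves this step.\<close>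
    have last: "(real (len \<kappa>))\<^sup>2 \<le> s \<kappa>" if "\<kappa> \<ge> K1"
    proof -
      have "(real (len \<kappa>))\<^sup>2 \<le> \<epsilon> * s \<kappa>" using that K'[of \<kappa>] by (simp add: K1_def)
      also have "\<dots> \<le> 1 * s \<kappa>" using eps s0 by (intro mult_right_mono) auto
      finally show ?thesis by simp
    qed
    have "(\<Sum>k<Suc \<kappa>. ((real (block_len n k))\<^sup>2) powr r) \<le> (\<Sum>k<Suc \<kappa>. ((real (len k))\<^sup>2) powr r)"
      using r block_len_le[OF n] by (intro sum_mono powr_mono2) auto
    also have "\<dots> \<le> (\<Sum>k\<in>{..<K1} \<union> {K1..<Suc \<kappa>}. ((real (len k))\<^sup>2) powr r)"
      by (intro sum_mono2) auto
    also have "\<dots> = C + (\<Sum>k\<in>{K1..<Suc \<kappa>}. ((real (len k))\<^sup>2) powr r)"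
      unfolding C_def by (intro sum.union_disjoint) auto
    also have "(\<Sum>k\<in>{K1..<Suc \<kappa>}. ((real (len k))\<^sup>2) powr r) \<le> (\<Sum>k\<in>{K1..<Suc \<kappa>}. (real (len k))\<^sup>2 * (\<epsilon> * s \<kappa>) powr (r - 1))"
      by (intro sum_mono block_term) auto
    also have "\<dots> = (\<Sum>k\<in>{K1..<Suc \<kappa>}. (real (len k))\<^sup>2) * (\<epsilon> * s \<kappa>) powr (r - 1)"
      by (rule sum_distrib_right[symmetric])
    also have "\<dots> \<le> (2 * s \<kappa>) * (\<epsilon> * s \<kappa>) powr (r - 1)"
    proof (intro mult_right_mono)
      show "(\<Sum>k\<in>{K1..<Suc \<kappa>}. (real (len k))\<^sup>2) \<le> 2 * s \<kappa>"
      proof (cases "\<kappa> \<ge> K1")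
        case True
        have "(\<Sum>k\<in>{K1..<Suc \<kappa>}. (real (len k))\<^sup>2) \<le> (\<Sum>k<Suc \<kappa>. (real (len k))\<^sup>2)"
          by (intro sum_mono2) auto
        also have "\<dots> = s \<kappa> + (real (len \<kappa>))\<^sup>2" by (simp add: s_def)
        finally show ?thesis using last[OF True] by simp
      qed (use s0 in auto)
    qed auto
    also have "\<dots> = 2 * \<epsilon> powr (r - 1) * s \<kappa> powr r"
    proof -
      have "s \<kappa> powr r = s \<kappa> * s \<kappa> powr (r - 1)"
        using s0[of \<kappa>] by (cases "s \<kappa> = 0") (auto simp: powr_diff)
      then show ?thesis by (simp add: powr_mult)
    qed
    also have "\<dots> \<le> 2 * (e / (2 * 2 powr r)) * (2 * real_of_int (vn a n)) powr r"
      using er sv s0 r e by (intro mult_mono powr_mono2) auto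
    also have "\<dots> = e * real_of_int (vn a n) powr r" by (simp add: powr_mult)
    finally show "(\<Sum>k<Suc (block_index n). ((real (block_len n k))\<^sup>2) powr r) \<le> e * real_of_int (vn a n) powr r + C"
      by (simp add: \<kappa>_def)
  qed
qed

end

section \<open>Off-diagonal terms of the squared block sums\<close>

text \<open>In each product the newest factor \<open>d n\<close> stands apart from the earlier ones,
  which is the form that conditioning can annihilate.\<close>

lemma square_sum_minus_sum_squares:
  fixes d :: "nat \<Rightarrow> real"
  shows "(\<Sum>n<N. d n)\<^sup>2 - (\<Sum>n<N. (d n)\<^sup>2) = (\<Sum>n<N. 2 * ((\<Sum>j<n. d j) * d n))"
  by (induction N) (auto simp: power2_eq_square algebra_simps)

context iid_sequence begin

text \<open>Conditioning on the later \<open>F k\<close> first pulls R out and makes the factor D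
  vanish; the tower property carries the 0 back to \<open>F j\<close>.\<close>

lemma CE_mult_zero:
  assumes jk: "j \<le> k" and R: "R \<in> borel_measurable (F k)" and D: "D \<in> borel_measurable M"
    and i: "integrable M (\<lambda>x. R x * D x)" and z: "AE x in M. CE k D x = 0"
  shows "AE x in M. CE j (\<lambda>x. R x * D x) x = 0"
proof -
  interpret C: sigma_finite_subalgebra M "F k" by (rule sigma_finite_F)
  interpret C': sigma_finite_subalgebra M "F j" by (rule sigma_finite_F)
  have "AE x in M. CE k (\<lambda>x. R x * D x) x = R x * CE k D x"
    by (rule C.real_cond_exp_mult[OF R D i])
  with z have 0: "AE x in M. CE k (\<lambda>x. R x * D x) x = 0" by eventually_elim simp
  have "AE x in M. CE j (CE k (\<lambda>x. R x * D x)) x = CE j (\<lambda>x. R x * D x) x"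
    by (rule C'.real_cond_exp_nested_subalg[OF subalgebra_F subalgebra_F_mono[OF jk] i])
  moreover have "AE x in M. CE j (CE k (\<lambda>x. R x * D x)) x = CE j (\<lambda>x. 0) x"
    by (rule C'.real_cond_exp_cong[OF 0]) auto
  moreover have "AE x in M. CE j (\<lambda>x. 0) x = 0" by (rule C'.real_cond_exp_F_meas) auto
  ultimately show ?thesis by eventually_elim simp
qed

text \<open>There is one term per position i, since V_n squares the sum from the block start up to
  every position. The bound available for its norm is of order l^2, like the contribution of the
  block to v_n, so cancellation between blocks is what makes the total negligible.\<close>

definition off_diag :: "nat \<Rightarrow> ((nat \<Rightarrow> 'b) \<Rightarrow> real) \<Rightarrow> int \<Rightarrow> nat \<Rightarrow> 'a \<Rightarrow> real" where
  "off_diag m f t l x = (\<Sum>i<l. (\<Sum>n<Suc i. mart_diff m f (t + int n) x)\<^sup>2 - (\<Sum>n<Suc i. (mart_diff m f (t + int n) x)\<^sup>2))"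

lemma off_diag_measurable_F:
  assumes "1 < q" "in_Lp past_law q f" "t + int l \<le> k + 1"
  shows "off_diag m f t l \<in> borel_measurable (F k)"
proof -
  have "mart_diff m f (t + int n) \<in> borel_measurable (F k)" if "i < l" "n < Suc i" for i n
    using assms that by (intro mart_diff_measurable_F[of q]) auto
  then show ?thesis unfolding off_diag_def[abs_def]
    by (intro borel_measurable_sum borel_measurable_diff borel_measurable_power) auto
qed

context
  fixes p :: real and f :: "(nat \<Rightarrow> 'b) \<Rightarrow> real"
  assumes f: "in_Lp past_law (2 * p) f" and p: "1 < p"
    and mean_zero: "(\<integral>u. f u \<partial>past_law) = 0" and summable_dep: "summable (dependence (2 * p) f)"
begin

abbreviation (input) "\<tau> \<equiv> (\<Sum>j. dependence (2 * p) f j)"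

lemma p2: "1 < 2 * p" and p_pos: "0 < p" and p_ge_1: "1 \<le> p" using p by auto

lemma tau_nonneg: "0 \<le> \<tau>"
  by (intro suminf_nonneg summable_dep) auto

lemma mart_sum_in_Lp: "in_Lp M (2 * p) (\<lambda>x. \<Sum>n<l. mart_diff m f (t + int n) x)"
  using p by (intro in_Lp_sum mart_diff_in_Lp[OF f p2]) auto

lemma Y_sum_in_Lp: "in_Lp M (2 * p) (\<lambda>x. \<Sum>n<l. Y f (t + int n) x)"
  using p by (intro in_Lp_sum in_Lp_Y'[OF f]) auto

lemma in_Lp_square:
  assumes "in_Lp M (2 * p) g"
  shows "in_Lp M p (\<lambda>x. (g x)\<^sup>2)" "Lpnorm M p (\<lambda>x. (g x)\<^sup>2) \<le> (Lpnorm M (2 * p) g)\<^sup>2"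
  using in_Lp_mult[OF assms assms p_pos] by (auto simp: power2_eq_square)

lemma mart_sum_sqrt_bound:
  "Lpnorm M (2 * p) (\<lambda>x. \<Sum>n<l. mart_diff m f (s + int n) x) \<le> (moment_const (2 * p) * real l) powr (1/2) * \<tau>"
  "Lpnorm M (2 * p) (\<lambda>x. \<Sum>n<l. Y f (s + int n) x) \<le> (moment_const (2 * p) * real l) powr (1/2) * \<tau>"
  using Lpnorm_mart_diff_sum_total[OF f p2 mean_zero summable_dep, where m = m and s = s and l = l]
    Lpnorm_Y_sum[OF f p2 mean_zero summable_dep, where s = s and l = l] p by (auto simp: min_def)

lemma off_diag_in_Lp: "in_Lp M p (off_diag m f t l)"
  unfolding off_diag_def[abs_def] using p_pos
  by (intro in_Lp_sum in_Lp_diff in_Lp_square mart_sum_in_Lp mart_diff_in_Lp[OF f p2]) auto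

text \<open>Each of the l positions costs at most order l: the partial sum has norm of order sqrt l,
  hence its square has norm of order l, and the diagonal has at most l terms of bounded
  norm.\<close>

lemma off_diag_Lpnorm:
  "Lpnorm M p (off_diag m f t l) \<le> (moment_const (2 * p) + 1) * \<tau>\<^sup>2 * (real l)\<^sup>2"
proof -
  let ?K = "moment_const (2 * p)"
  have K: "?K \<ge> 0" using moment_const_ge_1[of "2 * p"] by simp
  have "Lpnorm M p (off_diag m f t l)
     \<le> (\<Sum>i<l. Lpnorm M p (\<lambda>x. (\<Sum>n<Suc i. mart_diff m f (t + int n) x)\<^sup>2 - (\<Sum>n<Suc i. (mart_diff m f (t + int n) x)\<^sup>2)))"
    unfolding off_diag_def[abs_def] using p_pos p_ge_1
    by (intro Lpnorm_sum in_Lp_sum in_Lp_diff in_Lp_square mart_sum_in_Lp mart_diff_in_Lp[OF f p2]) auto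
  also have "\<dots> \<le> (\<Sum>i<l. (?K + 1) * \<tau>\<^sup>2 * real l)"
  proof (rule sum_mono)
    fix i assume i: "i \<in> {..<l}"
    have "Lpnorm M p (\<lambda>x. (\<Sum>n<Suc i. mart_diff m f (t + int n) x)\<^sup>2 - (\<Sum>n<Suc i. (mart_diff m f (t + int n) x)\<^sup>2))
      \<le> Lpnorm M p (\<lambda>x. (\<Sum>n<Suc i. mart_diff m f (t + int n) x)\<^sup>2) + Lpnorm M p (\<lambda>x. \<Sum>n<Suc i. (mart_diff m f (t + int n) x)\<^sup>2)"
      using p_pos p_ge_1 by (intro Lpnorm_triangle_diff in_Lp_sum in_Lp_square mart_sum_in_Lp mart_diff_in_Lp[OF f p2]) auto
    also have "Lpnorm M p (\<lambda>x. (\<Sum>n<Suc i. mart_diff m f (t + int n) x)\<^sup>2)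
        \<le> (Lpnorm M (2 * p) (\<lambda>x. \<Sum>n<Suc i. mart_diff m f (t + int n) x))\<^sup>2"
      by (intro in_Lp_square mart_sum_in_Lp)
    also have "\<dots> \<le> ((?K * real (Suc i)) powr (1/2) * \<tau>)\<^sup>2"
      by (intro power_mono mart_sum_sqrt_bound) auto
    also have "\<dots> = ?K * real (Suc i) * \<tau>\<^sup>2"
      using K by (simp add: powr_half_sqrt power_mult_distrib)
    also have "Lpnorm M p (\<lambda>x. \<Sum>n<Suc i. (mart_diff m f (t + int n) x)\<^sup>2)
        \<le> (\<Sum>n<Suc i. Lpnorm M p (\<lambda>x. (mart_diff m f (t + int n) x)\<^sup>2))"
      by (intro Lpnorm_sum in_Lp_square mart_diff_in_Lp[OF f p2] p_ge_1)
    also have "\<dots> \<le> (\<Sum>n<Suc i. \<tau>\<^sup>2)"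
      by (intro sum_mono order_trans[OF in_Lp_square(2)] power_mono mart_diff_in_Lp[OF f p2]
            mart_diff_Lpnorm_total[OF f p2 mean_zero summable_dep]) auto
    also have "?K * real (Suc i) * \<tau>\<^sup>2 + (\<Sum>n<Suc i. \<tau>\<^sup>2) = (?K + 1) * \<tau>\<^sup>2 * real (Suc i)"
      by (simp add: algebra_simps)
    also have "\<dots> \<le> (?K + 1) * \<tau>\<^sup>2 * real l"
      using i K by (intro mult_left_mono) auto
    finally show "Lpnorm M p (\<lambda>x. (\<Sum>n<Suc i. mart_diff m f (t + int n) x)\<^sup>2 - (\<Sum>n<Suc i. (mart_diff m f (t + int n) x)\<^sup>2))
      \<le> (?K + 1) * \<tau>\<^sup>2 * real l" by simp
  qed
  also have "\<dots> = (?K + 1) * \<tau>\<^sup>2 * (real l)\<^sup>2" by (simp add: power2_eq_square)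
  finally show ?thesis .
qed

text \<open>A product of the earlier differences with the one at t + n has mean 0 given time t + n -
  1, hence also given the earlier time t - 1. Whole blocks thus act as single martingale
  differences.\<close>

lemma CE_off_diag: "AE x in M. CE (t - 1) (off_diag m f t l) x = 0"
proof -
  interpret C: sigma_finite_subalgebra M "F (t - 1)" by (rule sigma_finite_F)
  define c where "c n x = (\<Sum>j<n. mart_diff m f (t + int j) x) * mart_diff m f (t + int n) x" for n x
  have ci: "integrable M (c n)" for n
    unfolding c_def by (rule in_Lp_integrable[OF in_Lp_mult(1)[OF mart_sum_in_Lp mart_diff_in_Lp[OF f p2] p_pos] p_ge_1])
  have cz: "AE x in M. CE (t - 1) (c n) x = 0" for n
    unfolding c_def
  proof (rule CE_mult_zero[where k = "t + int n - 1"])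
    show "(\<lambda>x. \<Sum>j<n. mart_diff m f (t + int j) x) \<in> borel_measurable (F (t + int n - 1))"
      by (intro borel_measurable_sum mart_diff_measurable_F[OF f p2]) auto
    show "integrable M (\<lambda>x. (\<Sum>j<n. mart_diff m f (t + int j) x) * mart_diff m f (t + int n) x)"
      using ci[of n] unfolding c_def .
    show "AE x in M. CE (t + int n - 1) (mart_diff m f (t + int n)) x = 0" by (rule CE_mart_diff[OF f p2])
  qed (use mart_diff_in_Lp[OF f p2] in auto)
  have e: "off_diag m f t l = (\<lambda>x. \<Sum>i<l. \<Sum>n<Suc i. 2 * c n x)"
    unfolding off_diag_def[abs_def] square_sum_minus_sum_squares c_def ..
  have i2: "integrable M (\<lambda>x. 2 * c n x)" for n using ci by simp
  have "AE x in M. \<forall>i. CE (t - 1) (\<lambda>x. \<Sum>n<Suc i. 2 * c n x) x = (\<Sum>n<Suc i. CE (t - 1) (\<lambda>x. 2 * c n x) x)"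
    unfolding AE_all_countable using C.real_cond_exp_sum[where f = "\<lambda>n x. 2 * c n x", OF i2] by blast
  moreover have "AE x in M. \<forall>n. CE (t - 1) (\<lambda>x. 2 * c n x) x = 2 * CE (t - 1) (c n) x"
    unfolding AE_all_countable using C.real_cond_exp_cmult[OF ci] by blast
  moreover have "AE x in M. \<forall>n. CE (t - 1) (c n) x = 0" unfolding AE_all_countable using cz by blast
  moreover have "AE x in M. CE (t - 1) (\<lambda>x. \<Sum>i<l. \<Sum>n<Suc i. 2 * c n x) x = (\<Sum>i<l. CE (t - 1) (\<lambda>x. \<Sum>n<Suc i. 2 * c n x) x)"
    by (rule C.real_cond_exp_sum[where f = "\<lambda>i x. \<Sum>n<Suc i. 2 * c n x"]) (intro Bochner_Integration.integrable_sum i2)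
  ultimately show ?thesis unfolding e by eventually_elim simp
qed

text \<open>Blocks do not overlap, so each is determined before the next one starts and the
  martingale bound applies with one step per block. The condition \<open>bl\<close> admits blocks
  that are cut short, such as the last one.\<close>

lemma off_diag_blocks_Lpnorm:
  fixes b :: "nat \<Rightarrow> int" and l :: "nat \<Rightarrow> nat"
  assumes bl: "\<And>k. b k + int (l k) \<le> b (Suc k)"
  shows "Lpnorm M p (\<lambda>x. \<Sum>k<\<kappa>. off_diag m f (b k) (l k) x) powr (min 2 p)
    \<le> moment_const p * ((moment_const (2 * p) + 1) * \<tau>\<^sup>2) powr (min 2 p) * (\<Sum>k<\<kappa>. ((real (l k))\<^sup>2) powr (min 2 p))"
proof -
  let ?r = "min 2 p" and ?B = "(moment_const (2 * p) + 1) * \<tau>\<^sup>2"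
  have bmono: "b j \<le> b k" if "j \<le> k" for j k
    using that
  proof (induction rule: dec_induct)
    case (step n)
    then show ?case using bl[of n] by linarith
  qed simp
  have "Lpnorm M p (\<lambda>x. \<Sum>k<\<kappa>. off_diag m f (b k) (l k) x) powr ?r
     \<le> moment_const p * (\<Sum>k<\<kappa>. Lpnorm M p (off_diag m f (b k) (l k)) powr ?r)"
  proof (rule Lpnorm_martingale_sum[where G = "\<lambda>k. F (b k - 1)"])
    fix i j :: nat assume "j < i"
    then have "b (Suc j) \<le> b i" by (intro bmono) auto
    then show "off_diag m f (b j) (l j) \<in> borel_measurable (F (b i - 1))"
      using bl[of j] by (intro off_diag_measurable_F[OF p2 f]) auto
  qed (use p in \<open>auto intro!: subalgebra_F off_diag_in_Lp CE_off_diag\<close>)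
  also have "\<dots> \<le> moment_const p * (\<Sum>k<\<kappa>. (?B * (real (l k))\<^sup>2) powr ?r)"
    using moment_const_ge_1[of p] p by (intro mult_left_mono sum_mono powr_mono2 off_diag_Lpnorm) auto
  also have "\<dots> = moment_const p * ?B powr ?r * (\<Sum>k<\<kappa>. ((real (l k))\<^sup>2) powr ?r)"
    by (simp only: powr_mult sum_distrib_left mult.assoc)
  finally show ?thesis .
qed

end

end

section \<open>Completeness\<close>

text \<open>Fatou's lemma for the functions |g N|^q.\<close>

lemma in_Lp_AE_limit:
  assumes g: "\<And>N. in_Lp M q (g N)" and h: "h \<in> borel_measurable M"
    and lim: "AE x in M. (\<lambda>N. g N x) \<longlonglongrightarrow> h x" and B: "\<And>N. Lpnorm M q (g N) \<le> B" and q: "0 < q"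
  shows "in_Lp M q h" "Lpnorm M q h \<le> B"
proof -
  note [measurable] = h
  have B0: "0 \<le> B" using B[of 0] Lpnorm_nonneg order_trans by blast
  have gm [measurable]: "g N \<in> borel_measurable M" for N using g[of N] by auto
  have "(\<integral>\<^sup>+x. ennreal (\<bar>h x\<bar> powr q) \<partial>M) = (\<integral>\<^sup>+x. liminf (\<lambda>N. ennreal (\<bar>g N x\<bar> powr q)) \<partial>M)"
  proof (rule nn_integral_cong_AE)
    show "AE x in M. ennreal (\<bar>h x\<bar> powr q) = liminf (\<lambda>N. ennreal (\<bar>g N x\<bar> powr q))"
      using lim
    proof eventually_elim
      fix x assume "(\<lambda>N. g N x) \<longlonglongrightarrow> h x"
      then have "(\<lambda>N. \<bar>g N x\<bar> powr q) \<longlonglongrightarrow> \<bar>h x\<bar> powr q"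
        using q by (intro tendsto_powr2 tendsto_rabs tendsto_const) auto
      then have "(\<lambda>N. ennreal (\<bar>g N x\<bar> powr q)) \<longlonglongrightarrow> ennreal (\<bar>h x\<bar> powr q)"
        by (rule tendsto_ennrealI)
      then show "ennreal (\<bar>h x\<bar> powr q) = liminf (\<lambda>N. ennreal (\<bar>g N x\<bar> powr q))"
        by (intro lim_imp_Liminf[symmetric]) auto
    qed
  qed
  also have "\<dots> \<le> liminf (\<lambda>N. \<integral>\<^sup>+x. ennreal (\<bar>g N x\<bar> powr q) \<partial>M)"
    by (rule nn_integral_liminf) simp
  also have "\<dots> \<le> limsup (\<lambda>N. \<integral>\<^sup>+x. ennreal (\<bar>g N x\<bar> powr q) \<partial>M)"
    by (rule Liminf_le_Limsup) simp
  also have "\<dots> \<le> ennreal (B powr q)"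
  proof (rule Limsup_bounded, rule always_eventually, rule allI)
    fix N
    have "(\<integral>\<^sup>+x. ennreal (\<bar>g N x\<bar> powr q) \<partial>M) = ennreal (\<integral>x. \<bar>g N x\<bar> powr q \<partial>M)"
      using g[of N] by (intro nn_integral_eq_integral) auto
    also have "\<dots> \<le> ennreal (B powr q)"
      using B[of N] Lpnorm_le_iff[OF q B0, of M "g N"] by (intro ennreal_leI) auto
    finally show "(\<integral>\<^sup>+x. ennreal (\<bar>g N x\<bar> powr q) \<partial>M) \<le> ennreal (B powr q)" .
  qed
  finally have le: "(\<integral>\<^sup>+x. ennreal (\<bar>h x\<bar> powr q) \<partial>M) \<le> ennreal (B powr q)" .
  have i: "integrable M (\<lambda>x. \<bar>h x\<bar> powr q)"
    using le by (intro integrableI_bounded) (auto simp: le_less_trans)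
  then show "in_Lp M q h" using h by (simp add: in_Lp_def)
  have "ennreal (\<integral>x. \<bar>h x\<bar> powr q \<partial>M) = (\<integral>\<^sup>+x. ennreal (\<bar>h x\<bar> powr q) \<partial>M)"
    using i by (intro nn_integral_eq_integral[symmetric]) auto
  then have "ennreal (\<integral>x. \<bar>h x\<bar> powr q \<partial>M) \<le> ennreal (B powr q)" using le by metis
  then have "(\<integral>x. \<bar>h x\<bar> powr q \<partial>M) \<le> B powr q" by (subst (asm) ennreal_le_iff) auto
  then show "Lpnorm M q h \<le> B" using Lpnorm_le_iff[OF q B0, of M h] by simp
qed

text \<open>As in the Riesz-Fischer theorem: the sum of the absolute values has finite expectation,
  so the series converges a.e., and Fatou bounds its tails in norm. At q = 2 this produces
  D_0.\<close>

lemma (in prob_space) Lp_series_converges: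
  fixes f :: "nat \<Rightarrow> 'a \<Rightarrow> real"
  assumes f: "\<And>j. in_Lp M q (f j)" and q: "1 \<le> q" and s: "summable (\<lambda>j. Lpnorm M q (f j))"
  shows "\<exists>D. in_Lp M q D \<and> (\<lambda>n. Lpnorm M q (\<lambda>x. D x - (\<Sum>j<n. f j x))) \<longlonglongrightarrow> 0"
proof -
  have fm [measurable]: "f j \<in> borel_measurable M" for j using f[of j] by auto
  have "(\<integral>\<^sup>+x. (\<Sum>j. ennreal \<bar>f j x\<bar>) \<partial>M) = (\<Sum>j. \<integral>\<^sup>+x. ennreal \<bar>f j x\<bar> \<partial>M)"
    by (rule nn_integral_suminf) measurable
  also have "\<dots> \<le> (\<Sum>j. ennreal (Lpnorm M q (f j)))"
  proof (rule suminf_le)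
    fix j
    have "(\<integral>\<^sup>+x. ennreal \<bar>f j x\<bar> \<partial>M) = ennreal (\<integral>x. \<bar>f j x\<bar> \<partial>M)"
      using in_Lp_integrable[OF f q, of j] by (intro nn_integral_eq_integral) auto
    also have "\<dots> \<le> ennreal (Lpnorm M q (f j))"
      using Lpnorm_mono_exponent(2)[OF f, of 1 j] q by (intro ennreal_leI) (simp add: Lpnorm_1)
    finally show "(\<integral>\<^sup>+x. ennreal \<bar>f j x\<bar> \<partial>M) \<le> ennreal (Lpnorm M q (f j))" .
  qed auto
  also have "\<dots> = ennreal (\<Sum>j. Lpnorm M q (f j))"
    by (rule suminf_ennreal2[OF Lpnorm_nonneg s])
  finally have "(\<integral>\<^sup>+x. (\<Sum>j. ennreal \<bar>f j x\<bar>) \<partial>M) \<noteq> \<infinity>"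
    using ennreal_less_top le_less_trans by (metis infinity_ennreal_def order_less_irrefl)
  then have "AE x in M. (\<Sum>j. ennreal \<bar>f j x\<bar>) \<noteq> \<infinity>"
    by (intro nn_integral_PInf_AE) auto
  then have summ: "AE x in M. summable (\<lambda>j. f j x)"
  proof eventually_elim
    fix x assume "(\<Sum>j. ennreal \<bar>f j x\<bar>) \<noteq> \<infinity>"
    then have "summable (\<lambda>j. \<bar>f j x\<bar>)"
      by (intro summable_suminf_not_top abs_ge_zero) (simp only: infinity_ennreal_def not_False_eq_True)
    then show "summable (\<lambda>j. f j x)" by (rule summable_rabs_cancel)
  qed
  define D where "D x = (\<Sum>j. f j x)" for x
  have Dm [measurable]: "D \<in> borel_measurable M" unfolding D_def by measurable
  have lim: "AE x in M. (\<lambda>N. \<Sum>j<N. f (j + n) x) \<longlonglongrightarrow> D x - (\<Sum>j<n. f j x)" for n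
    using summ
  proof eventually_elim
    fix x assume "summable (\<lambda>j. f j x)"
    then have "(\<lambda>j. f j x) sums D x" unfolding D_def by (rule summable_sums)
    then have "(\<lambda>j. f (j + n) x) sums (D x - (\<Sum>j<n. f j x))" by (rule sums_split_initial_segment)
    then show "(\<lambda>N. \<Sum>j<N. f (j + n) x) \<longlonglongrightarrow> D x - (\<Sum>j<n. f j x)" by (simp add: sums_def)
  qed
  have bd: "Lpnorm M q (\<lambda>x. \<Sum>j<N. f (j + n) x) \<le> (\<Sum>j. Lpnorm M q (f (j + n)))" for n N
  proof -
    have "Lpnorm M q (\<lambda>x. \<Sum>j<N. f (j + n) x) \<le> (\<Sum>j<N. Lpnorm M q (f (j + n)))"
      by (intro Lpnorm_sum f q)
    also have "\<dots> \<le> (\<Sum>j. Lpnorm M q (f (j + n)))"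
      by (intro sum_le_suminf summable_ignore_initial_segment s) auto
    finally show ?thesis .
  qed
  have fL: "in_Lp M q (\<lambda>x. \<Sum>j<N. f (j + n) x)" for n N using q by (intro in_Lp_sum f) auto
  have mm: "(\<lambda>x. D x - (\<Sum>j<n. f j x)) \<in> borel_measurable M" for n by measurable
  note lims = in_Lp_AE_limit[OF fL mm lim bd]
  have "in_Lp M q D" using lims(1)[of 0] q by simp
  moreover have "(\<lambda>n. Lpnorm M q (\<lambda>x. D x - (\<Sum>j<n. f j x))) \<longlonglongrightarrow> 0"
  proof (rule real_tendsto_sandwich[OF _ _ tendsto_const])
    show "(\<lambda>n. \<Sum>j. Lpnorm M q (f (j + n))) \<longlonglongrightarrow> 0" by (rule suminf_exist_split2[OF s])
    show "\<forall>\<^sub>F n in sequentially. Lpnorm M q (\<lambda>x. D x - (\<Sum>j<n. f j x)) \<le> (\<Sum>j. Lpnorm M q (f (j + n)))"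
      using lims(2) q by simp
  qed auto
  ultimately show ?thesis by blast
qed

lemma Lpnorm_2_squared: "(Lpnorm M 2 f)\<^sup>2 = (\<integral>x. (f x)\<^sup>2 \<partial>M)"
proof -
  have "(Lpnorm M 2 f)\<^sup>2 = Lpnorm M 2 f powr 2" by simp
  also have "\<dots> = (\<integral>x. \<bar>f x\<bar> powr 2 \<partial>M)" by (rule Lpnorm_powr) simp
  finally show ?thesis by simp
qed

lemma in_Lp_2: "in_Lp M 2 f \<longleftrightarrow> f \<in> borel_measurable M \<and> integrable M (\<lambda>x. (f x)\<^sup>2)"
  by (simp add: in_Lp_def)

section \<open>The main estimate\<close>

context iid_sequence begin

context
  fixes p :: real and f :: "(nat \<Rightarrow> 'b) \<Rightarrow> real"
  assumes f: "in_Lp past_law (2 * p) f" and p: "1 < p"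
    and mean_zero: "(\<integral>u. f u \<partial>past_law) = 0" and summable_dep: "summable (dependence (2 * p) f)"
begin

abbreviation (input) "\<sigma>2 m \<equiv> (Lpnorm M 2 (mart_diff m f 0))\<^sup>2"

text \<open>Cauchy-Schwarz for W^2 - U^2 = (W - U)(W + U): with R of order sqrt l, the factors have
  norms at most R T + A and 2 R \<tau>. The product of the R terms is linear in l with a coefficient
  proportional to the dependence tail T; the cross term is of order sqrt l and is absorbed.\<close>

lemma square_sum_mart_approx:
  assumes e: "e > 0"
  shows "\<exists>C\<ge>0. \<forall>t l. Lpnorm M p (\<lambda>x. (\<Sum>n<l. Y f (t + int n) x)\<^sup>2 - (\<Sum>n<l. mart_diff m f (t + int n) x)\<^sup>2)
     \<le> (2 * moment_const (2 * p) * \<tau> p f * (\<Sum>j. dependence (2 * p) f (j + m)) + e) * real l + C"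
proof -
  let ?K = "moment_const (2 * p)"
  note ctx = f p mean_zero summable_dep
  define T where "T = (\<Sum>j. dependence (2 * p) f (j + m))"
  define A where "A = (\<Sum>j<m. 2 * real j * dependence (2 * p) f j)"
  have K: "?K \<ge> 0" using moment_const_ge_1[of "2 * p"] by simp
  have A: "A \<ge> 0" unfolding A_def by (intro sum_nonneg) auto
  have T: "T \<ge> 0" unfolding T_def using summable_dep
    by (intro suminf_nonneg) (auto simp: summable_iff_shift)
  note tau = tau_nonneg[OF ctx]
  obtain C where C: "C \<ge> 0" "\<And>l. (?K * real l) powr (1/2) * (2 * A * \<tau> p f) \<le> e * real l + C"
    using powr_sublinear_scaled[of "1/2" e ?K "2 * A * \<tau> p f"] e K A tau by auto
  have "Lpnorm M p (\<lambda>x. (\<Sum>n<l. Y f (t + int n) x)\<^sup>2 - (\<Sum>n<l. mart_diff m f (t + int n) x)\<^sup>2)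
     \<le> (2 * ?K * \<tau> p f * T + e) * real l + C" for t l
  proof -
    define W U where "W x = (\<Sum>n<l. Y f (t + int n) x)" and "U x = (\<Sum>n<l. mart_diff m f (t + int n) x)" for x
    define R where "R = (?K * real l) powr (1/2)"
    have R: "R \<ge> 0" "R * R = ?K * real l"
      using K by (auto simp: R_def powr_half_sqrt)
    have WL: "in_Lp M (2 * p) W" unfolding W_def by (rule Y_sum_in_Lp[OF ctx])
    have UL: "in_Lp M (2 * p) U" unfolding U_def by (rule mart_sum_in_Lp[OF ctx])
    have Wb: "Lpnorm M (2 * p) W \<le> R * \<tau> p f" unfolding W_def R_def by (rule mart_sum_sqrt_bound(2)[OF ctx])
    have Ub: "Lpnorm M (2 * p) U \<le> R * \<tau> p f" unfolding U_def R_def by (rule mart_sum_sqrt_bound(1)[OF ctx])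
    have Db: "Lpnorm M (2 * p) (\<lambda>x. W x - U x) \<le> R * T + A"
      using Lpnorm_mart_approx[OF f _ mean_zero summable_dep, where m = m and s = t and l = l] p
      unfolding W_def U_def R_def T_def A_def by (simp add: min_def)
    have DL: "in_Lp M (2 * p) (\<lambda>x. W x - U x)" using p by (intro in_Lp_diff WL UL) auto
    have SL: "in_Lp M (2 * p) (\<lambda>x. W x + U x)" using p by (intro in_Lp_add WL UL) auto
    have Sb: "Lpnorm M (2 * p) (\<lambda>x. W x + U x) \<le> R * \<tau> p f + R * \<tau> p f"
      using Lpnorm_triangle[OF WL UL] Wb Ub p by auto
    have "Lpnorm M p (\<lambda>x. (W x)\<^sup>2 - (U x)\<^sup>2) = Lpnorm M p (\<lambda>x. (W x - U x) * (W x + U x))"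
      by (simp add: power2_eq_square algebra_simps)
    also have "\<dots> \<le> Lpnorm M (2 * p) (\<lambda>x. W x - U x) * Lpnorm M (2 * p) (\<lambda>x. W x + U x)"
      using p by (intro in_Lp_mult(2) DL SL) auto
    also have "\<dots> \<le> (R * T + A) * (R * \<tau> p f + R * \<tau> p f)"
      using R T A tau by (intro mult_mono Db Sb) auto
    also have "\<dots> = 2 * (R * R) * \<tau> p f * T + R * (2 * A * \<tau> p f)" by (simp add: algebra_simps)
    also have "\<dots> \<le> 2 * (?K * real l) * \<tau> p f * T + (e * real l + C)"
      using C(2)[of l] R(2) by (simp add: R_def)
    also have "\<dots> = (2 * ?K * \<tau> p f * T + e) * real l + C" by (simp add: algebra_simps)
    finally show ?thesis unfolding W_def U_def .
  qed
  then show ?thesis using C(1) unfolding T_def by blast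
qed

text \<open>The squared martingale differences again form a stationary function of the past,
  attached to times moved by m, with integrable power p. The law of large numbers applies, and its
  centring is the second moment of the difference at time 0.\<close>

lemma sum_squares_mart_diff_LLN:
  assumes e: "e > 0"
  shows "\<exists>C\<ge>0. \<forall>t l. Lpnorm M p (\<lambda>x. (\<Sum>n<l. (mart_diff m f (t + int n) x)\<^sup>2) - real l * \<sigma>2 m) \<le> e * real l + C"
proof -
  have p2: "1 < 2 * p" using p by simp
  obtain h where h: "in_Lp past_law (2 * p) h" and AE: "\<And>k. AE x in M. mart_diff m f k x = Y h (k + int m) x"
    using mart_diff_stationary[OF f p2, of m] by blast
  have hm: "h \<in> borel_measurable Seq" by (rule in_Lp_past_law_measurable[OF h])
  then have h2m: "(\<lambda>u. (h u)\<^sup>2) \<in> borel_measurable Seq" by measurable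
  have h2: "in_Lp past_law p (\<lambda>u. (h u)\<^sup>2)"
    using in_Lp_mult(1)[OF h h] p by (simp add: power2_eq_square)
  have "\<sigma>2 m = (\<integral>x. (mart_diff m f 0 x)\<^sup>2 \<partial>M)" by (rule Lpnorm_2_squared)
  also have "\<dots> = (\<integral>x. (Y h (0 + int m) x)\<^sup>2 \<partial>M)"
  proof (rule integral_cong_AE)
    show "AE x in M. (mart_diff m f 0 x)\<^sup>2 = (Y h (0 + int m) x)\<^sup>2"
      using AE[of 0] by eventually_elim simp
  qed (use mart_diff_in_Lp[OF f p2] Y_measurable[OF hm] in auto)
  also have "\<dots> = (\<integral>u. (h u)\<^sup>2 \<partial>past_law)" by (rule integral_Y[OF _ hm]) simp
  finally have \<sigma>: "\<sigma>2 m = (\<integral>u. (h u)\<^sup>2 \<partial>past_law)" .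
  obtain C where C: "C \<ge> 0" "\<And>s l. Lpnorm M p (\<lambda>x. \<Sum>n<l. (Y (\<lambda>u. (h u)\<^sup>2) (s + int n) x - \<sigma>2 m)) \<le> e * real l + C"
    using law_of_large_numbers_Lp[OF h2 p e] unfolding \<sigma> by blast
  have "Lpnorm M p (\<lambda>x. (\<Sum>n<l. (mart_diff m f (t + int n) x)\<^sup>2) - real l * \<sigma>2 m) \<le> e * real l + C" for t l
  proof -
    have "AE x in M. \<forall>n. mart_diff m f (t + int n) x = Y h (t + int n + int m) x"
      unfolding AE_all_countable using AE by blast
    then have "AE x in M. (\<Sum>n<l. (mart_diff m f (t + int n) x)\<^sup>2) - real l * \<sigma>2 m
        = (\<Sum>n<l. (Y (\<lambda>u. (h u)\<^sup>2) (t + int m + int n) x - \<sigma>2 m))"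
      by eventually_elim (simp add: bern_proc_def sum_subtractf algebra_simps)
    then have "Lpnorm M p (\<lambda>x. (\<Sum>n<l. (mart_diff m f (t + int n) x)\<^sup>2) - real l * \<sigma>2 m)
        = Lpnorm M p (\<lambda>x. \<Sum>n<l. (Y (\<lambda>u. (h u)\<^sup>2) (t + int m + int n) x - \<sigma>2 m))"
    proof (rule Lpnorm_cong_AE)
      show "(\<lambda>x. (\<Sum>n<l. (mart_diff m f (t + int n) x)\<^sup>2) - real l * \<sigma>2 m) \<in> borel_measurable M"
        using in_Lp_measurable[OF mart_diff_in_Lp[OF f p2]] by measurable
      show "(\<lambda>x. \<Sum>n<l. (Y (\<lambda>u. (h u)\<^sup>2) (t + int m + int n) x - \<sigma>2 m)) \<in> borel_measurable M"
        using Y_measurable[OF h2m] by measurable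
    qed
    also have "\<dots> \<le> e * real l + C" by (rule C)
    finally show ?thesis .
  qed
  then show ?thesis using C(1) by blast
qed

text \<open>Here m is fixed. The only linear error that cannot be made arbitrarily small is the
  multiple of the dependence tail beyond m, which is why this term is kept explicit.\<close>

lemma main_estimate:
  fixes a :: "nat \<Rightarrow> int"
  assumes a: "block_partition a"
    and len: "filterlim (\<lambda>k. real (block_partition.len a k)) at_top sequentially"
    and ratio: "(\<lambda>k. (real (block_partition.len a k))\<^sup>2 / (\<Sum>j<k. (real (block_partition.len a j))\<^sup>2)) \<longlonglongrightarrow> 0"
    and e: "e > 0"
  shows "\<exists>C\<ge>0. \<forall>n\<ge>1. Lpnorm M p (\<lambda>x. Vn (Y f) a n x - real_of_int (vn a n) * \<sigma>2 m)
    \<le> (2 * moment_const (2 * p) * \<tau> p f * (\<Sum>j. dependence (2 * p) f (j + m)) + e) * real_of_int (vn a n) + C"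
proof -
  interpret block_partition a by (rule a)
  note ctx = f p mean_zero summable_dep
  have p2: "1 < 2 * p" and p1: "1 \<le> p" and p0: "0 \<le> p" using p by auto
  \<comment> \<open>Four shares: the martingale approximation, the diagonal law of large numbers,
    the constants C1 + C2 incurred at each of the n positions, and the off-diagonal part.\<close>
  define e' where "e' = e / 4"
  have e': "e' > 0" using e by (simp add: e'_def)
  define c where "c = 2 * moment_const (2 * p) * \<tau> p f * (\<Sum>j. dependence (2 * p) f (j + m))"
  define r where "r = min 2 p"
  have r: "r > 1" using p by (simp add: r_def)
  obtain C1 where C1: "C1 \<ge> 0" "\<And>t l. Lpnorm M p (\<lambda>x. (\<Sum>n<l. Y f (t + int n) x)\<^sup>2 - (\<Sum>n<l. mart_diff m f (t + int n) x)\<^sup>2) \<le> (c + e') * real l + C1"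
    using square_sum_mart_approx[OF e', of m] unfolding c_def by blast
  obtain C2 where C2: "C2 \<ge> 0" "\<And>t l. Lpnorm M p (\<lambda>x. (\<Sum>n<l. (mart_diff m f (t + int n) x)\<^sup>2) - real l * \<sigma>2 m) \<le> e' * real l + C2"
    using sum_squares_mart_diff_LLN[OF e', of m] by blast
  obtain C3 where C3: "C3 \<ge> 0" "\<And>n. n \<ge> 1 \<Longrightarrow> (C1 + C2) / e' * real n \<le> real_of_int (vn a n) + C3"
    using n_little_o_vn[OF len, of "(C1 + C2) / e'"] C1(1) C2(1) e' by auto
  define Q where "Q = moment_const p * ((moment_const (2 * p) + 1) * (\<tau> p f)\<^sup>2) powr r"
  have Q: "Q \<ge> 0" unfolding Q_def using moment_const_ge_1[of p] by auto
  \<comment> \<open>Chosen so that Q e4 \<le> e'^r, including the case Q = 0; the r-th root then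
    leaves e' v.\<close>
  define e4 where "e4 = e' powr r / (Q + 1)"
  have e4: "e4 > 0" using e' Q by (auto simp: e4_def)
  obtain C4 where C4: "C4 \<ge> 0" "\<And>n. n \<ge> 1 \<Longrightarrow> (\<Sum>k<Suc (block_index n). ((real (block_len n k))\<^sup>2) powr r) \<le> e4 * real_of_int (vn a n) powr r + C4"
    using block_len_powr_sum[OF ratio r e4] by auto
  define C where "C = e' * C3 + (Q * C4) powr (1 / r)"
  have C0: "C \<ge> 0" using e' C3 by (simp add: C_def)
  have "Lpnorm M p (\<lambda>x. Vn (Y f) a n x - real_of_int (vn a n) * \<sigma>2 m) \<le> (c + e) * real_of_int (vn a n) + C" if n: "n \<ge> 1" for n
  proof -
    define v where "v = real_of_int (vn a n)"
    have v0: "v \<ge> 0" using vn_ge[OF n] by (simp add: v_def)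
    define \<kappa> where "\<kappa> = Suc (block_index n)"
    define b where "b k = start k" for k
    define l where "l k = block_len n k" for k
    define W where "W k i x = (\<Sum>n<Suc i. Y f (b k + int n) x)" for k i x
    define U where "U k i x = (\<Sum>n<Suc i. mart_diff m f (b k + int n) x)" for k i x
    define S where "S k i x = (\<Sum>n<Suc i. (mart_diff m f (b k + int n) x)\<^sup>2)" for k i x
    have V: "Vn (Y f) a n x = (\<Sum>k<\<kappa>. \<Sum>i<l k. (W k i x)\<^sup>2)" for x
    proof -
      have "Vn (Y f) a n x = (\<Sum>k<\<kappa>. \<Sum>i<l k. (\<Sum>j\<in>{b k..b k + int i}. Y f j x)\<^sup>2)"
        unfolding Vn_def Wblk_def \<kappa>_def l_def b_def
        by (rule block_sum[OF n, of "\<lambda>t i. (\<Sum>j\<in>{t..i}. Y f j x)\<^sup>2"])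
      then show ?thesis unfolding W_def sum_int_interval' .
    qed
    have v: "v = (\<Sum>k<\<kappa>. \<Sum>i<l k. real (Suc i))"
      unfolding v_def vn_eq[OF n] \<kappa>_def l_def ..
    have nsum: "real n = (\<Sum>k<\<kappa>. \<Sum>i<l k. 1)"
      unfolding n_eq[OF n] \<kappa>_def l_def by simp
    define E where "E k i x = ((W k i x)\<^sup>2 - (U k i x)\<^sup>2) + (S k i x - real (Suc i) * \<sigma>2 m)" for k i x
    define Z where "Z x = (\<Sum>k<\<kappa>. off_diag m f (b k) (l k) x)" for x
    \<comment> \<open>\<open>E\<close> contains the replacement of X by the martingale differences
      and the centring of the diagonal, and is bounded position by position. \<open>Z\<close> must
      be treated as a whole, since only its sum over blocks is small.\<close>
    have dec: "Vn (Y f) a n x - v * \<sigma>2 m = (\<Sum>k<\<kappa>. \<Sum>i<l k. E k i x) + Z x" for x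
    proof -
      have "Z x = (\<Sum>k<\<kappa>. \<Sum>i<l k. (U k i x)\<^sup>2 - S k i x)"
        unfolding Z_def off_diag_def U_def S_def ..
      then show ?thesis
        unfolding V v E_def sum_distrib_right by (simp add: sum.distrib sum_subtractf)
    qed
    have sq: "in_Lp M p (\<lambda>x. (g x)\<^sup>2)" if "in_Lp M (2 * p) g" for g
      by (rule in_Lp_square(1)[OF ctx that])
    have WUL: "in_Lp M p (\<lambda>x. (W k i x)\<^sup>2 - (U k i x)\<^sup>2)" for k i
      unfolding W_def U_def by (intro in_Lp_diff sq Y_sum_in_Lp[OF ctx] mart_sum_in_Lp[OF ctx] p0)
    have SL: "in_Lp M p (\<lambda>x. S k i x - real (Suc i) * \<sigma>2 m)" for k i
      unfolding S_def by (intro in_Lp_diff in_Lp_sum sq mart_diff_in_Lp[OF f p2] p0) auto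
    have EL: "in_Lp M p (E k i)" for k i
      unfolding E_def[abs_def] by (intro in_Lp_add WUL SL p0)
    have ZL: "in_Lp M p Z"
      unfolding Z_def[abs_def] by (intro in_Lp_sum off_diag_in_Lp[OF ctx] p0)
    have Eb: "Lpnorm M p (E k i) \<le> (c + 2 * e') * real (Suc i) + (C1 + C2)" for k i
    proof -
      have "Lpnorm M p (E k i) \<le> Lpnorm M p (\<lambda>x. (W k i x)\<^sup>2 - (U k i x)\<^sup>2) + Lpnorm M p (\<lambda>x. S k i x - real (Suc i) * \<sigma>2 m)"
        unfolding E_def[abs_def] by (intro Lpnorm_triangle WUL SL p1)
      also have "\<dots> \<le> ((c + e') * real (Suc i) + C1) + (e' * real (Suc i) + C2)"
        unfolding W_def U_def S_def by (intro add_mono C1 C2)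
      finally show ?thesis by (simp add: algebra_simps)
    qed
    have "Lpnorm M p (\<lambda>x. Vn (Y f) a n x - v * \<sigma>2 m) \<le> Lpnorm M p (\<lambda>x. \<Sum>k<\<kappa>. \<Sum>i<l k. E k i x) + Lpnorm M p Z"
      unfolding dec by (intro Lpnorm_triangle in_Lp_sum EL ZL p1 p0)
    also have "Lpnorm M p (\<lambda>x. \<Sum>k<\<kappa>. \<Sum>i<l k. E k i x) \<le> (\<Sum>k<\<kappa>. Lpnorm M p (\<lambda>x. \<Sum>i<l k. E k i x))"
      by (intro Lpnorm_sum in_Lp_sum EL p1 p0)
    also have "\<dots> \<le> (\<Sum>k<\<kappa>. \<Sum>i<l k. Lpnorm M p (E k i))"
      by (intro sum_mono Lpnorm_sum EL p1)
    also have "\<dots> \<le> (\<Sum>k<\<kappa>. \<Sum>i<l k. (c + 2 * e') * real (Suc i) + (C1 + C2) * 1)"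
      using Eb by (intro sum_mono) simp
    also have "\<dots> = (c + 2 * e') * v + (C1 + C2) * real n"
      unfolding v nsum sum_distrib_left sum.distrib ..
    also have "(C1 + C2) * real n \<le> e' * v + e' * C3"
    proof -
      have "(C1 + C2) * real n = e' * ((C1 + C2) / e' * real n)" using e' by simp
      also have "\<dots> \<le> e' * (v + C3)" unfolding v_def using e' by (intro mult_left_mono C3(2)[OF n]) auto
      finally show ?thesis by (simp add: algebra_simps)
    qed
    also have "Lpnorm M p Z \<le> e' * v + (Q * C4) powr (1 / r)"
    proof -
      have "Lpnorm M p Z powr r \<le> Q * (\<Sum>k<\<kappa>. ((real (l k))\<^sup>2) powr r)"
        unfolding Z_def[abs_def] Q_def r_def
        by (rule off_diag_blocks_Lpnorm[OF ctx]) (unfold b_def l_def, rule start_block_len[OF n])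
      also have "\<dots> \<le> Q * (e4 * v powr r + C4)"
        unfolding \<kappa>_def l_def v_def using Q C4(2)[OF n] by (intro mult_left_mono)
      also have "\<dots> = (Q * e4) * v powr r + Q * C4" by (simp add: algebra_simps)
      also have "\<dots> \<le> e' powr r * v powr r + Q * C4"
      proof (intro add_right_mono mult_right_mono)
        have "Q * e4 \<le> (Q + 1) * e4" using e4 by simp
        also have "\<dots> = e' powr r" using Q by (simp add: e4_def)
        finally show "Q * e4 \<le> e' powr r" .
      qed simp
      also have "\<dots> = (e' * v) powr r + Q * C4" by (simp add: powr_mult)
      finally have "(Lpnorm M p Z powr r) powr (1 / r) \<le> ((e' * v) powr r + Q * C4) powr (1 / r)"
        using r by (intro powr_mono2) auto
      also have "\<dots> \<le> ((e' * v) powr r) powr (1 / r) + (Q * C4) powr (1 / r)"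
        using r Q C4(1) by (intro powr_add_subadditive) auto
      finally show ?thesis using r v0 e' by (simp add: powr_powr)
    qed
    finally show ?thesis unfolding v_def[symmetric] C_def by (simp add: e'_def algebra_simps)
  qed
  then show ?thesis using C0 unfolding c_def by blast
qed

end

end

section \<open>Removal of the truncation and convergence of V_n/v_n\<close>

theorem theorem1:
  fixes M :: "'a measure" and N :: "'b measure" and eps :: "int \<Rightarrow> 'a \<Rightarrow> 'b"
    and g :: "(nat \<Rightarrow> 'b) \<Rightarrow> real" and \<alpha> :: real and a :: "nat \<Rightarrow> int"
    and X :: "int \<Rightarrow> 'a \<Rightarrow> real" and P :: "int \<Rightarrow> ('a \<Rightarrow> real) \<Rightarrow> 'a \<Rightarrow> real"
  defines "X \<equiv> bern_proc eps g"
    and "P \<equiv> proj M N eps"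
  assumes "prob_space M"
    and "\<forall>i. eps i \<in> measurable M N"
    and "prob_space.indep_vars M (\<lambda>_. N) eps UNIV"
    and "\<forall>i. distr M N (eps i) = distr M N (eps 0)"
    and "g \<in> borel_measurable (PiM UNIV (\<lambda>_. N))"
    and "\<forall>i. (\<integral>x. X i x \<partial>M) = 0"
    and "\<alpha> > 2"
    and "\<forall>i. integrable M (\<lambda>x. \<bar>X i x\<bar> powr \<alpha>)"
    and "summable (\<lambda>i::nat. Lpnorm M \<alpha> (P 0 (X (int i))))"
    and "a 1 = 1"
    and "\<forall>k\<ge>1. a k < a (Suc k)"
    and "filterlim (\<lambda>m. real_of_int (a (Suc m) - a m)) at_top sequentially"
    and "(\<lambda>m. real_of_int ((a (Suc m) - a m)^2) / real_of_int (\<Sum>k\<in>{2..m}. (a k - a (k - 1))^2))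
           \<longlonglongrightarrow> 0"
  shows "(\<exists>D. D \<in> borel_measurable M \<and> integrable M (\<lambda>x. (D x)^2) \<and>
              (\<lambda>n. Lpnorm M 2 (\<lambda>x. D x - (\<Sum>i<n. P 0 (X (int i)) x))) \<longlonglongrightarrow> 0)
       \<and> (\<forall>D. D \<in> borel_measurable M \<and> integrable M (\<lambda>x. (D x)^2) \<and>
              (\<lambda>n. Lpnorm M 2 (\<lambda>x. D x - (\<Sum>i<n. P 0 (X (int i)) x))) \<longlonglongrightarrow> 0
            \<longrightarrow> (\<lambda>n. Lpnorm M (\<alpha> / 2) (\<lambda>x. Vn X a n x / real_of_int (vn a n) - (Lpnorm M 2 D)^2))
                 \<longlonglongrightarrow> 0)"
proof -
  interpret prob_space M by fact
  interpret iid_sequence M N eps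
    using assms(4-6) by unfold_locales auto
  interpret block_partition a
    using assms(12,13) by unfold_locales auto
  define p where "p = \<alpha> / 2"
  have \<alpha>: "\<alpha> = 2 * p" and p: "1 < p" using \<open>\<alpha> > 2\<close> by (auto simp: p_def)
  have p2: "1 < 2 * p" "1 \<le> 2 * p" and p1: "1 \<le> p" using p by auto
  have gm: "g \<in> borel_measurable Seq" by fact
  have X: "X = Y g" by (simp add: X_def fun_eq_iff)
  have f: "in_Lp past_law (2 * p) g"
  proof -
    have "in_Lp M (2 * p) (Y g 0)"
      using assms(10) Y_measurable[OF gm] by (auto simp: in_Lp_def X \<alpha>)
    then show ?thesis using in_Lp_Y[OF gm] by simp
  qed
  have mean_zero: "(\<integral>u. g u \<partial>past_law) = 0"
    using assms(8) integral_Y[of "\<lambda>x. x" g 0] gm by (simp add: X)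
  have dep: "dependence (2 * p) g = (\<lambda>i. Lpnorm M \<alpha> (P 0 (X (int i))))"
    by (simp add: dependence_def fun_eq_iff \<alpha> P_def X)
  have summable_dep: "summable (dependence (2 * p) g)" unfolding dep by fact
  have PL: "in_Lp M (2 * p) (P 0 (X (int i)))" for i
    unfolding P_def X by (intro proj_in_Lp in_Lp_Y' f p2)
  have PL2: "in_Lp M 2 (P 0 (X (int i)))" and P2le: "Lpnorm M 2 (P 0 (X (int i))) \<le> dependence (2 * p) g i" for i
    using Lpnorm_mono_exponent[OF PL, of 2 i] p by (auto simp: dep \<alpha>)
  have md: "mart_diff n g 0 x = (\<Sum>i<n. P 0 (X (int i)) x)" for n x
    by (simp add: mart_diff_def P_def X)
  have len_eq: "real (len k) = real_of_int (a (Suc (Suc k)) - a (Suc k))" for k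
    using int_len[of k] by (metis of_int_of_nat_eq)
  have len: "filterlim (\<lambda>k. real (len k)) at_top sequentially"
    unfolding len_eq using filterlim_compose[OF assms(14) filterlim_Suc] .
  \<comment> \<open>Blocks are numbered from 0, so the hypothesis is read along m = Suc k, and the
    index i from 2 on becomes j = i - 2.\<close>
  have ratio: "(\<lambda>k. (real (len k))\<^sup>2 / (\<Sum>j<k. (real (len j))\<^sup>2)) \<longlonglongrightarrow> 0"
  proof -
    have s: "(\<Sum>i\<in>{2..Suc k}. (a i - a (i - 1))^2) = (\<Sum>j<k. (a (Suc (Suc j)) - a (Suc j))\<^sup>2)" for k
    proof (rule sum.reindex_bij_witness[where i = "\<lambda>j. Suc (Suc j)" and j = "\<lambda>i. i - 2"])
      fix i assume "i \<in> {2..Suc k}"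
      then have "Suc (Suc (i - 2)) = i" "Suc (i - 2) = i - 1" by auto
      then show "(a (Suc (Suc (i - 2))) - a (Suc (i - 2)))\<^sup>2 = (a i - a (i - 1))\<^sup>2" by simp
    qed auto
    show ?thesis
      using filterlim_compose[OF assms(15) filterlim_Suc] unfolding s len_eq by simp
  qed
  have ex: "\<exists>D. D \<in> borel_measurable M \<and> integrable M (\<lambda>x. (D x)^2) \<and>
              (\<lambda>n. Lpnorm M 2 (\<lambda>x. D x - (\<Sum>i<n. P 0 (X (int i)) x))) \<longlonglongrightarrow> 0"
  proof -
    have "summable (\<lambda>i. Lpnorm M 2 (P 0 (X (int i))))"
      using P2le by (intro summable_comparison_test'[OF summable_dep]) auto
    then show ?thesis using Lp_series_converges[of 2 "\<lambda>i. P 0 (X (int i))"] PL2 by (auto simp: in_Lp_2)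
  qed
  have conv: "(\<lambda>n. Lpnorm M (\<alpha> / 2) (\<lambda>x. Vn X a n x / real_of_int (vn a n) - (Lpnorm M 2 D)^2)) \<longlonglongrightarrow> 0"
    if D: "D \<in> borel_measurable M" "integrable M (\<lambda>x. (D x)^2)"
      "(\<lambda>n. Lpnorm M 2 (\<lambda>x. D x - (\<Sum>i<n. P 0 (X (int i)) x))) \<longlonglongrightarrow> 0" for D
  proof -
    define \<sigma>2 where "\<sigma>2 = (Lpnorm M 2 D)\<^sup>2"
    define sm where "sm m = (Lpnorm M 2 (mart_diff m g 0))\<^sup>2" for m
    have DL: "in_Lp M 2 D" using D by (simp add: in_Lp_2)
    have mdL: "in_Lp M 2 (mart_diff m g 0)" for m
      unfolding md[abs_def] by (intro in_Lp_sum PL2) auto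
    \<comment> \<open>\<open>mart_diff m g 0\<close> is the m-th partial sum of the series for D_0,
      and \<sigma> depends on D only through its norm; so L^2 convergence suffices to identify
      \<sigma> for any limit D.\<close>
    have "(\<lambda>m. Lpnorm M 2 (mart_diff m g 0) - Lpnorm M 2 D) \<longlonglongrightarrow> 0"
    proof (rule Lim_null_comparison[OF _ D(3)], rule always_eventually, rule allI)
      fix m
      show "norm (Lpnorm M 2 (mart_diff m g 0) - Lpnorm M 2 D) \<le> Lpnorm M 2 (\<lambda>x. D x - (\<Sum>i<m. P 0 (X (int i)) x))"
        using Lpnorm_reverse_triangle[OF DL mdL, of m] unfolding md by (simp add: abs_minus_commute)
    qed
    then have "(\<lambda>m. Lpnorm M 2 (mart_diff m g 0)) \<longlonglongrightarrow> Lpnorm M 2 D" by (rule LIM_zero_cancel)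
    then have sm_lim: "sm \<longlonglongrightarrow> \<sigma>2" unfolding sm_def[abs_def] \<sigma>2_def by (rule tendsto_power)
    define c where "c m = 2 * moment_const (2 * p) * (\<Sum>j. dependence (2 * p) g j) * (\<Sum>j. dependence (2 * p) g (j + m))" for m
    have c_lim: "c \<longlonglongrightarrow> 0"
      unfolding c_def[abs_def] by (rule tendsto_mult_right_zero[OF suminf_exist_split2[OF summable_dep]])
    show ?thesis
    proof (rule LIMSEQ_I)
      fix e :: real assume e: "e > 0"
      \<comment> \<open>m is chosen before n. The four quarters of e go to the dependence tail, the
        distance of \<open>sm m\<close> from \<sigma>^2, the slack in the main estimate, and C /
        v_n, which is small because v_n \<ge> n.\<close>
      have "eventually (\<lambda>m. c m < e / 4 \<and> dist (sm m) \<sigma>2 < e / 4) sequentially"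
        using order_tendstoD(2)[OF c_lim, of "e/4"] tendstoD[OF sm_lim, of "e/4"] e
        by (intro eventually_conj) auto
      then obtain m where m: "c m < e / 4" "\<bar>sm m - \<sigma>2\<bar> < e / 4"
        by (auto simp: eventually_sequentially dist_real_def)
      obtain C where C: "C \<ge> 0" "\<And>n. n \<ge> 1 \<Longrightarrow> Lpnorm M p (\<lambda>x. Vn X a n x - real_of_int (vn a n) * sm m) \<le> (c m + e / 4) * real_of_int (vn a n) + C"
        using main_estimate[OF f p mean_zero summable_dep block_partition_axioms len ratio, of "e/4" m] e
        unfolding c_def sm_def X by auto
      obtain n0 where n0: "real n0 > 4 * C / e" using reals_Archimedean2 by blast
      show "\<exists>no. \<forall>n\<ge>no. norm (Lpnorm M (\<alpha> / 2) (\<lambda>x. Vn X a n x / real_of_int (vn a n) - (Lpnorm M 2 D)\<^sup>2) - 0) < e"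
      proof (intro exI[of _ "max n0 1"] allI impI)
        fix n assume "max n0 1 \<le> n"
        then have n: "n \<ge> 1" "n \<ge> n0" by auto
        define v where "v = real_of_int (vn a n)"
        have v: "v \<ge> real n" using vn_ge[OF n(1)] by (simp add: v_def)
        then have v0: "v > 0" using n by linarith
        have "real n \<ge> real n0" using n by simp
        then have "e * real n0 \<le> e * v" using v e by (intro mult_left_mono) auto
        moreover have "4 * C < e * real n0" using n0 e by (simp add: field_simps)
        ultimately have Cv: "C < e / 4 * v" by linarith
        have VL: "in_Lp M p (Vn X a n)"
        proof -
          have "in_Lp M p (\<lambda>x. (\<Sum>j\<in>J. Y g j x)\<^sup>2)" for J
            using p by (intro in_Lp_square(1)[OF f p mean_zero summable_dep] in_Lp_sum in_Lp_Y'[OF f]) auto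
          then show ?thesis unfolding Vn_def[abs_def] Wblk_def X using p by (intro in_Lp_sum) auto
        qed
        have DV: "in_Lp M p (\<lambda>x. Vn X a n x - v * sm m)"
          using p by (intro in_Lp_diff VL) auto
        have "Lpnorm M (\<alpha> / 2) (\<lambda>x. Vn X a n x / v - \<sigma>2)
          = Lpnorm M p (\<lambda>x. (1 / v) * (Vn X a n x - v * sm m) + (sm m - \<sigma>2))"
          using v0 by (simp add: p_def field_simps)
        also have "\<dots> \<le> Lpnorm M p (\<lambda>x. (1 / v) * (Vn X a n x - v * sm m)) + Lpnorm M p (\<lambda>x. sm m - \<sigma>2)"
          by (intro Lpnorm_triangle in_Lp_cmult DV p1) auto
        also have "\<dots> = Lpnorm M p (\<lambda>x. Vn X a n x - v * sm m) / v + \<bar>sm m - \<sigma>2\<bar>"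
          using p v0 by (subst Lpnorm_cmult) (auto simp: Lpnorm_const)
        also have "\<dots> < e"
        proof -
          have "Lpnorm M p (\<lambda>x. Vn X a n x - v * sm m) \<le> (c m + e / 4) * v + C"
            using C(2)[OF n(1)] by (simp add: v_def)
          also have "\<dots> < (e / 4 + e / 4) * v + e / 4 * v"
            using m(1) v0 Cv by (intro add_le_less_mono mult_right_mono) auto
          finally have "Lpnorm M p (\<lambda>x. Vn X a n x - v * sm m) / v < 3 * e / 4"
            using v0 by (simp add: field_simps)
          then show ?thesis using m(2) by linarith
        qed
        finally show "norm (Lpnorm M (\<alpha> / 2) (\<lambda>x. Vn X a n x / real_of_int (vn a n) - (Lpnorm M 2 D)\<^sup>2) - 0) < e"
          by (simp add: v_def \<sigma>2_def)
      qed
    qed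
  qed
  show ?thesis using ex conv by blast
qed

end
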